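(* Let $J\in\frac12\mathbb{N}$, $\Delta>1$, $L\ge2$, $\Lambda=[1,L]$, $\widetilde\Lambda=\Lambda\times[1,2J]$ and $M\in[-JL,JL]$. If $\psi\in\mathcal{H}(\widetilde\Lambda,M)$ and $\psi\perp\mathcal{G}(\widetilde\Lambda,M)$, then there are $\psi'\in\mathcal{H}_{0,\perp}(\widetilde\Lambda,M)$ and $\psi''\in\mathcal{H}_{\mathrm{exc}}(\widetilde\Lambda,M)$ such that $$P_\Lambda\psi=\psi'+\psi''.$$ Moreover (when $P_\Lambda\psi\ne0$), $$\frac{\langle P_\Lambda\psi|\widetilde{\widetilde H}_{\widetilde\Lambda}P_\Lambda\psi\rangle}{\langle P_\Lambda\psi|P_\Lambda\psi\rangle}\ \ge\ (1-\Delta^{-1})\left(1-\frac{\langle\psi'|P_\Lambda\psi'\rangle}{\langle\psi'|\psi'\rangle}\right),$$ where the ratio on the right is interpreted as zero if $\psi'=0$. Hence $$\gamma(\Lambda,J,M)\ \ge\ 2J(1-\Delta^{-1})\left(1-\sup_{0\neq\psi\in\mathcal{H}_{0,\perp}(\widetilde\Lambda,M)}\frac{\langle\psi|P_\Lambda\psi\rangle}{\langle\psi|\psi\rangle}\right).$$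
   Context: Intervals $[a,b]$ are discrete: $\{a,a+1,\dots,b\}$ (with $b-a$ an integer). $\frac12\mathbb{N}=\{\frac12,1,\frac32,\dots\}$. Spin chain. For spin $s$, with standard spin-$s$ matrices $S^1_u,S^2_u,S^3_u$ at each site $u$, set $$h^s(u,v)=s^2-S^3_uS^3_v-\Delta^{-1}(S^1_uS^1_v+S^2_uS^2_v)+s\sqrt{1-\Delta^{-2}}\,(S^3_u-S^3_v).$$ On $(\mathbb{C}^{2J+1})^{\otimes L}$ let $H^J_\Lambda=\sum_{\alpha=1}^{L-1}h^J(\alpha,\alpha+1)\ge0$. $\mathcal{H}(\Lambda,J,M)$ is the eigenspace of $\sum_{\alpha\in\Lambda}S^3_\alpha$ with eigenvalue $M$; in it $\ker H^J_\Lambda$ is one-dimensional and is denoted $\mathcal{G}(\Lambda,J,M)$. The gap is $$\gamma(\Lambda,J,M)=\inf\left\{\frac{\langle\psi|H^J_\Lambda\psi\rangle}{\langle\psi|\psi\rangle}:0\ne\psi\in\mathcal{H}(\Lambda,J,M),\ \psi\perp\mathcal{G}(\Lambda,J,M)\right\}.$$ Spin ladder. Put a spin-$\frac12$ space $\mathbb{C}^2$ at each $(\alpha,j)\in\widetilde\Lambda=\Lambda\times[1,2J]$. $\mathcal{H}(\widetilde\Lambda,M)$ is the subspace of $\bigotimes_{(\alpha,j)\in\widetilde\Lambda}\mathbb{C}^2$ on which $\sum_{(\alpha,j)}S^3_{(\alpha,j)}=M$. Define $$\widetilde H_{\widetilde\Lambda}=\sum_{\alpha=1}^{L-1}\sum_{j,k=1}^{2J}h^{1/2}((\alpha,j),(\alpha+1,k)),\qquad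 \widetilde{\widetilde H}_{\widetilde\Lambda}=\sum_{\alpha=1}^{L-1}\sum_{j=1}^{2J}h^{1/2}((\alpha,j),(\alpha+1,j)).$$ Both are nonnegative. $\mathcal{G}(\widetilde\Lambda,M)$ is the (one-dimensional) kernel of $\widetilde H_{\widetilde\Lambda}$ in $\mathcal{H}(\widetilde\Lambda,M)$; $\mathcal{H}_0(\widetilde\Lambda,M)$ is the kernel of $\widetilde{\widetilde H}_{\widetilde\Lambda}$ in $\mathcal{H}(\widetilde\Lambda,M)$, and contains $\mathcal{G}(\widetilde\Lambda,M)$; $\mathcal{H}_{\mathrm{exc}}(\widetilde\Lambda,M)$ is the orthogonal complement of $\mathcal{H}_0(\widetilde\Lambda,M)$ in $\mathcal{H}(\widetilde\Lambda,M)$; and $\mathcal{H}_{0,\perp}(\widetilde\Lambda,M)=\mathcal{H}_0(\widetilde\Lambda,M)\cap\mathcal{G}(\widetilde\Lambda,M)^\perp$. $P_\Lambda=\prod_{\alpha\in\Lambda}P_\alpha$, where $P_\alpha$ is the orthogonal projection onto the symmetric tensors (usual permutation action) in the factor $\bigotimes_{j=1}^{2J}\mathbb{C}^2_{(\alpha,j)}$ of rung $\alpha$. Conventions: an infimum over the empty set is $+\infty$, and the supremum is $0$ if $\mathcal{H}_{0,\perp}(\widetilde\Lambda,M)=\{0\}$. *)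

theory Defs
  imports
    Complex_Main
    "HOL-Library.FuncSet"
    "HOL-Library.Extended_Real"
    "HOL-Combinatorics.Permutations"
begin

definition half_nats :: "real set" where
  "half_nats = {real n / 2 | n. n \<ge> 1}"

definition dint :: "real \<Rightarrow> real \<Rightarrow> real set" where
  "dint a b = {x. \<exists>k::nat. x = a + real k \<and> x \<le> b}"

text \<open>The tensor product of one copy of $C^{2s+1}$ per site in the finite set V. The standard basis of
  $C^{2s+1}$ is labelled by the \<open>S\<^sup>3\<close>-eigenvalues \<open>-s, -s+1, \<dots>, s\<close>, so the product basis is
  labelled by the maps in \<open>configs V s\<close>, and a vector is its coefficient function, extended by
  zero to all other arguments.\<close>

type_synonym 'v vect = "('v \<Rightarrow> real) \<Rightarrow> complex"

definition configs :: "'v set \<Rightarrow> real \<Rightarrow> ('v \<Rightarrow> real) set" where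
  "configs V s = (V \<rightarrow>\<^sub>E dint (- s) s)"

definition tensor_space :: "'v set \<Rightarrow> real \<Rightarrow> 'v vect set" where
  "tensor_space V s = {\<psi>. \<forall>\<sigma>. \<sigma> \<notin> configs V s \<longrightarrow> \<psi> \<sigma> = 0}"

abbreviation zero_vect :: "'v vect" where
  "zero_vect \<equiv> (\<lambda>_. 0)"

definition braket :: "'v set \<Rightarrow> real \<Rightarrow> 'v vect \<Rightarrow> 'v vect \<Rightarrow> complex" where
  "braket V s \<phi> \<psi> = (\<Sum>\<sigma>\<in>configs V s. cnj (\<phi> \<sigma>) * \<psi> \<sigma>)"

definition orth_to :: "'v set \<Rightarrow> real \<Rightarrow> 'v vect \<Rightarrow> 'v vect set \<Rightarrow> bool" where
  "orth_to V s \<psi> W \<longleftrightarrow> (\<forall>\<phi>\<in>W. braket V s \<phi> \<psi> = 0)"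

definition orth_proj :: "'v set \<Rightarrow> real \<Rightarrow> 'v vect set \<Rightarrow> 'v vect \<Rightarrow> 'v vect" where
  "orth_proj V s W \<psi> = (THE \<phi>. \<phi> \<in> W \<and> orth_to V s (\<lambda>\<sigma>. \<psi> \<sigma> - \<phi> \<sigma>) W)"

text \<open>The real part only changes the type: the operators used below are self-adjoint.\<close>

definition rayleigh :: "'v set \<Rightarrow> real \<Rightarrow> ('v vect \<Rightarrow> 'v vect) \<Rightarrow> 'v vect \<Rightarrow> real" where
  "rayleigh V s A \<psi> = Re (braket V s \<psi> (A \<psi>)) / Re (braket V s \<psi> \<psi>)"

text \<open>Spin-s matrices. The row index m and the column index m' run over \<open>dint (- s) s\<close>, and
  \<open>spin_plus s m m'\<close> is the usual \<open>sqrt (s (s + 1) - m' (m' + 1))\<close> for \<open>m = m' + 1\<close>.\<close>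

definition spin_plus :: "real \<Rightarrow> real \<Rightarrow> real \<Rightarrow> complex" where
  "spin_plus s m m' = (if m = m' + 1 then complex_of_real (sqrt (s * (s + 1) - m' * (m' + 1))) else 0)"

definition spin_minus :: "real \<Rightarrow> real \<Rightarrow> real \<Rightarrow> complex" where
  "spin_minus s m m' = (if m = m' - 1 then complex_of_real (sqrt (s * (s + 1) - m' * (m' - 1))) else 0)"

definition spin1 :: "real \<Rightarrow> real \<Rightarrow> real \<Rightarrow> complex" where
  "spin1 s m m' = (spin_plus s m m' + spin_minus s m m') / 2"

definition spin2 :: "real \<Rightarrow> real \<Rightarrow> real \<Rightarrow> complex" where
  "spin2 s m m' = (spin_plus s m m' - spin_minus s m m') / (2 * \<i>)"

definition spin3 :: "real \<Rightarrow> real \<Rightarrow> real \<Rightarrow> complex" where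
  "spin3 s m m' = (if m = m' then complex_of_real m else 0)"

definition site_op :: "real \<Rightarrow> (real \<Rightarrow> real \<Rightarrow> complex) \<Rightarrow> 'v \<Rightarrow> 'v vect \<Rightarrow> 'v vect" where
  "site_op s A u \<psi> = (\<lambda>\<sigma>. \<Sum>m\<in>dint (- s) s. A (\<sigma> u) m * \<psi> (\<sigma>(u := m)))"

abbreviation S1 :: "real \<Rightarrow> 'v \<Rightarrow> 'v vect \<Rightarrow> 'v vect" where
  "S1 s \<equiv> site_op s (spin1 s)"

abbreviation S2 :: "real \<Rightarrow> 'v \<Rightarrow> 'v vect \<Rightarrow> 'v vect" where
  "S2 s \<equiv> site_op s (spin2 s)"

abbreviation S3 :: "real \<Rightarrow> 'v \<Rightarrow> 'v vect \<Rightarrow> 'v vect" where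
  "S3 s \<equiv> site_op s (spin3 s)"

definition h_op :: "real \<Rightarrow> real \<Rightarrow> 'v \<Rightarrow> 'v \<Rightarrow> 'v vect \<Rightarrow> 'v vect" where
  "h_op \<Delta> s u v \<psi> = (\<lambda>\<sigma>.
      complex_of_real (s\<^sup>2) * \<psi> \<sigma>
      - S3 s u (S3 s v \<psi>) \<sigma>
      - complex_of_real (1 / \<Delta>) * (S1 s u (S1 s v \<psi>) \<sigma> + S2 s u (S2 s v \<psi>) \<sigma>)
      + complex_of_real (s * sqrt (1 - 1 / \<Delta>\<^sup>2)) * (S3 s u \<psi> \<sigma> - S3 s v \<psi> \<sigma>))"

definition magnetization_space :: "'v set \<Rightarrow> real \<Rightarrow> real \<Rightarrow> 'v vect set" where
  "magnetization_space V s M =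
     {\<psi> \<in> tensor_space V s. (\<lambda>\<sigma>. \<Sum>u\<in>V. S3 s u \<psi> \<sigma>) = (\<lambda>\<sigma>. complex_of_real M * \<psi> \<sigma>)}"

subsection \<open>The spin chain\<close>

definition chain_ham :: "real \<Rightarrow> real \<Rightarrow> nat \<Rightarrow> nat vect \<Rightarrow> nat vect" where
  "chain_ham \<Delta> J L \<psi> = (\<lambda>\<sigma>. \<Sum>\<alpha>\<in>{1..L - 1}. h_op \<Delta> J \<alpha> (\<alpha> + 1) \<psi> \<sigma>)"

definition chain_space :: "real \<Rightarrow> nat \<Rightarrow> real \<Rightarrow> nat vect set" where
  "chain_space J L M = magnetization_space {1..L} J M"

definition chain_ground :: "real \<Rightarrow> real \<Rightarrow> nat \<Rightarrow> real \<Rightarrow> nat vect set" where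
  "chain_ground \<Delta> J L M = {\<psi> \<in> chain_space J L M. chain_ham \<Delta> J L \<psi> = zero_vect}"

definition gap :: "real \<Rightarrow> real \<Rightarrow> nat \<Rightarrow> real \<Rightarrow> ereal" where
  "gap \<Delta> J L M =
     (INF \<psi> \<in> {\<psi> \<in> chain_space J L M. \<psi> \<noteq> zero_vect \<and>
                   orth_to {1..L} J \<psi> (chain_ground \<Delta> J L M)}.
        ereal (rayleigh {1..L} J (chain_ham \<Delta> J L) \<psi>))"

subsection \<open>The spin ladder\<close>

definition legs :: "real \<Rightarrow> nat set" where
  "legs J = {1..nat \<lfloor>2 * J\<rfloor>}"

definition ladder :: "real \<Rightarrow> nat \<Rightarrow> (nat \<times> nat) set" where
  "ladder J L = {1..L} \<times> legs J"

abbreviation ladder_orth :: "real \<Rightarrow> nat \<Rightarrow> (nat \<times> nat) vect \<Rightarrow> (nat \<times> nat) vect set \<Rightarrow> bool" where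
  "ladder_orth J L \<equiv> orth_to (ladder J L) (1/2)"

abbreviation ladder_rayleigh ::
    "real \<Rightarrow> nat \<Rightarrow> ((nat \<times> nat) vect \<Rightarrow> (nat \<times> nat) vect) \<Rightarrow> (nat \<times> nat) vect \<Rightarrow> real" where
  "ladder_rayleigh J L \<equiv> rayleigh (ladder J L) (1/2)"

definition ladder_space :: "real \<Rightarrow> nat \<Rightarrow> real \<Rightarrow> (nat \<times> nat) vect set" where
  "ladder_space J L M = magnetization_space (ladder J L) (1/2) M"

definition ladder_ham_full :: "real \<Rightarrow> real \<Rightarrow> nat \<Rightarrow> (nat \<times> nat) vect \<Rightarrow> (nat \<times> nat) vect" where
  "ladder_ham_full \<Delta> J L \<psi> =
     (\<lambda>\<sigma>. \<Sum>\<alpha>\<in>{1..L - 1}. \<Sum>j\<in>legs J. \<Sum>k\<in>legs J. h_op \<Delta> (1/2) (\<alpha>, j) (\<alpha> + 1, k) \<psi> \<sigma>)"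

definition ladder_ham :: "real \<Rightarrow> real \<Rightarrow> nat \<Rightarrow> (nat \<times> nat) vect \<Rightarrow> (nat \<times> nat) vect" where
  "ladder_ham \<Delta> J L \<psi> =
     (\<lambda>\<sigma>. \<Sum>\<alpha>\<in>{1..L - 1}. \<Sum>j\<in>legs J. h_op \<Delta> (1/2) (\<alpha>, j) (\<alpha> + 1, j) \<psi> \<sigma>)"

definition ladder_ground :: "real \<Rightarrow> real \<Rightarrow> nat \<Rightarrow> real \<Rightarrow> (nat \<times> nat) vect set" where
  "ladder_ground \<Delta> J L M = {\<psi> \<in> ladder_space J L M. ladder_ham_full \<Delta> J L \<psi> = zero_vect}"

definition H0 :: "real \<Rightarrow> real \<Rightarrow> nat \<Rightarrow> real \<Rightarrow> (nat \<times> nat) vect set" where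
  "H0 \<Delta> J L M = {\<psi> \<in> ladder_space J L M. ladder_ham \<Delta> J L \<psi> = zero_vect}"

definition Hexc :: "real \<Rightarrow> real \<Rightarrow> nat \<Rightarrow> real \<Rightarrow> (nat \<times> nat) vect set" where
  "Hexc \<Delta> J L M = {\<psi> \<in> ladder_space J L M. ladder_orth J L \<psi> (H0 \<Delta> J L M)}"

definition H0_perp :: "real \<Rightarrow> real \<Rightarrow> nat \<Rightarrow> real \<Rightarrow> (nat \<times> nat) vect set" where
  "H0_perp \<Delta> J L M = {\<psi> \<in> H0 \<Delta> J L M. ladder_orth J L \<psi> (ladder_ground \<Delta> J L M)}"

text \<open>The permutation p sends the basis tensor labelled by \<open>\<tau>\<close> to the one labelled by
  \<open>\<tau> \<circ> inv p\<close>; on coefficient functions this is precomposition with p.\<close>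

definition sym_tensors :: "real \<Rightarrow> nat vect set" where
  "sym_tensors J = {\<psi> \<in> tensor_space (legs J) (1/2).
     \<forall>p. p permutes legs J \<longrightarrow> (\<forall>\<eta>. \<psi> (\<eta> \<circ> p) = \<psi> \<eta>)}"

text \<open>\<open>rung_slice \<alpha> \<sigma> \<psi>\<close> is the vector in the factor of rung \<open>\<alpha>\<close> obtained from \<open>\<psi>\<close> by
  fixing the labels on all other rungs as in \<open>\<sigma>\<close>. Thus \<open>rung_proj J \<alpha>\<close> is the tensor product of
  the projection on the factor of rung \<open>\<alpha>\<close> with the identity on the other factors.\<close>

definition rung_slice :: "nat \<Rightarrow> (nat \<times> nat \<Rightarrow> real) \<Rightarrow> (nat \<times> nat) vect \<Rightarrow> nat vect" where
  "rung_slice \<alpha> \<sigma> \<psi> = (\<lambda>\<eta>. \<psi> (\<lambda>(\<beta>, j). if \<beta> = \<alpha> then \<eta> j else \<sigma> (\<beta>, j)))"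

definition rung_proj :: "real \<Rightarrow> nat \<Rightarrow> (nat \<times> nat) vect \<Rightarrow> (nat \<times> nat) vect" where
  "rung_proj J \<alpha> \<psi> =
     (\<lambda>\<sigma>. orth_proj (legs J) (1/2) (sym_tensors J) (rung_slice \<alpha> \<sigma> \<psi>) (\<lambda>j. \<sigma> (\<alpha>, j)))"

text \<open>The factors act on different rungs and commute, so their order is immaterial.\<close>

definition P_lattice :: "real \<Rightarrow> nat \<Rightarrow> (nat \<times> nat) vect \<Rightarrow> (nat \<times> nat) vect" where
  "P_lattice J L = foldr (\<lambda>\<alpha> A. rung_proj J \<alpha> \<circ> A) [1..<L + 1] id"

text \<open>The Rayleigh quotients of a projection lie in \<open>[0, 1]\<close>, so the real supremum is the true one.\<close>

definition sup_overlap :: "real \<Rightarrow> real \<Rightarrow> nat \<Rightarrow> real \<Rightarrow> real" where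
  "sup_overlap \<Delta> J L M =
     (if H0_perp \<Delta> J L M = {zero_vect} then 0
      else SUP \<psi> \<in> H0_perp \<Delta> J L M - {zero_vect}. ladder_rayleigh J L (P_lattice J L) \<psi>)"

end

theory Submission
  imports Defs
begin

text \<open>Each spin-1/2 bond operator \<open>h\<close> is a projection, bonds without a common site commute, and neighbouring
  bonds of a leg satisfy \<open>h\<^sub>1 h\<^sub>2 h\<^sub>1 = (2 \<Delta>)\<^sup>-\<^sup>2 h\<^sub>1\<close>. Hence \<open>h\<^sub>1 h\<^sub>2 + h\<^sub>2 h\<^sub>1 \<ge> - (h\<^sub>1 + h\<^sub>2) / (2 \<Delta>)\<close>, and summing over all pairs of
  bonds gives \<open>H\<^sup>2 \<ge> (1 - 1 / \<Delta>) H\<close> for the Hamiltonian \<open>H\<close> of the uncoupled legs, that is, a gap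
  \<open>1 - 1 / \<Delta>\<close> above its kernel. A zero-energy vector of the fully coupled ladder is symmetric on every
  rung, because two spins of a rung can be exchanged through a spin of a neighbouring rung. So \<open>P\<close> preserves
  the orthogonal complement of \<open>\<G>\<close>, and if \<open>\<psi>'\<close> is the component of \<open>P \<psi>\<close> in \<open>ker H\<close>, then
  \<open>\<langle>\<psi>'|\<psi>'\<rangle> = \<langle>P \<psi>|P \<psi>'\<rangle>\<close>, whence Cauchy-Schwarz bounds the excited component of \<open>P \<psi>\<close> from below.
  For the chain, a spin \<open>J\<close> is the symmetric part of \<open>2 J\<close> spins 1/2; on symmetric vectors all \<open>2 J\<close> by \<open>2 J\<close> bonds
  between two rungs have the same energy, so the chain energy is \<open>2 J\<close> times that of the uncoupled legs.\<close>

section \<open>Finite-dimensional inner products\<close>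

text \<open>The gap needs no diagonalization: on a finite-dimensional space, a vector orthogonal to
  the kernel of the self-adjoint \<open>H\<close> has a preimage under \<open>H\<close>, and
  \<open>H\<^sup>2 \<ge> g H\<close> is applied to that preimage. The constant is a count: the
  product of two neighbouring bonds, in either order, costs at most
  \<open>1 / (4 * \<Delta>)\<close> times the sum of their energies, and a bond occurs in at most
  four ordered pairs of neighbours. The delicate point in the comparison with the chain is
  orthogonality. A chain vector orthogonal to the chain ground space must be sent to a ladder vector
  orthogonal to the ladder ground space. This requires every zero-energy vector of the coupled
  ladder to be the image of a zero-energy chain vector, so the symmetry of these vectors on the
  rungs is used a second time.\<close>

definition ip :: "'a set \<Rightarrow> ('a \<Rightarrow> complex) \<Rightarrow> ('a \<Rightarrow> complex) \<Rightarrow> complex" where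
  "ip C f g = (\<Sum>x\<in>C. cnj (f x) * g x)"

text \<open>\<open>ip\<close> takes an arbitrary index set because the existence of orthogonal
  projections is shown by induction on that set, and removing one point from
  \<open>configs V s\<close> leaves no set of this form.\<close>

lemma braket_ip: "braket V s = ip (configs V s)"
  by (intro ext) (simp add: braket_def ip_def)

lemma ip_add_left: "ip C (\<lambda>x. f x + g x) h = ip C f h + ip C g h"
  by (simp add: ip_def sum.distrib algebra_simps)

lemma ip_add_right: "ip C f (\<lambda>x. g x + h x) = ip C f g + ip C f h"
  by (simp add: ip_def sum.distrib algebra_simps)

lemma ip_diff_left: "ip C (\<lambda>x. f x - g x) h = ip C f h - ip C g h"
  by (simp add: ip_def sum_subtractf algebra_simps)

lemma ip_diff_right: "ip C f (\<lambda>x. g x - h x) = ip C f g - ip C f h"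
  by (simp add: ip_def sum_subtractf algebra_simps)

lemma ip_scale_left: "ip C (\<lambda>x. c * f x) g = cnj c * ip C f g"
  by (simp add: ip_def sum_distrib_left algebra_simps)

lemma ip_scale_right: "ip C f (\<lambda>x. c * g x) = c * ip C f g"
  by (simp add: ip_def sum_distrib_left algebra_simps)

lemma ip_sum_left: "ip C (\<lambda>x. \<Sum>i\<in>I. f i x) g = (\<Sum>i\<in>I. ip C (f i) g)"
  unfolding ip_def by (subst sum.swap) (simp add: sum_distrib_right)

lemma ip_sum_right: "ip C f (\<lambda>x. \<Sum>i\<in>I. g i x) = (\<Sum>i\<in>I. ip C f (g i))"
  unfolding ip_def by (subst sum.swap) (simp add: sum_distrib_left)

lemma ip_zero_left [simp]: "ip C (\<lambda>x. 0) g = 0"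
  and ip_zero_right [simp]: "ip C g (\<lambda>x. 0) = 0"
  by (simp_all add: ip_def)

lemma ip_commute: "ip C f g = cnj (ip C g f)"
  by (simp add: ip_def mult.commute)

lemma Re_ip_commute: "Re (ip C f g) = Re (ip C g f)"
  by (subst ip_commute) simp

lemma ip_self: "ip C f f = complex_of_real (\<Sum>x\<in>C. (cmod (f x))\<^sup>2)"
  by (simp add: ip_def mult.commute complex_norm_square del: of_real_power)

lemma ip_self_nonneg: "0 \<le> Re (ip C f f)"
  by (simp add: ip_self sum_nonneg)

lemma ip_self_eq_0:
  assumes "finite C" "Re (ip C f f) \<le> 0" "x \<in> C"
  shows "f x = 0"
proof -
  have "(\<Sum>x\<in>C. (cmod (f x))\<^sup>2) = 0"
    using assms(2) by (simp add: ip_self sum_nonneg order_antisym)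
  then show ?thesis
    using assms by (simp add: sum_nonneg_eq_0_iff)
qed

lemma ip_cong: "(\<And>x. x \<in> C \<Longrightarrow> f x = f' x) \<Longrightarrow> (\<And>x. x \<in> C \<Longrightarrow> g x = g' x) \<Longrightarrow> ip C f g = ip C f' g'"
  by (simp add: ip_def)

lemma ip_reindex:
  assumes "bij_betw p C C"
  shows "ip C (\<lambda>x. f (p x)) (\<lambda>x. g (p x)) = ip C f g"
  unfolding ip_def using sum.reindex_bij_betw[OF assms, of "\<lambda>x. cnj (f x) * g x"] by simp

section \<open>Linear subspaces, orthogonal projection and the abstract gap\<close>

definition lin_sub :: "('a \<Rightarrow> complex) set \<Rightarrow> bool" where
  "lin_sub W \<longleftrightarrow> (\<lambda>x. 0) \<in> W \<and> (\<forall>f\<in>W. \<forall>g\<in>W. (\<lambda>x. f x + g x) \<in> W) \<and>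
     (\<forall>c. \<forall>f\<in>W. (\<lambda>x. c * f x) \<in> W)"

lemma lin_sub_add: "lin_sub W \<Longrightarrow> f \<in> W \<Longrightarrow> g \<in> W \<Longrightarrow> (\<lambda>x. f x + g x) \<in> W"
  and lin_sub_scale: "lin_sub W \<Longrightarrow> f \<in> W \<Longrightarrow> (\<lambda>x. c * f x) \<in> W"
  and lin_sub_zero: "lin_sub W \<Longrightarrow> (\<lambda>x. 0) \<in> W"
  by (auto simp: lin_sub_def)

lemma lin_sub_diff: "lin_sub W \<Longrightarrow> f \<in> W \<Longrightarrow> g \<in> W \<Longrightarrow> (\<lambda>x. f x - g x) \<in> W"
  using lin_sub_add[of W f "\<lambda>x. -1 * g x"] lin_sub_scale[of W g "-1"] by simp

lemma lin_sub_sum: "finite I \<Longrightarrow> lin_sub W \<Longrightarrow> (\<And>i. i \<in> I \<Longrightarrow> f i \<in> W) \<Longrightarrow> (\<lambda>x. \<Sum>i\<in>I. f i x) \<in> W"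
proof (induction I rule: finite_induct)
  case empty
  then show ?case using lin_sub_zero[of W] by simp
next
  case (insert i I)
  then show ?case using lin_sub_add[of W "f i" "\<lambda>x. \<Sum>i\<in>I. f i x"] by simp
qed

text \<open>Induction on the support: passing from the subspace of vectors vanishing at \<open>c\<close> to all of
  \<open>W\<close> adds at most one dimension.\<close>

lemma orthogonal_projection_exists:
  assumes "finite C" "lin_sub W" "\<And>f x. f \<in> W \<Longrightarrow> x \<notin> C \<Longrightarrow> f x = 0"
  shows "\<exists>g\<in>W. \<forall>h\<in>W. ip C h (\<lambda>x. f x - g x) = 0"
  using assms
proof (induction C arbitrary: W f rule: finite_induct)
  case empty
  then show ?case by (intro bexI[of _ "\<lambda>x. 0"]) (auto simp: ip_def lin_sub_zero)
next
  case (insert c C)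
  define W0 where "W0 = {w\<in>W. w c = 0}"
  have W0: "lin_sub W0" "\<And>f x. f \<in> W0 \<Longrightarrow> x \<notin> C \<Longrightarrow> f x = 0"
    using insert.prems(1) insert.prems(2) by (auto simp: W0_def lin_sub_def) (metis insertE)
  have ex: "\<exists>g\<in>W0. \<forall>h\<in>W0. ip (insert c C) h (\<lambda>x. k x - g x) = 0" for k
  proof -
    obtain g where g: "g \<in> W0" "\<forall>h\<in>W0. ip C h (\<lambda>x. k x - g x) = 0"
      using insert.IH[of W0 k] W0 by blast
    have "ip (insert c C) h (\<lambda>x. k x - g x) = 0" if "h \<in> W0" for h
      using g that insert.hyps by (simp add: ip_def W0_def)
    then show ?thesis using g(1) by blast
  qed
  show ?case
  proof (cases "W = W0")
    case True
    then show ?thesis using ex by blast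
  next
    case False
    then obtain w where w: "w \<in> W" "w c \<noteq> 0" by (auto simp: W0_def)
    obtain w0 where w0: "w0 \<in> W0" "\<forall>h\<in>W0. ip (insert c C) h (\<lambda>x. w x - w0 x) = 0"
      using ex by blast
    \<comment> \<open>\<open>e\<close> spans the orthogonal complement of \<open>W0\<close> in
      \<open>W\<close>, so the projection on \<open>W\<close> is the projection on \<open>W0\<close>
      plus the component along \<open>e\<close>.\<close>
    define e where "e = (\<lambda>x. w x - w0 x)"
    have e: "e \<in> W" "e c \<noteq> 0" "\<And>h. h \<in> W0 \<Longrightarrow> ip (insert c C) h e = 0"
      using w w0 insert.prems by (auto simp: e_def W0_def lin_sub_diff)
    have e': "ip (insert c C) e e \<noteq> 0"
      using ip_self_eq_0[of "insert c C" e c] e insert.hyps by auto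
    obtain f0 where f0: "f0 \<in> W0" "\<forall>h\<in>W0. ip (insert c C) h (\<lambda>x. f x - f0 x) = 0"
      using ex by blast
    define a where "a = ip (insert c C) e f / ip (insert c C) e e"
    define g where "g = (\<lambda>x. f0 x + a * e x)"
    have gW: "g \<in> W"
      using f0 e insert.prems unfolding g_def
      by (intro lin_sub_add lin_sub_scale) (auto simp: W0_def)
    have expand: "ip (insert c C) h (\<lambda>x. f x - g x) =
        ip (insert c C) h (\<lambda>x. f x - f0 x) - a * ip (insert c C) h e" for h
      by (simp add: g_def ip_diff_right ip_add_right ip_scale_right)
    have g0: "ip (insert c C) h (\<lambda>x. f x - g x) = 0" if "h \<in> W0" for h
      using f0 e that by (simp add: expand)
    have ge: "ip (insert c C) e (\<lambda>x. f x - g x) = 0"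
    proof -
      have "ip (insert c C) e f0 = 0"
        using e(3)[OF f0(1)] ip_commute[of "insert c C" e f0] by simp
      then show ?thesis
        using e' by (subst expand) (simp add: ip_diff_right a_def)
    qed
    have "ip (insert c C) h (\<lambda>x. f x - g x) = 0" if h: "h \<in> W" for h
    proof -
      define h0 where "h0 = (\<lambda>x. h x - (h c / e c) * e x)"
      have "h0 \<in> W0"
        using e(2) lin_sub_diff[OF insert.prems(1) h lin_sub_scale[OF insert.prems(1) e(1), of "h c / e c"]]
        unfolding h0_def W0_def by simp
      moreover have "h = (\<lambda>x. h0 x + (h c / e c) * e x)"
        by (simp add: h0_def)
      then have "ip (insert c C) h k = ip (insert c C) h0 k + cnj (h c / e c) * ip (insert c C) e k" for k
        by (metis ip_add_left ip_scale_left)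
      ultimately show ?thesis by (simp add: g0 ge)
    qed
    then show ?thesis using gW by blast
  qed
qed

text \<open>With \<open>w = H v\<close>, positivity of \<open>H\<close> is applied to \<open>g v - w\<close>.\<close>

lemma spectral_gap:
  assumes "finite C" "lin_sub W" and supp: "\<And>f x. f \<in> W \<Longrightarrow> x \<notin> C \<Longrightarrow> f x = 0"
    and HW: "\<And>f. f \<in> W \<Longrightarrow> H f \<in> W"
    and Hadd: "\<And>f g. H (\<lambda>x. f x + g x) = (\<lambda>x. H f x + H g x)"
    and Hscale: "\<And>c f. H (\<lambda>x. c * f x) = (\<lambda>x. c * H f x)"
    and sa: "\<And>f g. f \<in> W \<Longrightarrow> g \<in> W \<Longrightarrow> ip C (H f) g = ip C f (H g)"
    and pos: "\<And>f. f \<in> W \<Longrightarrow> 0 \<le> Re (ip C f (H f))"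
    and "g > 0" and sq: "\<And>f. f \<in> W \<Longrightarrow> g * Re (ip C f (H f)) \<le> Re (ip C (H f) (H f))"
    and w: "w \<in> W" "\<And>k. k \<in> W \<Longrightarrow> H k = (\<lambda>x. 0) \<Longrightarrow> ip C k w = 0"
  shows "g * Re (ip C w w) \<le> Re (ip C w (H w))"
proof -
  have H0: "H (\<lambda>x. 0) = (\<lambda>x. 0)" using Hscale[of 0 "\<lambda>x. 0"] by simp
  have "lin_sub (H ` W)"
    unfolding lin_sub_def
  proof (intro conjI ballI allI)
    show "(\<lambda>x. 0) \<in> H ` W" using H0 assms(2) by (metis lin_sub_zero image_eqI)
  next
    fix a b assume "a \<in> H ` W" "b \<in> H ` W"
    then obtain f g where "a = H f" "b = H g" "f \<in> W" "g \<in> W" by auto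
    then show "(\<lambda>x. a x + b x) \<in> H ` W"
      using Hadd[of f g] lin_sub_add[OF assms(2), of f g] by (metis image_eqI)
  next
    fix c a assume "a \<in> H ` W"
    then obtain f where "a = H f" "f \<in> W" by auto
    then show "(\<lambda>x. c * a x) \<in> H ` W"
      using Hscale[of c f] lin_sub_scale[OF assms(2), of f c] by (metis image_eqI)
  qed
  then obtain u where u: "u \<in> H ` W" "\<forall>h\<in>H ` W. ip C h (\<lambda>x. w x - u x) = 0"
    using orthogonal_projection_exists[of C "H ` W" w] assms(1) HW supp by blast
  then obtain v where v: "v \<in> W" "u = H v" by blast
  \<comment> \<open>The residual is orthogonal to the range of \<open>H\<close>, in particular to
    \<open>H (H r)\<close>, so \<open>H r = 0\<close> by self-adjointness. Then \<open>r\<close> is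
    orthogonal to \<open>w\<close> by hypothesis and to \<open>u\<close> by construction, hence
    zero, and \<open>w\<close> lies in the range.\<close>
  define r where "r = (\<lambda>x. w x - u x)"
  have r: "r \<in> W" using w v HW assms(2) by (auto simp: r_def intro!: lin_sub_diff)
  have "ip C (H r) (H r) = 0"
    using u(2) sa[of "H r" r] HW[OF r] r by (simp add: r_def)
  then have "H r x = 0" for x
    using ip_self_eq_0[OF assms(1), of "H r" x] supp[OF HW[OF r], of x] by (cases "x \<in> C") auto
  then have "ip C r w = 0" using w r by blast
  moreover have "ip C r u = 0" using bspec[OF u(2) u(1)] ip_commute[of C r u] by (simp add: r_def)
  ultimately have "ip C r r = 0" unfolding r_def by (simp add: ip_diff_right)
  then have "r x = 0" for x
    using ip_self_eq_0[OF assms(1), of r x] supp[OF r, of x] by (cases "x \<in> C") auto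
  then have wv: "w = H v" by (auto simp: r_def v fun_eq_iff)
  define z where "z = (\<lambda>x. complex_of_real g * v x + (-1) * w x)"
  have Hz: "H z = (\<lambda>x. complex_of_real g * w x + (-1) * H w x)"
    unfolding z_def Hadd Hscale using wv by simp
  have "z \<in> W" unfolding z_def using v w assms(2) by (intro lin_sub_add lin_sub_scale)
  then have "0 \<le> Re (ip C z (H z))" by (rule pos)
  also have "\<dots> = g * g * Re (ip C v w) - g * Re (ip C v (H w)) - g * Re (ip C w w) + Re (ip C w (H w))"
    unfolding Hz unfolding z_def
    by (simp only: ip_add_left ip_add_right ip_scale_left ip_scale_right) (simp add: algebra_simps)
  also have "ip C v (H w) = ip C w w" using sa[OF v(1) w(1)] wv by simp
  finally have "0 \<le> g * (g * Re (ip C v w)) - 2 * g * Re (ip C w w) + Re (ip C w (H w))" by simp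
  moreover have "g * Re (ip C v w) \<le> Re (ip C w w)" using sq[OF v(1)] wv by simp
  then have "g * (g * Re (ip C v w)) \<le> g * Re (ip C w w)" using \<open>g > 0\<close> by simp
  ultimately show ?thesis by linarith
qed

section \<open>Spin operators\<close>

lemma finite_dint [simp]: "finite (dint a b)"
proof -
  have "dint a b \<subseteq> (\<lambda>k. a + real k) ` {..nat \<lfloor>b - a\<rfloor>}"
  proof
    fix x assume "x \<in> dint a b"
    then obtain k where k: "x = a + real k" "x \<le> b" by (auto simp: dint_def)
    then have "k \<le> nat \<lfloor>b - a\<rfloor>" by (simp add: le_nat_floor)
    then show "x \<in> (\<lambda>k. a + real k) ` {..nat \<lfloor>b - a\<rfloor>}" using k by auto
  qed
  then show ?thesis by (rule finite_subset) simp
qed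

lemma finite_configs [simp]: "finite V \<Longrightarrow> finite (configs V s)"
  by (simp add: configs_def finite_PiE)

lemma dint_half: "dint (- (1/2)) (1/2) = {- (1/2), 1/2}"
proof -
  have "x = - (1/2) \<or> x = 1/2" if "x = - (1/2) + real k" "x \<le> 1/2" for x and k :: nat
  proof -
    have "k = 0 \<or> k = 1" using that by linarith
    then show ?thesis using that by auto
  qed
  moreover have "\<exists>k. - (1/2) = - (1/2) + real k \<and> - (1/2) \<le> (1/2::real)"
    by (rule exI[of _ 0]) simp
  moreover have "\<exists>k. 1/2 = - (1/2) + real k \<and> 1/2 \<le> (1/2::real)"
    by (rule exI[of _ 1]) simp
  ultimately show ?thesis unfolding dint_def by auto
qed

lemma configs_half_cases:
  assumes "\<sigma> \<in> configs V (1/2)" "u \<in> V"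
  obtains "\<sigma> u = - (1/2)" | "\<sigma> u = 1/2"
proof -
  have "\<sigma> u \<in> dint (- (1/2)) (1/2)" using assms by (auto simp: configs_def)
  then show ?thesis using that by (auto simp: dint_half)
qed

lemma configs_upd: "\<sigma> \<in> configs V s \<Longrightarrow> u \<in> V \<Longrightarrow> m \<in> dint (- s) s \<Longrightarrow> \<sigma>(u := m) \<in> configs V s"
  by (auto simp: configs_def PiE_def extensional_def)

lemma configs_val: "\<sigma> \<in> configs V s \<Longrightarrow> u \<in> V \<Longrightarrow> \<sigma> u \<in> dint (- s) s"
  by (auto simp: configs_def)

lemma configs_upd_half:
  "\<sigma> \<in> configs V (1/2) \<Longrightarrow> u \<in> V \<Longrightarrow> m = - (1/2) \<or> m = 1/2 \<Longrightarrow> \<sigma>(u := m) \<in> configs V (1/2)"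
  by (rule configs_upd) (auto simp: dint_half)

lemma not_configs_upd:
  assumes "\<sigma> \<notin> configs V s" "u \<in> V" "\<sigma> u \<in> dint (- s) s"
  shows "\<sigma>(u := m) \<notin> configs V s"
  using assms configs_upd[of "\<sigma>(u := m)" V s u "\<sigma> u"] by auto

section \<open>Action of the spin matrices on coefficient functions\<close>

lemma tensor_space_vanish: "\<psi> \<in> tensor_space V s \<Longrightarrow> \<sigma> \<notin> configs V s \<Longrightarrow> \<psi> \<sigma> = 0"
  by (simp add: tensor_space_def)

text \<open>For an inadmissible label the defining sum is zero, but so is
  \<open>\<psi> \<sigma>\<close>. The formula therefore holds for every label function and needs no
  side condition on \<open>\<sigma>\<close>.\<close>

lemma S3_apply:
  assumes "u \<in> V" "\<psi> \<in> tensor_space V s"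
  shows "S3 s u \<psi> \<sigma> = complex_of_real (\<sigma> u) * \<psi> \<sigma>"
proof (cases "\<sigma> u \<in> dint (- s) s")
  case True
  have "S3 s u \<psi> \<sigma> = (\<Sum>m\<in>dint (- s) s. if \<sigma> u = m then complex_of_real m * \<psi> (\<sigma>(u := m)) else 0)"
    unfolding site_op_def by (intro sum.cong refl) (simp add: spin3_def)
  also have "\<dots> = complex_of_real (\<sigma> u) * \<psi> \<sigma>" using True by (subst sum.delta') simp_all
  finally show ?thesis .
next
  case False
  then have "\<sigma> \<notin> configs V s" using configs_val assms(1) by metis
  then have "\<psi> \<sigma> = 0" by (rule tensor_space_vanish[OF assms(2)])
  moreover have "S3 s u \<psi> \<sigma> = 0"
    unfolding site_op_def
  proof (intro sum.neutral ballI)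
    fix m assume "m \<in> dint (- s) s"
    then have "\<sigma> u \<noteq> m" using False by metis
    then show "spin3 s (\<sigma> u) m * \<psi> (\<sigma>(u := m)) = 0" by (simp add: spin3_def)
  qed
  ultimately show ?thesis by simp
qed

text \<open>No boundary term appears at the lowest label: there \<open>\<sigma> u - 1\<close> is
  inadmissible, the defining sum has no nonzero term, and \<open>\<psi>\<close> vanishes at the
  updated argument.\<close>

lemma S_plus_apply:
  assumes "u \<in> V" "\<psi> \<in> tensor_space V s"
  shows "site_op s (spin_plus s) u \<psi> \<sigma> =
    complex_of_real (sqrt (s * (s + 1) - (\<sigma> u - 1) * \<sigma> u)) * \<psi> (\<sigma>(u := \<sigma> u - 1))" (is "_ = ?rhs")
proof (cases "\<sigma> u - 1 \<in> dint (- s) s")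
  case True
  have "site_op s (spin_plus s) u \<psi> \<sigma> = (\<Sum>m\<in>dint (- s) s. if \<sigma> u - 1 = m then
    complex_of_real (sqrt (s * (s + 1) - m * (m + 1))) * \<psi> (\<sigma>(u := m)) else 0)"
    unfolding site_op_def
  proof (intro sum.cong refl)
    fix m
    show "spin_plus s (\<sigma> u) m * \<psi> (\<sigma>(u := m)) = (if \<sigma> u - 1 = m then
        complex_of_real (sqrt (s * (s + 1) - m * (m + 1))) * \<psi> (\<sigma>(u := m)) else 0)"
      by (cases "\<sigma> u = m + 1") (simp_all add: spin_plus_def eq_diff_eq diff_eq_eq)
  qed
  also have "\<dots> = ?rhs" using True by (subst sum.delta') simp_all
  finally show ?thesis .
next
  case False
  then have "\<sigma>(u := \<sigma> u - 1) \<notin> configs V s"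
    using configs_val[of "\<sigma>(u := \<sigma> u - 1)" V s u] assms(1) by (metis fun_upd_same)
  then have "\<psi> (\<sigma>(u := \<sigma> u - 1)) = 0" by (rule tensor_space_vanish[OF assms(2)])
  moreover have "site_op s (spin_plus s) u \<psi> \<sigma> = 0"
    unfolding site_op_def
  proof (intro sum.neutral ballI)
    fix m assume "m \<in> dint (- s) s"
    then have "\<sigma> u \<noteq> m + 1" using False by (metis add_diff_cancel_right')
    then show "spin_plus s (\<sigma> u) m * \<psi> (\<sigma>(u := m)) = 0" by (simp add: spin_plus_def)
  qed
  ultimately show ?thesis by simp
qed

lemma S_minus_apply:
  assumes "u \<in> V" "\<psi> \<in> tensor_space V s"
  shows "site_op s (spin_minus s) u \<psi> \<sigma> =
    complex_of_real (sqrt (s * (s + 1) - (\<sigma> u + 1) * \<sigma> u)) * \<psi> (\<sigma>(u := \<sigma> u + 1))" (is "_ = ?rhs")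
proof (cases "\<sigma> u + 1 \<in> dint (- s) s")
  case True
  have "site_op s (spin_minus s) u \<psi> \<sigma> = (\<Sum>m\<in>dint (- s) s. if \<sigma> u + 1 = m then
    complex_of_real (sqrt (s * (s + 1) - m * (m - 1))) * \<psi> (\<sigma>(u := m)) else 0)"
    unfolding site_op_def
  proof (intro sum.cong refl)
    fix m
    show "spin_minus s (\<sigma> u) m * \<psi> (\<sigma>(u := m)) = (if \<sigma> u + 1 = m then
        complex_of_real (sqrt (s * (s + 1) - m * (m - 1))) * \<psi> (\<sigma>(u := m)) else 0)"
      by (cases "\<sigma> u = m - 1") (simp_all add: spin_minus_def eq_diff_eq diff_eq_eq)
  qed
  also have "\<dots> = ?rhs" using True by (subst sum.delta') simp_all
  finally show ?thesis .
next
  case False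
  then have "\<sigma>(u := \<sigma> u + 1) \<notin> configs V s"
    using configs_val[of "\<sigma>(u := \<sigma> u + 1)" V s u] assms(1) by (metis fun_upd_same)
  then have "\<psi> (\<sigma>(u := \<sigma> u + 1)) = 0" by (rule tensor_space_vanish[OF assms(2)])
  moreover have "site_op s (spin_minus s) u \<psi> \<sigma> = 0"
    unfolding site_op_def
  proof (intro sum.neutral ballI)
    fix m assume "m \<in> dint (- s) s"
    then have "\<sigma> u \<noteq> m - 1" using False by (metis diff_add_cancel)
    then show "spin_minus s (\<sigma> u) m * \<psi> (\<sigma>(u := m)) = 0" by (simp add: spin_minus_def)
  qed
  ultimately show ?thesis by simp
qed

lemma site_op_spin1:
  "site_op s (spin1 s) u \<psi> \<sigma> = (site_op s (spin_plus s) u \<psi> \<sigma> + site_op s (spin_minus s) u \<psi> \<sigma>) / 2"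
  unfolding site_op_def sum.distrib[symmetric] sum_divide_distrib
  by (intro sum.cong) (simp_all add: spin1_def field_simps)

lemma site_op_spin2:
  "site_op s (spin2 s) u \<psi> \<sigma> = (site_op s (spin_plus s) u \<psi> \<sigma> - site_op s (spin_minus s) u \<psi> \<sigma>) / (2 * \<i>)"
  unfolding site_op_def sum_subtractf[symmetric] sum_divide_distrib
  by (intro sum.cong) (simp_all add: spin2_def field_simps)

lemma dint_spin:
  assumes "2 * s = real n"
  shows "dint (- s) s = (\<lambda>k. real k - s) ` {..n}"
  using assms by (auto simp: dint_def image_iff intro!: bexI)

text \<open>A raising or lowering operator could leave the tensor space only by a step beyond
  \<open>s\<close> or \<open>- s\<close>, and its matrix element vanishes exactly there. That
  \<open>2 * s\<close> is a natural number makes \<open>s\<close> the top label.\<close>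

lemma site_op_outside:
  assumes "2 * s = real n" "u \<in> V" "\<psi> \<in> tensor_space V s" "\<sigma> \<notin> configs V s"
  shows "site_op s (spin_plus s) u \<psi> \<sigma> = 0" "site_op s (spin_minus s) u \<psi> \<sigma> = 0"
    "site_op s (spin3 s) u \<psi> \<sigma> = 0"
proof -
  \<comment> \<open>If the label at \<open>u\<close> is admissible, \<open>\<sigma>\<close> fails to
    be a configuration for a reason away from \<open>u\<close>, which an update at \<open>u\<close>
    cannot repair.\<close>
  have inside: "\<psi> (\<sigma>(u := m)) = 0" if "\<sigma> u \<in> dint (- s) s" for m
    using not_configs_upd[OF assms(4,2) that] assms(3) by (simp add: tensor_space_def)
  have up: "m = s" if m: "m \<in> dint (- s) s" "m + 1 \<notin> dint (- s) s" for m
  proof -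
    obtain k where k: "k \<le> n" "m = real k - s" using m dint_spin[OF assms(1)] by auto
    have "\<not> Suc k \<le> n"
    proof
      assume "Suc k \<le> n"
      then have "m + 1 \<in> (\<lambda>k. real k - s) ` {..n}" using k by (intro image_eqI[of _ _ "Suc k"]) auto
      then show False using m dint_spin[OF assms(1)] by simp
    qed
    then show ?thesis using k assms(1) by simp
  qed
  have dn: "m = - s" if m: "m \<in> dint (- s) s" "m - 1 \<notin> dint (- s) s" for m
  proof -
    obtain k where k: "k \<le> n" "m = real k - s" using m dint_spin[OF assms(1)] by auto
    have "k = 0"
    proof (rule ccontr)
      assume "k \<noteq> 0"
      then have "m - 1 \<in> (\<lambda>k. real k - s) ` {..n}" using k by (intro image_eqI[of _ _ "k - 1"]) auto
      then show False using m dint_spin[OF assms(1)] by simp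
    qed
    then show ?thesis using k by simp
  qed
  have "spin_plus s (\<sigma> u) m * \<psi> (\<sigma>(u := m)) = 0" if "m \<in> dint (- s) s" for m
    using inside up[of m] that by (cases "\<sigma> u \<in> dint (- s) s") (auto simp: spin_plus_def algebra_simps)
  then show "site_op s (spin_plus s) u \<psi> \<sigma> = 0" unfolding site_op_def by (intro sum.neutral ballI)
  have "spin_minus s (\<sigma> u) m * \<psi> (\<sigma>(u := m)) = 0" if "m \<in> dint (- s) s" for m
    using inside dn[of m] that by (cases "\<sigma> u \<in> dint (- s) s") (auto simp: spin_minus_def algebra_simps)
  then show "site_op s (spin_minus s) u \<psi> \<sigma> = 0" unfolding site_op_def by (intro sum.neutral ballI)
  show "site_op s (spin3 s) u \<psi> \<sigma> = 0"
    using assms by (simp add: S3_apply[OF assms(2,3)] tensor_space_def)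
qed

lemma site_op_tensor_space:
  assumes "2 * s = real n" "u \<in> V" "\<psi> \<in> tensor_space V s"
  shows "S1 s u \<psi> \<in> tensor_space V s" "S2 s u \<psi> \<in> tensor_space V s" "S3 s u \<psi> \<in> tensor_space V s"
  using site_op_outside[OF assms] by (auto simp: tensor_space_def site_op_spin1 site_op_spin2)

text \<open>Reduces identities between products of bond operators to their values at configurations,
  since both sides vanish elsewhere.\<close>

lemma h_op_tensor_space:
  assumes "2 * s = real n" "u \<in> V" "v \<in> V" "\<psi> \<in> tensor_space V s"
  shows "h_op \<Delta> s u v \<psi> \<in> tensor_space V s"
proof -
  note T = site_op_tensor_space[OF assms(1)]
  have "h_op \<Delta> s u v \<psi> \<sigma> = 0" if "\<sigma> \<notin> configs V s" for \<sigma>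
    unfolding h_op_def using assms T(1)[OF assms(2) T(1)[OF assms(3,4)]] T(2)[OF assms(2) T(2)[OF assms(3,4)]]
      T(3)[OF assms(2) T(3)[OF assms(3,4)]] T(3)[OF assms(2,4)] T(3)[OF assms(3,4)]
    by (simp only: tensor_space_vanish[OF _ that]) simp
  then show ?thesis by (simp add: tensor_space_def)
qed

section \<open>Explicit form of the bond for spin 1/2\<close>

abbreviation swap :: "'v \<Rightarrow> 'v \<Rightarrow> ('v \<Rightarrow> real) \<Rightarrow> ('v \<Rightarrow> real)" where
  "swap u v \<sigma> \<equiv> \<sigma>(u := \<sigma> v, v := \<sigma> u)"

lemma sum_dint_half: "(\<Sum>m\<in>dint (- (1/2)) (1/2). f m) = f (- (1/2)) + f (1/2)"
  by (simp add: dint_half)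

lemma half_half: "2 * (1/2::real) = real 1" by simp

lemma S1_half:
  assumes "\<sigma> u = - (1/2) \<or> \<sigma> u = 1/2"
  shows "S1 (1/2) u \<psi> \<sigma> = 1/2 * \<psi> (\<sigma>(u := - \<sigma> u))"
proof -
  have sq: "sqrt (1/2 * (1/2 + 1) - - (1/2) * (- (1/2) + 1)) = 1" "sqrt (1/2 * (1/2 + 1) - 1/2 * (1/2 - 1)) = 1"
    by simp_all
  show ?thesis
    using assms
  proof
    assume e: "\<sigma> u = - (1/2)"
    show ?thesis unfolding site_op_def sum_dint_half spin1_def spin_plus_def spin_minus_def e using sq by simp
  next
    assume e: "\<sigma> u = 1/2"
    show ?thesis unfolding site_op_def sum_dint_half spin1_def spin_plus_def spin_minus_def e using sq by simp
  qed
qed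

lemma S2_half:
  assumes "\<sigma> u = - (1/2) \<or> \<sigma> u = 1/2"
  shows "S2 (1/2) u \<psi> \<sigma> = - \<i> * complex_of_real (\<sigma> u) * \<psi> (\<sigma>(u := - \<sigma> u))"
proof -
  have sq: "sqrt (1/2 * (1/2 + 1) - - (1/2) * (- (1/2) + 1)) = 1" "sqrt (1/2 * (1/2 + 1) - 1/2 * (1/2 - 1)) = 1"
    by simp_all
  show ?thesis
    using assms
  proof
    assume e: "\<sigma> u = - (1/2)"
    show ?thesis unfolding site_op_def sum_dint_half spin2_def spin_plus_def spin_minus_def e using sq by simp
  next
    assume e: "\<sigma> u = 1/2"
    show ?thesis unfolding site_op_def sum_dint_half spin2_def spin_plus_def spin_minus_def e using sq by simp
  qed
qed

lemma S3_half:
  assumes "\<sigma> u = - (1/2) \<or> \<sigma> u = 1/2"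
  shows "S3 (1/2) u \<psi> \<sigma> = complex_of_real (\<sigma> u) * \<psi> \<sigma>"
  using assms unfolding site_op_def sum_dint_half spin3_def by (auto simp: fun_upd_idem)

text \<open>The two transverse terms flip both spins, with total coefficient
  \<open>1/4 - \<sigma> u * \<sigma> v\<close>. It is 0 for aligned spins and 1/2 for opposite ones,
  where the double flip is the exchange. So the bond kills aligned spins and acts by a 2 by 2 block
  on the two opposite arrangements.\<close>

lemma h_op_half:
  assumes "u \<noteq> v" "u \<in> V" "v \<in> V" "\<sigma> \<in> configs V (1/2)"
  shows "h_op \<Delta> (1/2) u v \<psi> \<sigma> = (if \<sigma> u = \<sigma> v then 0 else
     complex_of_real (1/2 + sqrt (1 - 1 / \<Delta>\<^sup>2) * \<sigma> u) * \<psi> \<sigma> - complex_of_real (1 / (2 * \<Delta>)) * \<psi> (swap u v \<sigma>))"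
proof -
  define r where "r = sqrt (1 - 1 / \<Delta>\<^sup>2)"
  have uv: "\<sigma> u = - (1/2) \<or> \<sigma> u = 1/2" "\<sigma> v = - (1/2) \<or> \<sigma> v = 1/2"
    using configs_half_cases[OF assms(4,2)] configs_half_cases[OF assms(4,3)] by metis+
  define F where "F = \<psi> (\<sigma>(u := - \<sigma> u, v := - \<sigma> v))"
  define G where "G = \<psi> \<sigma>"
  have S1: "S1 (1/2) u (S1 (1/2) v \<psi>) \<sigma> = 1/4 * F"
    using uv assms(1) by (simp add: S1_half F_def)
  have S2: "S2 (1/2) u (S2 (1/2) v \<psi>) \<sigma> = - complex_of_real (\<sigma> u) * complex_of_real (\<sigma> v) * F"
    using uv assms(1) by (simp add: S2_half F_def algebra_simps)
  have S3: "S3 (1/2) u (S3 (1/2) v \<psi>) \<sigma> = complex_of_real (\<sigma> u) * complex_of_real (\<sigma> v) * G"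
    "S3 (1/2) u \<psi> \<sigma> = complex_of_real (\<sigma> u) * G" "S3 (1/2) v \<psi> \<sigma> = complex_of_real (\<sigma> v) * G"
    using uv by (simp_all only: S3_half G_def mult.assoc)
  have sw: "\<sigma> u \<noteq> \<sigma> v \<Longrightarrow> \<psi> (swap u v \<sigma>) = F"
  proof -
    assume "\<sigma> u \<noteq> \<sigma> v"
    then have "- \<sigma> u = \<sigma> v" "- \<sigma> v = \<sigma> u" using uv by auto
    then show ?thesis unfolding F_def by (simp only:)
  qed
  have "complex_of_real ((1/2)\<^sup>2) * G - complex_of_real (\<sigma> u) * complex_of_real (\<sigma> v) * G
      - complex_of_real (1 / \<Delta>) * (1/4 * F + - complex_of_real (\<sigma> u) * complex_of_real (\<sigma> v) * F)
      + complex_of_real (1/2 * r) * (complex_of_real (\<sigma> u) * G - complex_of_real (\<sigma> v) * G)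
    = (if \<sigma> u = \<sigma> v then 0 else complex_of_real (1/2 + r * \<sigma> u) * G - complex_of_real (1 / (2 * \<Delta>)) * F)"
    (is ?goal)
    using uv
  proof (elim disjE)
    assume e: "\<sigma> u = - (1/2)" "\<sigma> v = - (1/2)"
    show ?goal unfolding e by (simp add: power2_eq_square algebra_simps)
  next
    assume e: "\<sigma> u = 1/2" "\<sigma> v = 1/2"
    show ?goal unfolding e by (simp add: power2_eq_square algebra_simps)
  next
    assume e: "\<sigma> u = - (1/2)" "\<sigma> v = 1/2"
    show ?goal unfolding e by (simp add: power2_eq_square algebra_simps)
  next
    assume e: "\<sigma> u = 1/2" "\<sigma> v = - (1/2)"
    show ?goal unfolding e by (simp add: power2_eq_square algebra_simps)
  qed
  then show ?thesis
    unfolding h_op_def S1 S2 S3 r_def[symmetric] G_def[symmetric] using sw by (auto split: if_splits)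
qed

section \<open>The spin-1/2 bond operator\<close>

lemma site_op_add: "site_op s A u (\<lambda>\<sigma>. f \<sigma> + g \<sigma>) = (\<lambda>\<sigma>. site_op s A u f \<sigma> + site_op s A u g \<sigma>)"
  by (simp add: site_op_def sum.distrib algebra_simps)

lemma site_op_scale: "site_op s A u (\<lambda>\<sigma>. c * f \<sigma>) = (\<lambda>\<sigma>. c * site_op s A u f \<sigma>)"
  by (simp add: site_op_def sum_distrib_left algebra_simps)

lemma h_op_add: "h_op \<Delta> s u v (\<lambda>\<sigma>. f \<sigma> + g \<sigma>) = (\<lambda>\<sigma>. h_op \<Delta> s u v f \<sigma> + h_op \<Delta> s u v g \<sigma>)"
  unfolding h_op_def site_op_add by (simp add: algebra_simps add_divide_distrib)

lemma h_op_scale: "h_op \<Delta> s u v (\<lambda>\<sigma>. c * f \<sigma>) = (\<lambda>\<sigma>. c * h_op \<Delta> s u v f \<sigma>)"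
  unfolding h_op_def site_op_scale by (simp add: algebra_simps)

lemma swap_configs: "\<sigma> \<in> configs V s \<Longrightarrow> u \<in> V \<Longrightarrow> v \<in> V \<Longrightarrow> swap u v \<sigma> \<in> configs V s"
  by (intro configs_upd) (auto simp: configs_def)

lemma swap_swap [simp]: "u \<noteq> v \<Longrightarrow> swap u v (swap u v \<sigma>) = \<sigma>"
  by auto

lemma swap_eq_comp: "swap u v \<sigma> = \<sigma> \<circ> transpose u v"
  by (auto simp: transpose_def fun_eq_iff)

lemma bij_swap_configs:
  assumes "u \<noteq> v" "u \<in> V" "v \<in> V"
  shows "bij_betw (swap u v) (configs V s) (configs V s)"
  by (rule bij_betwI[where g = "swap u v"]) (use assms swap_configs in auto)

lemma sum_swap:
  assumes "u \<noteq> v" "u \<in> V" "v \<in> V" "finite V"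
  shows "(\<Sum>x\<in>V. swap u v \<sigma> x) = (\<Sum>x\<in>V. \<sigma> x)"
proof -
  have "bij_betw (transpose u v) V V"
    using assms by (intro bij_betwI[where g = "transpose u v"]) (auto simp: transpose_def)
  from sum.reindex_bij_betw[OF this, of \<sigma>] show ?thesis
    by (simp add: swap_eq_comp del: fun_upd_apply)
qed

lemma h_op_half_upd:
  assumes "u \<noteq> v" "u \<in> V" "v \<in> V" "\<sigma> \<in> configs V (1/2)" "x = - (1/2) \<or> x = 1/2" "y = - (1/2) \<or> y = 1/2"
  shows "h_op \<Delta> (1/2) u v \<psi> (\<sigma>(u := x, v := y)) = (if x = y then 0 else
     complex_of_real (1/2 + sqrt (1 - 1 / \<Delta>\<^sup>2) * x) * \<psi> (\<sigma>(u := x, v := y))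
     - complex_of_real (1 / (2 * \<Delta>)) * \<psi> (\<sigma>(u := y, v := x)))"
proof -
  have "\<sigma>(u := x, v := y) \<in> configs V (1/2)"
    using assms by (intro configs_upd_half) auto
  note h = h_op_half[OF assms(1-3) this, of \<Delta> \<psi>]
  have "swap u v (\<sigma>(u := x, v := y)) = \<sigma>(u := y, v := x)" "(\<sigma>(u := x, v := y)) u = x" "(\<sigma>(u := x, v := y)) v = y"
    using assms(1) by (simp_all add: fun_eq_iff)
  then show ?thesis using h by (simp only:)
qed

text \<open>Boolean labels turn the operator identities below into finite case distinctions settled
  by algebra.\<close>

definition spin_val :: "bool \<Rightarrow> real" where
  "spin_val s = (if s then 1/2 else - (1/2))"

lemma spin_val: "spin_val s = - (1/2) \<or> spin_val s = 1/2" "spin_val s = spin_val t \<longleftrightarrow> s = t"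
  by (auto simp: spin_val_def)

lemma configs_spin_val:
  assumes "\<sigma> \<in> configs V (1/2)" "u \<in> V"
  obtains s where "\<sigma> u = spin_val s"
  using configs_half_cases[OF assms] by (metis spin_val_def)

definition diag_coeff :: "real \<Rightarrow> bool \<Rightarrow> complex" where
  "diag_coeff \<Delta> s = complex_of_real (1/2 + sqrt (1 - 1 / \<Delta>\<^sup>2) * spin_val s)"

lemma h_op_half_spin_val:
  assumes "u \<noteq> v" "u \<in> V" "v \<in> V" "\<sigma> \<in> configs V (1/2)"
  shows "h_op \<Delta> (1/2) u v \<psi> (\<sigma>(u := spin_val s, v := spin_val t)) = (if s = t then 0 else
     diag_coeff \<Delta> s * \<psi> (\<sigma>(u := spin_val s, v := spin_val t))
     - complex_of_real (1 / (2 * \<Delta>)) * \<psi> (\<sigma>(u := spin_val t, v := spin_val s)))"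
  using h_op_half_upd[OF assms spin_val(1) spin_val(1), of \<Delta> \<psi> s t]
  unfolding diag_coeff_def[symmetric] spin_val(2) .

text \<open>The block on opposite spins, with off-diagonal entries
  \<open>- 1 / (2 * \<Delta>)\<close>, has trace 1 and determinant 0, so it is a rank-one
  projection. The projection and Temperley-Lieb identities use no other property of its
  entries.\<close>

lemma diag_coeff:
  assumes "\<Delta> > 1"
  shows "diag_coeff \<Delta> True + diag_coeff \<Delta> False = 1"
    "diag_coeff \<Delta> True * diag_coeff \<Delta> False = complex_of_real (1 / (2 * \<Delta>)) * complex_of_real (1 / (2 * \<Delta>))"
proof -
  define r where "r = sqrt (1 - 1 / \<Delta>\<^sup>2)"
  have "1 / \<Delta>\<^sup>2 \<le> 1" using assms by simp
  then have r: "r * r = 1 - 1 / \<Delta>\<^sup>2" by (simp add: r_def)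
  show "diag_coeff \<Delta> True + diag_coeff \<Delta> False = 1"
    by (simp add: diag_coeff_def spin_val_def)
  have "(1/2 + r * (1/2)) * (1/2 + r * - (1/2)) = 1/4 - r * r / 4" by (simp add: algebra_simps)
  also have "\<dots> = 1 / (2 * \<Delta>) * (1 / (2 * \<Delta>))" unfolding r by (simp add: power2_eq_square diff_divide_distrib)
  finally show "diag_coeff \<Delta> True * diag_coeff \<Delta> False = complex_of_real (1 / (2 * \<Delta>)) * complex_of_real (1 / (2 * \<Delta>))"
    unfolding diag_coeff_def spin_val_def r_def[symmetric] of_real_mult[symmetric] by simp
qed

section \<open>Projection, Temperley-Lieb and commutation relations\<close>

context
  fixes \<Delta> :: real and V :: "'v set"
  assumes \<Delta>: "\<Delta> > 1" and V: "finite V"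
begin

text \<open>The coefficients are real, and the exchange is an involution of the configurations that
  preserves the off-diagonal coefficient; reindexing by it moves the exchange to the other
  argument.\<close>

lemma h_half_selfadjoint:
  assumes "u \<noteq> v" "u \<in> V" "v \<in> V"
  shows "ip (configs V (1/2)) (h_op \<Delta> (1/2) u v f) g = ip (configs V (1/2)) f (h_op \<Delta> (1/2) u v g)"
proof -
  let ?C = "configs V (1/2)"
  define d where "d \<sigma> = (if \<sigma> u = \<sigma> v then 0 else complex_of_real (1 / (2 * \<Delta>)))" for \<sigma> :: "'v \<Rightarrow> real"
  define k where "k \<sigma> = (if \<sigma> u = \<sigma> v then 0 else complex_of_real (1/2 + sqrt (1 - 1 / \<Delta>\<^sup>2) * \<sigma> u))" for \<sigma> :: "'v \<Rightarrow> real"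
  have h: "h_op \<Delta> (1/2) u v f \<sigma> = k \<sigma> * f \<sigma> - d \<sigma> * f (swap u v \<sigma>)" if "\<sigma> \<in> ?C" for f \<sigma>
    unfolding h_op_half[OF assms that] d_def k_def by simp
  have cn: "cnj (k \<sigma>) = k \<sigma>" "cnj (d \<sigma>) = d \<sigma>" for \<sigma> by (auto simp: k_def d_def)
  have sw: "d (swap u v \<sigma>) = d \<sigma>" for \<sigma> using assms by (auto simp: d_def)
  have "ip ?C (h_op \<Delta> (1/2) u v f) g = (\<Sum>\<sigma>\<in>?C. k \<sigma> * cnj (f \<sigma>) * g \<sigma>) - (\<Sum>\<sigma>\<in>?C. d \<sigma> * cnj (f (swap u v \<sigma>)) * g \<sigma>)"
    unfolding ip_def sum_subtractf[symmetric]
    by (intro sum.cong refl) (simp add: h cn algebra_simps)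
  also have "(\<Sum>\<sigma>\<in>?C. d \<sigma> * cnj (f (swap u v \<sigma>)) * g \<sigma>) = (\<Sum>\<sigma>\<in>?C. d \<sigma> * cnj (f \<sigma>) * g (swap u v \<sigma>))"
    using sum.reindex_bij_betw[OF bij_swap_configs[OF assms, of "1/2"],
        of "\<lambda>\<sigma>. d \<sigma> * cnj (f \<sigma>) * g (swap u v \<sigma>)"]
    unfolding sw swap_swap[OF assms(1)] .
  also have "(\<Sum>\<sigma>\<in>?C. k \<sigma> * cnj (f \<sigma>) * g \<sigma>) - \<dots> = ip ?C f (h_op \<Delta> (1/2) u v g)"
    unfolding ip_def sum_subtractf[symmetric]
    by (intro sum.cong refl) (simp add: h cn algebra_simps)
  finally show ?thesis .
qed

lemma h_half_idem:
  assumes "u \<noteq> v" "u \<in> V" "v \<in> V" "\<psi> \<in> tensor_space V (1/2)"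
  shows "h_op \<Delta> (1/2) u v (h_op \<Delta> (1/2) u v \<psi>) = h_op \<Delta> (1/2) u v \<psi>"
proof
  fix \<sigma>
  note T = h_op_tensor_space[of "1/2" 1 u V v, simplified, OF assms(2,3)]
  show "h_op \<Delta> (1/2) u v (h_op \<Delta> (1/2) u v \<psi>) \<sigma> = h_op \<Delta> (1/2) u v \<psi> \<sigma>"
  proof (cases "\<sigma> \<in> configs V (1/2)")
    case True
    obtain s t where st: "\<sigma> u = spin_val s" "\<sigma> v = spin_val t"
      using configs_spin_val True assms(2,3) by metis
    have \<sigma>: "\<sigma> = \<sigma>(u := spin_val s, v := spin_val t)" by (simp add: st[symmetric])
    show ?thesis
      apply (subst (1 2) \<sigma>)
      using diag_coeff[OF \<Delta>] unfolding h_op_half_spin_val[OF assms(1-3) True]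
      apply (cases s; cases t)
         apply (simp_all del: of_real_mult of_real_divide)
       apply algebra+
      done
  next
    case False
    then show ?thesis using tensor_space_vanish[OF T[OF T[OF assms(4)]] False]
      tensor_space_vanish[OF T[OF assms(4)] False] by simp
  qed
qed

text \<open>For a fixed label at \<open>w\<close>, only one of the two components of the range
  vector of the first bond is opposite to \<open>w\<close> at \<open>v\<close> and thus seen by the
  second bond. The sandwich therefore yields the product of the two diagonal entries,
  \<open>(1 / (2 * \<Delta>))\<^sup>2\<close>, for either label at \<open>w\<close>.\<close>

lemma h_half_temperley_lieb:
  assumes "u \<noteq> v" "v \<noteq> w" "u \<noteq> w" "u \<in> V" "v \<in> V" "w \<in> V" "\<psi> \<in> tensor_space V (1/2)"
  shows "h_op \<Delta> (1/2) u v (h_op \<Delta> (1/2) v w (h_op \<Delta> (1/2) u v \<psi>)) =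
    (\<lambda>\<sigma>. complex_of_real ((1 / (2 * \<Delta>))\<^sup>2) * h_op \<Delta> (1/2) u v \<psi> \<sigma>)"
proof
  fix \<sigma>
  note T1 = h_op_tensor_space[of "1/2" 1 u V v, simplified, OF assms(4,5)]
  note T2 = h_op_tensor_space[of "1/2" 1 v V w, simplified, OF assms(5,6)]
  show "h_op \<Delta> (1/2) u v (h_op \<Delta> (1/2) v w (h_op \<Delta> (1/2) u v \<psi>)) \<sigma> =
    complex_of_real ((1 / (2 * \<Delta>))\<^sup>2) * h_op \<Delta> (1/2) u v \<psi> \<sigma>"
  proof (cases "\<sigma> \<in> configs V (1/2)")
    case True
    obtain s t p where st: "\<sigma> u = spin_val s" "\<sigma> v = spin_val t" "\<sigma> w = spin_val p"
      using configs_spin_val True assms(4,5,6) by metis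
    define U where "U s t p = \<sigma>(w := spin_val p, u := spin_val s, v := spin_val t)" for s t p
    have \<sigma>: "\<sigma> = U s t p" by (simp add: st[symmetric] U_def)
    define b where b: "b = complex_of_real (1 / (2 * \<Delta>))"
    have h1: "h_op \<Delta> (1/2) u v \<phi> (U s t p) = (if s = t then 0 else
       diag_coeff \<Delta> s * \<phi> (U s t p) - b * \<phi> (U t s p))" for \<phi> s t p
      using h_op_half_spin_val[OF assms(1,4,5) configs_upd_half[OF True assms(6) spin_val(1)]]
      unfolding U_def b .
    have U2: "U s t p = \<sigma>(u := spin_val s, v := spin_val t, w := spin_val p)" for s t p
      unfolding U_def using assms by (auto simp: fun_eq_iff)
    have h2: "h_op \<Delta> (1/2) v w \<phi> (U s t p) = (if t = p then 0 else
       diag_coeff \<Delta> t * \<phi> (U s t p) - b * \<phi> (U s p t))" for \<phi> s t p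
      using h_op_half_spin_val[OF assms(2,5,6) configs_upd_half[OF True assms(4) spin_val(1)]]
      unfolding U2 b .
    have b2: "complex_of_real ((1 / (2 * \<Delta>))\<^sup>2) = b * b" by (simp add: b power2_eq_square)
    show ?thesis
      unfolding \<sigma> b2 h1 h2
      using diag_coeff[OF \<Delta>] unfolding b[symmetric]
      apply (cases s; cases t; cases p)
             apply (simp_all)
         apply algebra+
      done
  next
    case False
    then show ?thesis using tensor_space_vanish[OF T1[OF T2[OF T1[OF assms(7)]]] False]
      tensor_space_vanish[OF T1[OF assms(7)] False] by simp
  qed
qed

lemma h_half_commute:
  assumes "u \<noteq> v" "u' \<noteq> v'" "{u, v} \<inter> {u', v'} = {}" "u \<in> V" "v \<in> V" "u' \<in> V" "v' \<in> V" "\<psi> \<in> tensor_space V (1/2)"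
  shows "h_op \<Delta> (1/2) u v (h_op \<Delta> (1/2) u' v' \<psi>) = h_op \<Delta> (1/2) u' v' (h_op \<Delta> (1/2) u v \<psi>)"
proof
  fix \<sigma>
  note T1 = h_op_tensor_space[of "1/2" 1 u V v, simplified, OF assms(4,5)]
  note T2 = h_op_tensor_space[of "1/2" 1 u' V v', simplified, OF assms(6,7)]
  show "h_op \<Delta> (1/2) u v (h_op \<Delta> (1/2) u' v' \<psi>) \<sigma> = h_op \<Delta> (1/2) u' v' (h_op \<Delta> (1/2) u v \<psi>) \<sigma>"
  proof (cases "\<sigma> \<in> configs V (1/2)")
    case True
    define A B where AB: "A = swap u v \<sigma>" "B = swap u' v' \<sigma>"
    define r b where rb: "r = sqrt (1 - 1 / \<Delta>\<^sup>2)" "b = complex_of_real (1 / (2 * \<Delta>))"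
    define k k' where k: "k = complex_of_real (1/2 + r * \<sigma> u)" "k' = complex_of_real (1/2 + r * \<sigma> u')"
    have s: "A \<in> configs V (1/2)" "B \<in> configs V (1/2)"
      unfolding AB using swap_configs[OF True] assms by blast+
    have v: "A u' = \<sigma> u'" "A v' = \<sigma> v'" "B u = \<sigma> u" "B v = \<sigma> v"
      using assms by (auto simp: AB)
    have AB': "A(u' := \<sigma> v', v' := \<sigma> u') = B(u := \<sigma> v, v := \<sigma> u)"
      using assms by (auto simp: fun_eq_iff AB)
    show ?thesis
      unfolding h_op_half[OF assms(1,4,5) True] h_op_half[OF assms(2,6,7) True] AB[symmetric]
        h_op_half[OF assms(1,4,5) s(2)] h_op_half[OF assms(2,6,7) s(1)] v AB' rb[symmetric] k[symmetric]
      by (simp add: algebra_simps del: fun_upd_apply)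
  next
    case False
    then show ?thesis using tensor_space_vanish[OF T1[OF T2[OF assms(8)]] False]
      tensor_space_vanish[OF T2[OF T1[OF assms(8)]] False] by simp
  qed
qed

end

text \<open>Here \<open>x e\<close> stands for the energy of a bond and \<open>a e f\<close> for the
  real part of the inner product of two bond images, so the right-hand side is the squared norm of
  the image under the sum. An ordered pair of neighbours charges \<open>c\<close> to each of its
  members, and a member with at most two neighbours is charged at most four times.\<close>

lemma sum_products_ge:
  fixes a :: "'e \<Rightarrow> 'e \<Rightarrow> real"
  assumes "finite E" "0 \<le> c" and pos: "\<And>e. e \<in> E \<Longrightarrow> 0 \<le> x e" and diag: "\<And>e. e \<in> E \<Longrightarrow> a e e = x e"
    and adj: "\<And>e f. e \<in> E \<Longrightarrow> f \<in> E \<Longrightarrow> e \<noteq> f \<Longrightarrow> adj e f \<Longrightarrow> - c * (x e + x f) \<le> a e f"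
    and nonadj: "\<And>e f. e \<in> E \<Longrightarrow> f \<in> E \<Longrightarrow> e \<noteq> f \<Longrightarrow> \<not> adj e f \<Longrightarrow> 0 \<le> a e f"
    and sym: "\<And>e f. adj e f \<longleftrightarrow> adj f e" and irrefl: "\<And>e. \<not> adj e e"
    and deg: "\<And>e. e \<in> E \<Longrightarrow> card {f\<in>E. adj e f} \<le> 2"
  shows "(1 - 4 * c) * (\<Sum>e\<in>E. x e) \<le> (\<Sum>e\<in>E. \<Sum>f\<in>E. a e f)"
proof -
  define k where "k e f = (if adj e f then c else 0)" for e f
  have k: "(\<Sum>f\<in>E. k e f) \<le> 2 * c" if "e \<in> E" for e
  proof -
    have "(\<Sum>f\<in>E. k e f) = c * card {f\<in>E. adj e f}"
      unfolding k_def using assms(1) by (simp add: sum.If_cases Int_def)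
    also have "\<dots> \<le> c * 2" using deg[OF that] assms(2) by (intro mult_left_mono) simp_all
    finally show ?thesis by simp
  qed
  have "(\<Sum>e\<in>E. (\<Sum>f\<in>E. k e f) * x e) \<le> (\<Sum>e\<in>E. 2 * c * x e)"
    using k pos by (intro sum_mono mult_right_mono)
  then have kk: "(\<Sum>e\<in>E. \<Sum>f\<in>E. k e f * x e) \<le> 2 * c * (\<Sum>e\<in>E. x e)"
    by (simp add: sum_distrib_right sum_distrib_left)
  have "(\<Sum>e\<in>E. \<Sum>f\<in>E. k e f * x f) = (\<Sum>f\<in>E. \<Sum>e\<in>E. k e f * x f)" by (rule sum.swap)
  also have "\<dots> = (\<Sum>e\<in>E. \<Sum>f\<in>E. k e f * x e)" using sym by (simp add: k_def)
  finally have kk': "(\<Sum>e\<in>E. \<Sum>f\<in>E. k e f * x f) = (\<Sum>e\<in>E. \<Sum>f\<in>E. k e f * x e)" .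
  have diag_sum: "(\<Sum>e\<in>E. \<Sum>f\<in>E. if e = f then x e else 0) = (\<Sum>e\<in>E. x e)"
    using assms(1) by simp
  have "(1 - 4 * c) * (\<Sum>e\<in>E. x e) \<le> (\<Sum>e\<in>E. x e) - (\<Sum>e\<in>E. \<Sum>f\<in>E. k e f * x e) - (\<Sum>e\<in>E. \<Sum>f\<in>E. k e f * x f)"
    unfolding kk' using kk by (simp add: algebra_simps)
  also have "\<dots> = (\<Sum>e\<in>E. \<Sum>f\<in>E. (if e = f then x e else 0) - k e f * x e - k e f * x f)"
    unfolding sum_subtractf diag_sum ..
  also have "\<dots> \<le> (\<Sum>e\<in>E. \<Sum>f\<in>E. a e f)"
  proof (intro sum_mono)
    fix e f assume ef: "e \<in> E" "f \<in> E"
    show "(if e = f then x e else 0) - k e f * x e - k e f * x f \<le> a e f"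
      using diag[OF ef(1)] adj[OF ef] nonadj[OF ef] irrefl[of e]
      by (cases "e = f"; cases "adj e f") (auto simp: k_def algebra_simps)
  qed
  finally show ?thesis .
qed

section \<open>Energy inequalities for one and two bonds\<close>

context
  fixes \<Delta> :: real and V :: "'v set"
  assumes \<Delta>: "\<Delta> > 1" and V: "finite V"
begin

lemma h_half_norm:
  assumes "u \<noteq> v" "u \<in> V" "v \<in> V" "\<psi> \<in> tensor_space V (1/2)"
  shows "ip (configs V (1/2)) (h_op \<Delta> (1/2) u v \<psi>) (h_op \<Delta> (1/2) u v \<psi>) =
    ip (configs V (1/2)) \<psi> (h_op \<Delta> (1/2) u v \<psi>)"
  unfolding h_half_selfadjoint[OF \<Delta> V assms(1-3)] h_half_idem[OF \<Delta> V assms] ..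

lemma h_half_eq_zero:
  assumes "u \<noteq> v" "u \<in> V" "v \<in> V" "\<psi> \<in> tensor_space V (1/2)"
    "Re (ip (configs V (1/2)) \<psi> (h_op \<Delta> (1/2) u v \<psi>)) \<le> 0"
  shows "h_op \<Delta> (1/2) u v \<psi> = zero_vect"
proof
  fix \<sigma>
  have T: "h_op \<Delta> (1/2) u v \<psi> \<in> tensor_space V (1/2)"
    by (rule h_op_tensor_space[OF half_half assms(2-4)])
  show "h_op \<Delta> (1/2) u v \<psi> \<sigma> = 0"
  proof (cases "\<sigma> \<in> configs V (1/2)")
    case True
    show ?thesis
      by (rule ip_self_eq_0[OF finite_configs[OF V] _ True]) (use assms(5) in \<open>simp only: h_half_norm[OF assms(1-4)]\<close>)
  qed (rule tensor_space_vanish[OF T])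
qed

text \<open>For commuting projections \<open>P\<close> and \<open>Q\<close>, the inner product of
  \<open>P \<psi>\<close> and \<open>Q \<psi>\<close> is the squared norm of
  \<open>Q (P \<psi>)\<close>.\<close>

lemma h_half_disjoint_nonneg:
  assumes "u \<noteq> v" "u' \<noteq> v'" "{u, v} \<inter> {u', v'} = {}" "u \<in> V" "v \<in> V" "u' \<in> V" "v' \<in> V" "\<psi> \<in> tensor_space V (1/2)"
  shows "0 \<le> Re (ip (configs V (1/2)) (h_op \<Delta> (1/2) u v \<psi>) (h_op \<Delta> (1/2) u' v' \<psi>))"
proof -
  let ?P = "h_op \<Delta> (1/2) u v" and ?Q = "h_op \<Delta> (1/2) u' v'" and ?C = "configs V (1/2)"
  have "ip ?C (?P \<psi>) (?Q \<psi>) = ip ?C (?P (?P \<psi>)) (?Q (?Q \<psi>))"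
    unfolding h_half_idem[OF \<Delta> V assms(1,4,5,8)] h_half_idem[OF \<Delta> V assms(2,6,7,8)] ..
  also have "\<dots> = ip ?C (?P \<psi>) (?Q (?P (?Q \<psi>)))"
    unfolding h_half_selfadjoint[OF \<Delta> V assms(1,4,5)]
      h_half_commute[OF \<Delta> V assms(1-7) h_op_tensor_space[OF half_half assms(6,7,8)]] ..
  also have "\<dots> = ip ?C (?Q (?P \<psi>)) (?Q (?P \<psi>))"
    unfolding h_half_selfadjoint[OF \<Delta> V assms(2,6,7), symmetric] h_half_commute[OF \<Delta> V assms] ..
  finally show ?thesis using ip_self_nonneg by metis
qed

text \<open>Positivity of the norm of \<open>Q (P + c) \<psi>\<close>, where \<open>P Q P = c\<^sup>2 P\<close> and \<open>c = 1 / (2 \<Delta>)\<close>.\<close>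

lemma h_half_adjacent_ge:
  assumes "u \<noteq> v" "v \<noteq> w" "u \<noteq> w" "u \<in> V" "v \<in> V" "w \<in> V" "\<psi> \<in> tensor_space V (1/2)"
  shows "- (1 / (4 * \<Delta>)) * (Re (ip (configs V (1/2)) \<psi> (h_op \<Delta> (1/2) u v \<psi>)) +
      Re (ip (configs V (1/2)) \<psi> (h_op \<Delta> (1/2) v w \<psi>)))
    \<le> Re (ip (configs V (1/2)) (h_op \<Delta> (1/2) u v \<psi>) (h_op \<Delta> (1/2) v w \<psi>))"
proof -
  let ?P = "h_op \<Delta> (1/2) u v" and ?Q = "h_op \<Delta> (1/2) v w" and ?C = "configs V (1/2)"
  define c where "c = 1 / (2 * \<Delta>)"
  have c: "c > 0" using \<Delta> by (simp add: c_def)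
  have T: "?P \<psi> \<in> tensor_space V (1/2)" using h_op_tensor_space[OF half_half assms(4,5,7)] .
  have 1: "ip ?C (?Q (?P \<psi>)) (?Q (?P \<psi>)) = complex_of_real (c\<^sup>2) * ip ?C \<psi> (?P \<psi>)"
    unfolding h_half_norm[OF assms(2,5,6) T] h_half_selfadjoint[OF \<Delta> V assms(1,4,5)]
      h_half_temperley_lieb[OF \<Delta> V assms] ip_scale_right c_def ..
  have 2: "ip ?C (?Q (?P \<psi>)) (?Q \<psi>) = ip ?C (?P \<psi>) (?Q \<psi>)"
    unfolding h_half_selfadjoint[OF \<Delta> V assms(2,5,6)] h_half_idem[OF \<Delta> V assms(2,5,6,7)] ..
  have 3: "ip ?C (?Q \<psi>) (?Q (?P \<psi>)) = cnj (ip ?C (?P \<psi>) (?Q \<psi>))"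
    using 2 ip_commute by metis
  have "0 \<le> Re (ip ?C (\<lambda>\<sigma>. ?Q (?P \<psi>) \<sigma> + complex_of_real c * ?Q \<psi> \<sigma>) (\<lambda>\<sigma>. ?Q (?P \<psi>) \<sigma> + complex_of_real c * ?Q \<psi> \<sigma>))"
    by (rule ip_self_nonneg)
  also have "\<dots> = c * (c * Re (ip ?C \<psi> (?P \<psi>)) + 2 * Re (ip ?C (?P \<psi>) (?Q \<psi>)) + c * Re (ip ?C \<psi> (?Q \<psi>)))"
    unfolding ip_add_left ip_add_right ip_scale_left ip_scale_right 1 2 3 h_half_norm[OF assms(2,5,6,7)]
    by (simp add: algebra_simps power2_eq_square)
  finally have "0 \<le> c * Re (ip ?C \<psi> (?P \<psi>)) + 2 * Re (ip ?C (?P \<psi>) (?Q \<psi>)) + c * Re (ip ?C \<psi> (?Q \<psi>))"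
    using c by (simp add: zero_le_mult_iff)
  then show ?thesis unfolding c_def by (simp add: algebra_simps)
qed

end

section \<open>Magnetization sectors\<close>

lemma sum_spin_apply:
  assumes "\<psi> \<in> tensor_space V s" "finite V"
  shows "(\<Sum>u\<in>V. S3 s u \<psi> \<sigma>) = complex_of_real (\<Sum>u\<in>V. \<sigma> u) * \<psi> \<sigma>"
  unfolding of_real_sum sum_distrib_right
  by (intro sum.cong refl) (rule S3_apply[OF _ assms(1)])

text \<open>The total \<open>S3\<close> is diagonal, so a sector is a condition on the support
  alone; its invariance under bonds and permutations then follows from the invariance of the label
  sum.\<close>

lemma magnetization_space_iff:
  assumes "finite V"
  shows "\<psi> \<in> magnetization_space V s M \<longleftrightarrow>
    \<psi> \<in> tensor_space V s \<and> (\<forall>\<sigma>\<in>configs V s. \<psi> \<sigma> \<noteq> 0 \<longrightarrow> (\<Sum>u\<in>V. \<sigma> u) = M)"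
proof (cases "\<psi> \<in> tensor_space V s")
  case True
  have "(\<Sum>u\<in>V. S3 s u \<psi> \<sigma>) = complex_of_real M * \<psi> \<sigma> \<longleftrightarrow> \<psi> \<sigma> = 0 \<or> (\<Sum>u\<in>V. \<sigma> u) = M" for \<sigma>
    unfolding sum_spin_apply[OF True assms] mult_cancel_right of_real_eq_iff by blast
  then show ?thesis
    unfolding magnetization_space_def fun_eq_iff using True tensor_space_vanish[OF True] by blast
next
  case False
  then show ?thesis by (simp add: magnetization_space_def)
qed

lemma lin_sub_tensor_space: "lin_sub (tensor_space V s)"
  by (simp add: lin_sub_def tensor_space_def)

lemma lin_sub_magnetization_space:
  assumes "finite V"
  shows "lin_sub (magnetization_space V s M)"
proof -
  note iff = magnetization_space_iff[OF assms, of _ s M] and T = lin_sub_tensor_space[of V s]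
  show ?thesis
    unfolding lin_sub_def
  proof (intro conjI ballI allI)
    show "zero_vect \<in> magnetization_space V s M"
      unfolding iff using lin_sub_zero[OF T] by simp
  next
    fix f g assume "f \<in> magnetization_space V s M" "g \<in> magnetization_space V s M"
    then have fg: "f \<in> tensor_space V s" "\<And>\<sigma>. \<sigma> \<in> configs V s \<Longrightarrow> f \<sigma> \<noteq> 0 \<Longrightarrow> (\<Sum>u\<in>V. \<sigma> u) = M"
      "g \<in> tensor_space V s" "\<And>\<sigma>. \<sigma> \<in> configs V s \<Longrightarrow> g \<sigma> \<noteq> 0 \<Longrightarrow> (\<Sum>u\<in>V. \<sigma> u) = M"
      unfolding iff by blast+
    have "f \<sigma> \<noteq> 0 \<or> g \<sigma> \<noteq> 0" if "f \<sigma> + g \<sigma> \<noteq> 0" for \<sigma> using that by auto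
    then show "(\<lambda>x. f x + g x) \<in> magnetization_space V s M"
      unfolding iff using lin_sub_add[OF T fg(1,3)] fg(2,4) by blast
  next
    fix c f assume "f \<in> magnetization_space V s M"
    then show "(\<lambda>x. c * f x) \<in> magnetization_space V s M"
      unfolding iff using lin_sub_scale[OF T, of f c] by auto
  qed
qed

lemma h_half_magnetization_space:
  assumes "u \<noteq> v" "u \<in> V" "v \<in> V" "finite V" "\<psi> \<in> magnetization_space V (1/2) M"
  shows "h_op \<Delta> (1/2) u v \<psi> \<in> magnetization_space V (1/2) M"
  unfolding magnetization_space_iff[OF assms(4)]
proof (intro conjI ballI impI)
  have \<psi>: "\<psi> \<in> tensor_space V (1/2)" "\<And>\<sigma>. \<sigma> \<in> configs V (1/2) \<Longrightarrow> \<psi> \<sigma> \<noteq> 0 \<Longrightarrow> (\<Sum>u\<in>V. \<sigma> u) = M"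
    using assms(5) unfolding magnetization_space_iff[OF assms(4)] by auto
  show "h_op \<Delta> (1/2) u v \<psi> \<in> tensor_space V (1/2)"
    by (rule h_op_tensor_space[OF half_half assms(2,3) \<psi>(1)])
  fix \<sigma> assume \<sigma>: "\<sigma> \<in> configs V (1/2)" "h_op \<Delta> (1/2) u v \<psi> \<sigma> \<noteq> 0"
  have "\<psi> \<sigma> \<noteq> 0 \<or> \<psi> (swap u v \<sigma>) \<noteq> 0"
    using \<sigma>(2) unfolding h_op_half[OF assms(1-3) \<sigma>(1)] by (auto split: if_splits)
  then show "(\<Sum>u\<in>V. \<sigma> u) = M"
    using \<psi>(2)[OF \<sigma>(1)] \<psi>(2)[OF swap_configs[OF \<sigma>(1) assms(2,3)]] sum_swap[OF assms(1-4)] by metis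
qed

text \<open>Nonnegative bond energies with vanishing sum vanish one by one, and a projection with
  zero expectation in a vector annihilates it.\<close>

lemma frustration_free_sum_zero:
  assumes "\<Delta> > 1" "finite V" "finite I" "\<psi> \<in> tensor_space V (1/2)"
    and uv: "\<And>i. i \<in> I \<Longrightarrow> u i \<noteq> v i \<and> u i \<in> V \<and> v i \<in> V"
    and zero: "(\<lambda>\<sigma>. \<Sum>i\<in>I. h_op \<Delta> (1/2) (u i) (v i) \<psi> \<sigma>) = zero_vect"
    and "i \<in> I"
  shows "h_op \<Delta> (1/2) (u i) (v i) \<psi> = zero_vect"
proof -
  define E where "E i = Re (ip (configs V (1/2)) \<psi> (h_op \<Delta> (1/2) (u i) (v i) \<psi>))" for i
  have nonneg: "0 \<le> E i" if "i \<in> I" for i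
    unfolding E_def using h_half_norm[OF assms(1,2) _ _ _ assms(4), of "u i" "v i"] uv[OF that]
      ip_self_nonneg by metis
  have "(\<Sum>i\<in>I. E i) = Re (ip (configs V (1/2)) \<psi> (\<lambda>\<sigma>. \<Sum>i\<in>I. h_op \<Delta> (1/2) (u i) (v i) \<psi> \<sigma>))"
    unfolding E_def ip_sum_right by simp
  also have "\<dots> = 0" unfolding zero by simp
  finally have "E i = 0"
    using sum_nonneg_eq_0_iff[OF assms(3), of E] nonneg assms(7) by blast
  then show ?thesis
    using h_half_eq_zero[OF assms(1,2) _ _ _ assms(4), of "u i" "v i"] uv[OF assms(7)]
    unfolding E_def by simp
qed

lemma h_half_zero_exchange:
  assumes "u \<noteq> v" "u \<in> V" "v \<in> V" "\<sigma> \<in> configs V (1/2)" "h_op \<Delta> (1/2) u v \<psi> = zero_vect" "s \<noteq> t"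
  shows "diag_coeff \<Delta> s * \<psi> (\<sigma>(u := spin_val s, v := spin_val t)) =
    complex_of_real (1 / (2 * \<Delta>)) * \<psi> (\<sigma>(u := spin_val t, v := spin_val s))"
  using h_op_half_spin_val[OF assms(1-4), of \<Delta> \<psi> s t] assms(6) unfolding assms(5) by simp

text \<open>Two spins coupled to a common neighbour are exchanged by passing the odd one out through the
  neighbour; the two factors picked up are reciprocal.\<close>

lemma exchange_via_neighbour_aux:
  assumes "\<Delta> > 1" "u \<noteq> u'" "u \<noteq> v" "u' \<noteq> v" "u \<in> V" "u' \<in> V" "v \<in> V" "\<sigma> \<in> configs V (1/2)"
    and zero: "h_op \<Delta> (1/2) u v \<psi> = zero_vect \<and> h_op \<Delta> (1/2) u' v \<psi> = zero_vect \<or>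
      h_op \<Delta> (1/2) v u \<psi> = zero_vect \<and> h_op \<Delta> (1/2) v u' \<psi> = zero_vect"
    and st: "s \<noteq> t"
  shows "\<psi> (\<sigma>(u := spin_val s, u' := spin_val t, v := spin_val s)) = \<psi> (\<sigma>(u := spin_val t, u' := spin_val s, v := spin_val s))"
proof -
  define b where "b = complex_of_real (1 / (2 * \<Delta>))"
  have b: "b \<noteq> 0" using assms(1) by (simp add: b_def)
  have K: "diag_coeff \<Delta> s * diag_coeff \<Delta> t = b * b"
    using diag_coeff(2)[OF assms(1)] st unfolding b_def by (cases s; cases t) (simp_all add: mult.commute)
  define F where "F p q r = \<psi> (\<sigma>(u := spin_val p, u' := spin_val q, v := spin_val r))" for p q r
  \<comment> \<open>Each order of updates places last the two sites on which one of the bonds acts,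
    the form in which the exchange relation is stated.\<close>
  have F: "F p q r = \<psi> (\<sigma>(u' := spin_val q, u := spin_val p, v := spin_val r))"
    "F p q r = \<psi> (\<sigma>(u' := spin_val q, v := spin_val r, u := spin_val p))"
    "F p q r = \<psi> (\<sigma>(u := spin_val p, v := spin_val r, u' := spin_val q))" for p q r
    unfolding F_def using assms(2-4) by (auto intro!: arg_cong[of _ _ \<psi>])
  note c = configs_upd_half[OF assms(8) assms(5) spin_val(1)] configs_upd_half[OF assms(8) assms(6) spin_val(1)]
  from zero have "b * b * F s t s = b * b * F t s s"
  proof
    assume z: "h_op \<Delta> (1/2) u v \<psi> = zero_vect \<and> h_op \<Delta> (1/2) u' v \<psi> = zero_vect"
    have "diag_coeff \<Delta> t * F s t s = b * F s s t"
      unfolding F_def b_def using h_half_zero_exchange[OF assms(4,6,7) c(1), of \<Delta> \<psi> t s] z st by simp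
    moreover have "diag_coeff \<Delta> s * F s s t = b * F t s s"
      unfolding F(1) b_def using h_half_zero_exchange[OF assms(3,5,7) c(2), of \<Delta> \<psi> s t] z st by simp
    ultimately show ?thesis using K by algebra
  next
    assume z: "h_op \<Delta> (1/2) v u \<psi> = zero_vect \<and> h_op \<Delta> (1/2) v u' \<psi> = zero_vect"
    have "diag_coeff \<Delta> s * F s t s = b * F s s t"
      unfolding F(3) b_def using h_half_zero_exchange[OF assms(4)[symmetric] assms(7,6) c(1), of \<Delta> \<psi> s t] z st by simp
    moreover have "diag_coeff \<Delta> t * F s s t = b * F t s s"
      unfolding F(2) b_def using h_half_zero_exchange[OF assms(3)[symmetric] assms(7,5) c(2), of \<Delta> \<psi> t s] z st by simp
    ultimately show ?thesis using K by algebra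
  qed
  then show ?thesis using b unfolding F_def by simp
qed

lemma exchange_via_neighbour:
  assumes "\<Delta> > 1" "u \<noteq> u'" "u \<noteq> v" "u' \<noteq> v" "u \<in> V" "u' \<in> V" "v \<in> V" "\<sigma> \<in> configs V (1/2)"
    and zero: "h_op \<Delta> (1/2) u v \<psi> = zero_vect \<and> h_op \<Delta> (1/2) u' v \<psi> = zero_vect \<or>
      h_op \<Delta> (1/2) v u \<psi> = zero_vect \<and> h_op \<Delta> (1/2) v u' \<psi> = zero_vect"
  shows "\<psi> (swap u u' \<sigma>) = \<psi> \<sigma>"
proof -
  obtain p q r where pqr: "\<sigma> u = spin_val p" "\<sigma> u' = spin_val q" "\<sigma> v = spin_val r"
    using configs_spin_val assms(5-8) by metis
  have \<sigma>: "\<sigma> = \<sigma>(u := spin_val p, u' := spin_val q, v := spin_val r)"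
    using pqr by (auto simp: fun_eq_iff)
  have sw: "swap u u' \<sigma> = \<sigma>(u := spin_val q, u' := spin_val p, v := spin_val r)"
    using pqr assms(2-4) by (auto simp: fun_eq_iff)
  \<comment> \<open>If the labels at \<open>u\<close> and \<open>u'\<close> differ, the label at
    \<open>v\<close> agrees with one of them, so exactly one of the three spins is the odd
    one.\<close>
  consider "p = q" | "p \<noteq> q" "r = p" | "p \<noteq> q" "r = q" by (cases p; cases q; cases r) auto
  then show ?thesis
  proof cases
    case 1
    then show ?thesis unfolding sw using \<sigma> by simp
  next
    case 2
    then show ?thesis unfolding sw using \<sigma> exchange_via_neighbour_aux[OF assms 2(1)] by simp
  next
    case 3
    then show ?thesis unfolding sw using \<sigma> exchange_via_neighbour_aux[OF assms 3(1)[symmetric]] by simp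
  qed
qed

section \<open>The ladder\<close>

text \<open>Differences of one sign, not all zero, would make the sums unequal. It supplies the two
  legs of a rung whose exchange brings two configurations closer.\<close>

lemma sum_eq_excess_deficit:
  fixes f g :: "'b \<Rightarrow> real"
  assumes "finite A" "sum f A = sum g A" "x \<in> A" "f x \<noteq> g x"
  obtains j k where "j \<in> A" "k \<in> A" "f j < g j" "g k < f k"
proof -
  have "\<exists>j\<in>A. f j < g j"
  proof (rule ccontr)
    assume "\<not> (\<exists>j\<in>A. f j < g j)"
    then have "\<forall>j\<in>A. g j \<le> f j" by (simp add: not_less)
    moreover have "\<exists>j\<in>A. g j < f j" using calculation assms(3,4) by (metis order_less_le)
    ultimately have "sum g A < sum f A" by (rule sum_strict_mono_ex1[OF assms(1)])
    then show False using assms(2) by simp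
  qed
  moreover have "\<exists>j\<in>A. g j < f j"
  proof (rule ccontr)
    assume "\<not> (\<exists>j\<in>A. g j < f j)"
    then have "\<forall>j\<in>A. f j \<le> g j" by (simp add: not_less)
    moreover have "\<exists>j\<in>A. f j < g j" using calculation assms(3,4) by (metis order_less_le)
    ultimately have "sum f A < sum g A" by (rule sum_strict_mono_ex1[OF assms(1)])
    then show False using assms(2) by simp
  qed
  ultimately show ?thesis using that by blast
qed

locale spin_ladder =
  fixes J \<Delta> :: real and L n :: nat
  assumes J: "J = real n / 2" and n: "n \<ge> 1" and \<Delta>: "\<Delta> > 1" and L: "L \<ge> 2"
begin

abbreviation V where "V \<equiv> ladder J L"

abbreviation CC where "CC \<equiv> configs V (1/2)"

abbreviation TT where "TT \<equiv> tensor_space V (1/2)"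

abbreviation h where "h u v \<equiv> h_op \<Delta> (1/2) u v"

definition rung_sum :: "nat \<Rightarrow> (nat \<times> nat \<Rightarrow> real) \<Rightarrow> real" where
  "rung_sum \<alpha> \<sigma> = (\<Sum>j\<in>legs J. \<sigma> (\<alpha>, j))"

text \<open>These are the vectors invariant under permutations within each rung: up to such
  permutations a spin-1/2 configuration is determined by its rung sums. In this form a symmetric
  vector is visibly a function of a chain configuration.\<close>

definition Sym :: "(nat \<times> nat) vect set" where
  "Sym = {\<Phi>\<in>TT. \<forall>\<sigma>\<in>CC. \<forall>\<sigma>'\<in>CC. (\<forall>\<alpha>\<in>{1..L}. rung_sum \<alpha> \<sigma> = rung_sum \<alpha> \<sigma>') \<longrightarrow> \<Phi> \<sigma> = \<Phi> \<sigma>'}"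

lemma legs: "legs J = {1..n}"
  by (simp add: legs_def J)

lemma finite_legs [simp]: "finite (legs J)"
  by (simp add: legs)

lemma finite_V [simp]: "finite V"
  by (simp add: ladder_def)

lemma V_iff: "(\<alpha>, j) \<in> V \<longleftrightarrow> \<alpha> \<in> {1..L} \<and> j \<in> legs J"
  by (simp add: ladder_def)

lemma ladder_space_TT: "\<psi> \<in> ladder_space J L M \<Longrightarrow> \<psi> \<in> TT"
  by (simp add: ladder_space_def magnetization_space_def)

lemma lin_sub_ladder_space: "lin_sub (ladder_space J L M)"
  unfolding ladder_space_def by (rule lin_sub_magnetization_space[OF finite_V])

lemma ladder_space_outside: "\<psi> \<in> ladder_space J L M \<Longrightarrow> \<sigma> \<notin> CC \<Longrightarrow> \<psi> \<sigma> = 0"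
  by (rule tensor_space_vanish[OF ladder_space_TT])

section \<open>Gap of the uncoupled legs\<close>

definition bonds :: "(nat \<times> nat) set" where
  "bonds = {1..L - 1} \<times> legs J"

text \<open>A bond is labelled by its lower site, so \<open>up e\<close> is both the upper site of
  the bond \<open>e\<close> and the label of the next bond of the leg. Two different bonds share a
  site exactly when one is \<open>up\<close> of the other.\<close>

definition up :: "nat \<times> nat \<Rightarrow> nat \<times> nat" where
  "up e = (fst e + 1, snd e)"

lemma finite_bonds: "finite bonds"
  by (simp add: bonds_def)

lemma ladder_ham_bonds: "ladder_ham \<Delta> J L \<psi> = (\<lambda>\<sigma>. \<Sum>e\<in>bonds. h e (up e) \<psi> \<sigma>)"
  unfolding ladder_ham_def bonds_def up_def
  by (simp add: sum.cartesian_product case_prod_unfold)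

lemma bond:
  assumes "e \<in> bonds"
  shows "e \<noteq> up e" "e \<in> V" "up e \<in> V"
  using assms by (auto simp: bonds_def up_def V_iff)

definition adj :: "nat \<times> nat \<Rightarrow> nat \<times> nat \<Rightarrow> bool" where
  "adj e f \<longleftrightarrow> f = up e \<or> e = up f"

lemma ladder_ham_energy: "ip CC \<phi> (ladder_ham \<Delta> J L \<psi>) = (\<Sum>e\<in>bonds. ip CC \<phi> (h e (up e) \<psi>))"
  unfolding ladder_ham_bonds ip_sum_right ..

lemma ladder_ham_selfadjoint: "ip CC (ladder_ham \<Delta> J L f) g = ip CC f (ladder_ham \<Delta> J L g)"
  unfolding ladder_ham_bonds ip_sum_right ip_sum_left
  by (intro sum.cong refl h_half_selfadjoint[OF \<Delta> finite_V] bond)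

lemma bond_energy_nonneg:
  assumes "e \<in> bonds" "\<psi> \<in> TT"
  shows "0 \<le> Re (ip CC \<psi> (h e (up e) \<psi>))"
  using h_half_norm[OF \<Delta> finite_V bond[OF assms(1)] assms(2)] ip_self_nonneg by metis

lemma ladder_ham_nonneg: "\<psi> \<in> TT \<Longrightarrow> 0 \<le> Re (ip CC \<psi> (ladder_ham \<Delta> J L \<psi>))"
  unfolding ladder_ham_energy Re_sum by (intro sum_nonneg bond_energy_nonneg)

lemma ladder_ham_square_ge:
  assumes "\<psi> \<in> TT"
  shows "(1 - 1 / \<Delta>) * Re (ip CC \<psi> (ladder_ham \<Delta> J L \<psi>))
    \<le> Re (ip CC (ladder_ham \<Delta> J L \<psi>) (ladder_ham \<Delta> J L \<psi>))"
proof -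
  define x where "x e = Re (ip CC \<psi> (h e (up e) \<psi>))" for e
  define a where "a e f = Re (ip CC (h e (up e) \<psi>) (h f (up f) \<psi>))" for e f
  have up_adj: "- (1 / (4 * \<Delta>)) * (x e + x (up e)) \<le> a e (up e)" if "e \<in> bonds" "up e \<in> bonds" for e
    unfolding x_def a_def
    by (rule h_half_adjacent_ge[OF \<Delta> finite_V bond(1)[OF that(1)] bond(1)[OF that(2)] _
      bond(2,3)[OF that(1)] bond(3)[OF that(2)] assms]) (simp add: up_def prod_eq_iff)
  have "(1 - 4 * (1 / (4 * \<Delta>))) * (\<Sum>e\<in>bonds. x e) \<le> (\<Sum>e\<in>bonds. \<Sum>f\<in>bonds. a e f)"
  proof (rule sum_products_ge[where adj = adj])
    show "finite bonds" by (rule finite_bonds)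
    show "0 \<le> 1 / (4 * \<Delta>)" using \<Delta> by simp
    show "0 \<le> x e" if "e \<in> bonds" for e
      unfolding x_def by (rule bond_energy_nonneg[OF that assms])
    show "a e e = x e" if "e \<in> bonds" for e
      unfolding x_def a_def h_half_norm[OF \<Delta> finite_V bond[OF that] assms] ..
    show "- (1 / (4 * \<Delta>)) * (x e + x f) \<le> a e f" if "e \<in> bonds" "f \<in> bonds" "adj e f" for e f
      using that(3) unfolding adj_def
    proof
      assume "f = up e"
      then show ?thesis using up_adj that by blast
    next
      assume "e = up f"
      moreover have "a e f = a f e" unfolding a_def by (rule Re_ip_commute)
      ultimately show ?thesis using up_adj[of f] that by (simp add: add.commute)
    qed
    show "0 \<le> a e f" if ef: "e \<in> bonds" "f \<in> bonds" "e \<noteq> f" "\<not> adj e f" for e f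
      unfolding a_def
    proof (rule h_half_disjoint_nonneg[OF \<Delta> finite_V bond(1)[OF ef(1)] bond(1)[OF ef(2)] _
        bond(2,3)[OF ef(1)] bond(2,3)[OF ef(2)] assms])
      show "{e, up e} \<inter> {f, up f} = {}"
        using ef(3,4) by (auto simp: adj_def up_def prod_eq_iff)
    qed
    show "adj e f \<longleftrightarrow> adj f e" for e f by (auto simp: adj_def)
    show "\<not> adj e e" for e by (simp add: adj_def up_def prod_eq_iff)
    show "card {f\<in>bonds. adj e f} \<le> 2" for e
    proof -
      \<comment> \<open>These are the next and the previous bond of the leg. At an end of the leg
        one of them is not in \<open>bonds\<close>, which only lowers the count.\<close>
      have "{f\<in>bonds. adj e f} \<subseteq> {up e, (fst e - 1, snd e)}"
        by (auto simp: adj_def up_def)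
      then have "card {f\<in>bonds. adj e f} \<le> card {up e, (fst e - 1, snd e)}" by (intro card_mono) auto
      also have "\<dots> \<le> 2" by (simp add: card_insert_if)
      finally show ?thesis .
    qed
  qed
  moreover have "4 * (1 / (4 * \<Delta>)) = 1 / \<Delta>" using \<Delta> by simp
  moreover have "Re (ip CC \<psi> (ladder_ham \<Delta> J L \<psi>)) = (\<Sum>e\<in>bonds. x e)"
    unfolding x_def ladder_ham_energy Re_sum ..
  moreover have "Re (ip CC (ladder_ham \<Delta> J L \<psi>) (ladder_ham \<Delta> J L \<psi>)) = (\<Sum>e\<in>bonds. \<Sum>f\<in>bonds. a e f)"
    unfolding a_def ladder_ham_bonds ip_sum_right ip_sum_left Re_sum by (rule sum.swap)
  ultimately show ?thesis by simp
qed

lemma ladder_ham_add: "ladder_ham \<Delta> J L (\<lambda>x. f x + g x) = (\<lambda>x. ladder_ham \<Delta> J L f x + ladder_ham \<Delta> J L g x)"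
  unfolding ladder_ham_bonds h_op_add sum.distrib ..

lemma ladder_ham_scale: "ladder_ham \<Delta> J L (\<lambda>x. c * f x) = (\<lambda>x. c * ladder_ham \<Delta> J L f x)"
  unfolding ladder_ham_bonds h_op_scale sum_distrib_left ..

lemma ladder_ham_ladder_space:
  assumes "\<psi> \<in> ladder_space J L M"
  shows "ladder_ham \<Delta> J L \<psi> \<in> ladder_space J L M"
  unfolding ladder_ham_bonds
proof (rule lin_sub_sum[OF finite_bonds lin_sub_ladder_space])
  fix e assume e: "e \<in> bonds"
  show "h e (up e) \<psi> \<in> ladder_space J L M"
    using h_half_magnetization_space[OF bond[OF e] finite_V] assms unfolding ladder_space_def .
qed

lemma lin_sub_H0: "lin_sub (H0 \<Delta> J L M)"
  unfolding lin_sub_def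
proof (intro conjI ballI allI)
  show "zero_vect \<in> H0 \<Delta> J L M"
    using lin_sub_zero[OF lin_sub_ladder_space] ladder_ham_scale[of 0 zero_vect] unfolding H0_def by simp
next
  fix f g assume "f \<in> H0 \<Delta> J L M" "g \<in> H0 \<Delta> J L M"
  then show "(\<lambda>x. f x + g x) \<in> H0 \<Delta> J L M"
    using lin_sub_add[OF lin_sub_ladder_space, of f M g] ladder_ham_add[of f g] unfolding H0_def by simp
next
  fix c f assume "f \<in> H0 \<Delta> J L M"
  then show "(\<lambda>x. c * f x) \<in> H0 \<Delta> J L M"
    using lin_sub_scale[OF lin_sub_ladder_space, of f M c] ladder_ham_scale[of c f] unfolding H0_def by simp
qed

lemma Hexc_gap:
  assumes "w \<in> Hexc \<Delta> J L M"
  shows "(1 - 1 / \<Delta>) * Re (ip CC w w) \<le> Re (ip CC w (ladder_ham \<Delta> J L w))"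
proof (rule spectral_gap[where W = "ladder_space J L M"])
  show "finite CC" by simp
  show "lin_sub (ladder_space J L M)" by (rule lin_sub_ladder_space)
  show "f x = 0" if "f \<in> ladder_space J L M" "x \<notin> CC" for f x using ladder_space_outside[OF that] .
  show "ladder_ham \<Delta> J L f \<in> ladder_space J L M" if "f \<in> ladder_space J L M" for f
    by (rule ladder_ham_ladder_space[OF that])
  show "ladder_ham \<Delta> J L (\<lambda>x. f x + g x) = (\<lambda>x. ladder_ham \<Delta> J L f x + ladder_ham \<Delta> J L g x)" for f g
    by (rule ladder_ham_add)
  show "ladder_ham \<Delta> J L (\<lambda>x. c * f x) = (\<lambda>x. c * ladder_ham \<Delta> J L f x)" for c f
    by (rule ladder_ham_scale)
  show "ip CC (ladder_ham \<Delta> J L f) g = ip CC f (ladder_ham \<Delta> J L g)" for f g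
    by (rule ladder_ham_selfadjoint)
  show "0 \<le> Re (ip CC f (ladder_ham \<Delta> J L f))" if "f \<in> ladder_space J L M" for f
    by (rule ladder_ham_nonneg[OF ladder_space_TT[OF that]])
  show "0 < 1 - 1 / \<Delta>" using \<Delta> by simp
  show "(1 - 1 / \<Delta>) * Re (ip CC f (ladder_ham \<Delta> J L f)) \<le> Re (ip CC (ladder_ham \<Delta> J L f) (ladder_ham \<Delta> J L f))"
    if "f \<in> ladder_space J L M" for f
    by (rule ladder_ham_square_ge[OF ladder_space_TT[OF that]])
  show "w \<in> ladder_space J L M" using assms by (simp add: Hexc_def)
  show "ip CC k w = 0" if "k \<in> ladder_space J L M" "ladder_ham \<Delta> J L k = zero_vect" for k
    using assms that by (simp add: Hexc_def orth_to_def H0_def braket_ip)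
qed

section \<open>Symmetry of the ladder ground space\<close>

lemma rung_sum_swap:
  assumes "j \<in> legs J" "k \<in> legs J" "j \<noteq> k"
  shows "rung_sum \<beta> (swap (\<alpha>, j) (\<alpha>, k) \<sigma>) = rung_sum \<beta> \<sigma>"
proof (cases "\<beta> = \<alpha>")
  case True
  have "rung_sum \<beta> (swap (\<alpha>, j) (\<alpha>, k) \<sigma>) = (\<Sum>i\<in>legs J. swap j k (\<lambda>i. \<sigma> (\<alpha>, i)) i)"
    unfolding rung_sum_def True by (intro sum.cong refl) simp
  also have "\<dots> = rung_sum \<beta> \<sigma>"
    unfolding rung_sum_def True by (rule sum_swap[OF assms(3,1,2) finite_legs])
  finally show ?thesis .
next
  case False
  then show ?thesis by (simp add: rung_sum_def)
qed

text \<open>If two configurations have equal rung sums but differ, some rung carries both an excess and a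
  deficit, and exchanging these two spins brings the configurations closer.\<close>

lemma Sym_if_swap_invariant:
  assumes "\<Phi> \<in> TT"
    and inv: "\<And>\<alpha> j k \<sigma>. \<alpha> \<in> {1..L} \<Longrightarrow> j \<in> legs J \<Longrightarrow> k \<in> legs J \<Longrightarrow> j \<noteq> k \<Longrightarrow> \<sigma> \<in> CC \<Longrightarrow>
      \<Phi> (swap (\<alpha>, j) (\<alpha>, k) \<sigma>) = \<Phi> \<sigma>"
  shows "\<Phi> \<in> Sym"
proof -
  have "\<Phi> \<sigma> = \<Phi> \<sigma>'" if "\<sigma> \<in> CC" "\<sigma>' \<in> CC" "\<forall>\<alpha>\<in>{1..L}. rung_sum \<alpha> \<sigma> = rung_sum \<alpha> \<sigma>'" for \<sigma> \<sigma>'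
    using that
  proof (induction "card {x\<in>V. \<sigma> x \<noteq> \<sigma>' x}" arbitrary: \<sigma> rule: less_induct)
    case less
    show ?case
    proof (cases "\<forall>x\<in>V. \<sigma> x = \<sigma>' x")
      case True
      then have "\<sigma> = \<sigma>'" using less.prems(1,2) unfolding configs_def by (metis PiE_ext)
      then show ?thesis by simp
    next
      case False
      then obtain \<alpha> i where i: "\<alpha> \<in> {1..L}" "i \<in> legs J" "\<sigma> (\<alpha>, i) \<noteq> \<sigma>' (\<alpha>, i)"
        unfolding ladder_def by auto
      have "(\<Sum>j\<in>legs J. \<sigma> (\<alpha>, j)) = (\<Sum>j\<in>legs J. \<sigma>' (\<alpha>, j))"
        using less.prems(3) i(1) unfolding rung_sum_def by blast
      from sum_eq_excess_deficit[OF finite_legs this i(2,3)]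
      obtain j k where jk: "j \<in> legs J" "k \<in> legs J" "\<sigma> (\<alpha>, j) < \<sigma>' (\<alpha>, j)" "\<sigma>' (\<alpha>, k) < \<sigma> (\<alpha>, k)" .
      have inV: "(\<alpha>, j) \<in> V" "(\<alpha>, k) \<in> V" using i jk by (auto simp: V_iff)
      have jk_ne: "j \<noteq> k" using jk by auto
      have cases: "x = - (1/2) \<or> x = 1/2" if "x \<in> {\<sigma> (\<alpha>, j), \<sigma> (\<alpha>, k), \<sigma>' (\<alpha>, j), \<sigma>' (\<alpha>, k)}" for x
        using that configs_half_cases[OF less.prems(1) inV(1)] configs_half_cases[OF less.prems(1) inV(2)]
          configs_half_cases[OF less.prems(2) inV(1)] configs_half_cases[OF less.prems(2) inV(2)] by blast
      \<comment> \<open>With only two possible labels the strict inequalities determine all four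
        values, so after the exchange both legs agree with \<open>\<sigma>'\<close>.\<close>
      have v: "\<sigma> (\<alpha>, j) = \<sigma>' (\<alpha>, k)" "\<sigma> (\<alpha>, k) = \<sigma>' (\<alpha>, j)"
        using cases[of "\<sigma> (\<alpha>, j)"] cases[of "\<sigma> (\<alpha>, k)"] cases[of "\<sigma>' (\<alpha>, j)"] cases[of "\<sigma>' (\<alpha>, k)"] jk
        by auto
      define \<tau> where "\<tau> = swap (\<alpha>, j) (\<alpha>, k) \<sigma>"
      have \<tau>: "\<tau> \<in> CC" unfolding \<tau>_def by (rule swap_configs[OF less.prems(1) inV])
      have "{x\<in>V. \<tau> x \<noteq> \<sigma>' x} \<subseteq> {x\<in>V. \<sigma> x \<noteq> \<sigma>' x} - {(\<alpha>, j)}"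
        using v jk_ne by (auto simp: \<tau>_def)
      moreover have "(\<alpha>, j) \<in> {x\<in>V. \<sigma> x \<noteq> \<sigma>' x}" using jk inV by auto
      ultimately have "card {x\<in>V. \<tau> x \<noteq> \<sigma>' x} < card {x\<in>V. \<sigma> x \<noteq> \<sigma>' x}"
        by (intro psubset_card_mono) auto
      moreover have "\<forall>\<alpha>\<in>{1..L}. rung_sum \<alpha> \<tau> = rung_sum \<alpha> \<sigma>'"
        using less.prems(3) unfolding \<tau>_def rung_sum_swap[OF jk(1,2) jk_ne] .
      ultimately have "\<Phi> \<tau> = \<Phi> \<sigma>'" using less.hyps[OF _ \<tau> less.prems(2)] by blast
      then show ?thesis unfolding \<tau>_def using inv[OF i(1) jk(1,2) jk_ne less.prems(1)] by simp
    qed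
  qed
  then show ?thesis using assms(1) unfolding Sym_def by blast
qed

lemma ladder_ham_full_zero:
  assumes "\<psi> \<in> TT" "ladder_ham_full \<Delta> J L \<psi> = zero_vect" "\<alpha> \<in> {1..L - 1}" "j \<in> legs J" "k \<in> legs J"
  shows "h (\<alpha>, j) (\<alpha> + 1, k) \<psi> = zero_vect"
proof -
  let ?I = "{1..L - 1} \<times> legs J \<times> legs J"
  have "(\<lambda>\<sigma>. \<Sum>i\<in>?I. h (fst i, fst (snd i)) (fst i + 1, snd (snd i)) \<psi> \<sigma>) = zero_vect"
    using assms(2) unfolding ladder_ham_full_def by (simp add: sum.cartesian_product case_prod_unfold)
  from frustration_free_sum_zero[OF \<Delta> finite_V _ assms(1) _ this, of "(\<alpha>, j, k)"] show ?thesis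
    using assms(3-5) L by (fastforce simp: V_iff)
qed

lemma ladder_ground_subset_H0: "ladder_ground \<Delta> J L M \<subseteq> H0 \<Delta> J L M"
proof
  fix \<psi> assume "\<psi> \<in> ladder_ground \<Delta> J L M"
  then have \<psi>: "\<psi> \<in> ladder_space J L M" "ladder_ham_full \<Delta> J L \<psi> = zero_vect"
    by (simp_all add: ladder_ground_def)
  have "ladder_ham \<Delta> J L \<psi> = zero_vect"
    unfolding ladder_ham_def using ladder_ham_full_zero[OF ladder_space_TT[OF \<psi>(1)] \<psi>(2)] by simp
  then show "\<psi> \<in> H0 \<Delta> J L M" using \<psi>(1) by (simp add: H0_def)
qed

lemma ladder_ground_subset_Sym: "ladder_ground \<Delta> J L M \<subseteq> Sym"
proof
  fix \<psi> assume "\<psi> \<in> ladder_ground \<Delta> J L M"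
  then have \<psi>: "\<psi> \<in> ladder_space J L M" "ladder_ham_full \<Delta> J L \<psi> = zero_vect"
    by (simp_all add: ladder_ground_def)
  note z = ladder_ham_full_zero[OF ladder_space_TT[OF \<psi>(1)] \<psi>(2)]
  show "\<psi> \<in> Sym"
  proof (rule Sym_if_swap_invariant[OF ladder_space_TT[OF \<psi>(1)]])
    fix \<alpha> j k \<sigma>
    assume a: "\<alpha> \<in> {1..L}" "j \<in> legs J" "k \<in> legs J" "j \<noteq> k" "\<sigma> \<in> CC"
    have inV: "(\<alpha>, j) \<in> V" "(\<alpha>, k) \<in> V" using a by (auto simp: V_iff)
    show "\<psi> (swap (\<alpha>, j) (\<alpha>, k) \<sigma>) = \<psi> \<sigma>"
    \<comment> \<open>Since \<open>L \<ge> 2\<close>, every rung has a neighbouring rung through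
      which to exchange: the next one, or the previous one for the last rung.\<close>
    proof (cases "\<alpha> < L")
      case True
      then have "h (\<alpha>, j) (\<alpha> + 1, j) \<psi> = zero_vect \<and> h (\<alpha>, k) (\<alpha> + 1, j) \<psi> = zero_vect"
        using z a by auto
      moreover have "(\<alpha> + 1, j) \<in> V" using True a by (auto simp: V_iff)
      ultimately show ?thesis
        using a by (intro exchange_via_neighbour[OF \<Delta>, of _ _ "(\<alpha> + 1, j)", OF _ _ _ inV]) simp_all
    next
      case False
      then obtain \<beta> where \<beta>: "\<alpha> = \<beta> + 1" "\<beta> \<in> {1..L - 1}" using a L by (cases \<alpha>) auto
      then have "h (\<beta>, j) (\<alpha>, j) \<psi> = zero_vect \<and> h (\<beta>, j) (\<alpha>, k) \<psi> = zero_vect"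
        using z a by auto
      moreover have "(\<beta>, j) \<in> V" using \<beta> a by (auto simp: V_iff)
      ultimately show ?thesis
        using a \<beta> by (intro exchange_via_neighbour[OF \<Delta>, of _ _ "(\<beta>, j)", OF _ _ _ inV]) simp_all
    qed
  qed
qed

end

section \<open>The projection on symmetric rungs\<close>

lemma configs_comp:
  assumes "p permutes A" "\<eta> \<in> configs A s"
  shows "\<eta> \<circ> p \<in> configs A s"
  using assms(2) permutes_in_image[OF assms(1)] permutes_not_in[OF assms(1)]
  by (auto simp: configs_def PiE_def extensional_def)

lemma configs_comp_iff:
  assumes "p permutes A"
  shows "\<eta> \<circ> p \<in> configs A s \<longleftrightarrow> \<eta> \<in> configs A s"
proof
  assume "\<eta> \<circ> p \<in> configs A s"
  from configs_comp[OF permutes_inv[OF assms] this] show "\<eta> \<in> configs A s"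
    using permutes_inv_o(1)[OF assms] by (simp add: comp_assoc)
qed (rule configs_comp[OF assms])

lemma bij_comp_configs:
  assumes "p permutes A"
  shows "bij_betw (\<lambda>\<eta>. \<eta> \<circ> p) (configs A s) (configs A s)"
  by (rule bij_betwI[where g = "\<lambda>\<eta>. \<eta> \<circ> inv p"])
    (simp_all add: configs_comp assms permutes_inv comp_assoc permutes_inv_o[OF assms])

text \<open>Averaging over a finite group projects orthogonally on its invariants; this gives the
  definite description in \<open>orth_proj\<close> an explicit form.\<close>

definition sym_average :: "'v set \<Rightarrow> 'v vect \<Rightarrow> 'v vect" where
  "sym_average A \<psi> = (\<lambda>\<eta>. inverse (of_nat (card {p. p permutes A})) * (\<Sum>p | p permutes A. \<psi> (\<eta> \<circ> p)))"

lemma of_nat_card_permutes_nonzero: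
  assumes "finite A"
  shows "of_nat (card {p. p permutes A}) \<noteq> (0::complex)"
  using assms by (simp add: card_permutations)

text \<open>Stated for an arbitrary family \<open>f\<close> because it serves twice, for the vectors
  of a single rung and for those of the whole ladder.\<close>

lemma ip_sym_average:
  assumes "finite A" "a = (\<lambda>x. inverse (of_nat (card {p. p permutes A})) * (\<Sum>p | p permutes A. f p x))"
    "\<And>p. p permutes A \<Longrightarrow> ip C \<chi> (f p) = ip C \<chi> g"
  shows "ip C \<chi> (\<lambda>x. g x - a x) = 0"
proof -
  have "ip C \<chi> a = inverse (of_nat (card {p. p permutes A})) * (\<Sum>p | p permutes A. ip C \<chi> (f p))"
    unfolding assms(2) ip_scale_right ip_sum_right ..
  also have "(\<Sum>p | p permutes A. ip C \<chi> (f p)) = of_nat (card {p. p permutes A}) * ip C \<chi> g"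
    using assms(3) by simp
  finally show ?thesis
    using of_nat_card_permutes_nonzero[OF assms(1)] by (simp add: ip_diff_right)
qed

context spin_ladder
begin

lemma orth_proj_sym_tensors:
  assumes "\<xi> \<in> tensor_space (legs J) (1/2)"
  shows "orth_proj (legs J) (1/2) (sym_tensors J) \<xi> = sym_average (legs J) \<xi>"
  unfolding orth_proj_def
proof (rule the_equality)
  let ?A = "sym_average (legs J) \<xi>" and ?C = "configs (legs J) (1/2)"
  have "?A \<eta> = 0" if "\<eta> \<notin> ?C" for \<eta>
  proof -
    have "\<xi> (\<eta> \<circ> p) = 0" if "p permutes legs J" for p
      using tensor_space_vanish[OF assms] configs_comp_iff[OF that] \<open>\<eta> \<notin> ?C\<close> by blast
    then show ?thesis by (simp add: sym_average_def)
  qed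
  \<comment> \<open>Composition with \<open>q\<close> only permutes the group over which the average
    runs.\<close>
  moreover have "?A (\<eta> \<circ> q) = ?A \<eta>" if "q permutes legs J" for q \<eta>
    using setum_permutations_compose_left[OF that, of "\<lambda>p. \<xi> (\<eta> \<circ> p)"]
    by (simp add: sym_average_def comp_assoc)
  ultimately have mem: "?A \<in> sym_tensors J"
    by (simp add: sym_tensors_def tensor_space_def)
  have orth: "ip ?C \<chi> (\<lambda>\<eta>. \<xi> \<eta> - ?A \<eta>) = 0" if "\<chi> \<in> sym_tensors J" for \<chi>
  proof (rule ip_sym_average[OF finite_legs])
    show "?A = (\<lambda>\<eta>. inverse (of_nat (card {p. p permutes legs J})) * (\<Sum>p | p permutes legs J. \<xi> (\<eta> \<circ> p)))"
      by (simp add: sym_average_def)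
    fix p assume p: "p permutes legs J"
    have "ip ?C (\<lambda>\<eta>. \<chi> (\<eta> \<circ> p)) (\<lambda>\<eta>. \<xi> (\<eta> \<circ> p)) = ip ?C \<chi> \<xi>"
      by (rule ip_reindex[OF bij_comp_configs[OF p]])
    moreover have "(\<lambda>\<eta>. \<chi> (\<eta> \<circ> p)) = \<chi>" using that p by (simp add: sym_tensors_def)
    ultimately show "ip ?C \<chi> (\<lambda>\<eta>. \<xi> (\<eta> \<circ> p)) = ip ?C \<chi> \<xi>" by simp
  qed
  show "?A \<in> sym_tensors J \<and> orth_to (legs J) (1/2) (\<lambda>\<sigma>. \<xi> \<sigma> - ?A \<sigma>) (sym_tensors J)"
    using mem orth by (simp add: orth_to_def braket_ip)
  fix \<phi> assume \<phi>: "\<phi> \<in> sym_tensors J \<and> orth_to (legs J) (1/2) (\<lambda>\<sigma>. \<xi> \<sigma> - \<phi> \<sigma>) (sym_tensors J)"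
  \<comment> \<open>Uniqueness: the difference of two candidates lies in the subspace and is
    orthogonal to it, hence orthogonal to itself.\<close>
  define d where "d = (\<lambda>\<sigma>. \<phi> \<sigma> - ?A \<sigma>)"
  have d: "d \<in> sym_tensors J" using \<phi> mem by (simp add: d_def sym_tensors_def tensor_space_def)
  have "d = (\<lambda>\<sigma>. (\<xi> \<sigma> - ?A \<sigma>) - (\<xi> \<sigma> - \<phi> \<sigma>))" by (simp add: d_def)
  then have "ip ?C d d = ip ?C d (\<lambda>\<sigma>. \<xi> \<sigma> - ?A \<sigma>) - ip ?C d (\<lambda>\<sigma>. \<xi> \<sigma> - \<phi> \<sigma>)"
    by (metis ip_diff_right)
  also have "\<dots> = 0" using orth[OF d] \<phi> d by (simp add: orth_to_def braket_ip)
  finally have z: "Re (ip ?C d d) \<le> 0" by simp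
  have "d \<sigma> = 0" for \<sigma>
  proof (cases "\<sigma> \<in> ?C")
    case True
    then show ?thesis using ip_self_eq_0[OF finite_configs[OF finite_legs] z] by blast
  next
    case False
    have "d \<in> tensor_space (legs J) (1/2)" using d by (simp add: sym_tensors_def)
    from tensor_space_vanish[OF this False] show ?thesis .
  qed
  then show "\<phi> = ?A" by (simp add: d_def fun_eq_iff)
qed

section \<open>The rung projections as averages over site permutations\<close>

definition rung_perm :: "nat \<Rightarrow> (nat \<Rightarrow> nat) \<Rightarrow> nat \<times> nat \<Rightarrow> nat \<times> nat" where
  "rung_perm \<alpha> p = (\<lambda>(\<beta>, j). if \<beta> = \<alpha> then (\<beta>, p j) else (\<beta>, j))"

lemma rung_perm_comp: "rung_perm \<alpha> p \<circ> rung_perm \<alpha> q = rung_perm \<alpha> (p \<circ> q)"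
  by (auto simp: rung_perm_def fun_eq_iff)

lemma rung_perm_commute: "\<alpha> \<noteq> \<beta> \<Longrightarrow> rung_perm \<alpha> p \<circ> rung_perm \<beta> q = rung_perm \<beta> q \<circ> rung_perm \<alpha> p"
  by (auto simp: rung_perm_def fun_eq_iff)

lemma rung_perm_permutes:
  assumes "p permutes legs J" "\<alpha> \<in> {1..L}"
  shows "rung_perm \<alpha> p permutes V"
proof (rule bij_imp_permutes)
  show "bij_betw (rung_perm \<alpha> p) V V"
  proof (rule bij_betwI[where g = "rung_perm \<alpha> (inv p)"])
    show "rung_perm \<alpha> p \<in> V \<rightarrow> V" "rung_perm \<alpha> (inv p) \<in> V \<rightarrow> V"
      using permutes_in_image[OF assms(1)] permutes_in_image[OF permutes_inv[OF assms(1)]]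
      by (auto simp: rung_perm_def V_iff)
    show "rung_perm \<alpha> (inv p) (rung_perm \<alpha> p x) = x" "rung_perm \<alpha> p (rung_perm \<alpha> (inv p) x) = x" for x
      using permutes_inverses[OF assms(1)] by (auto simp: rung_perm_def split: prod.splits)
  qed
  show "rung_perm \<alpha> p x = x" if "x \<notin> V" for x
    using that permutes_not_in[OF assms(1)] assms(2) by (auto simp: rung_perm_def V_iff split: prod.splits)
qed

lemma swap_eq_rung_perm: "swap (\<alpha>, j) (\<alpha>, k) \<sigma> = \<sigma> \<circ> rung_perm \<alpha> (transpose j k)"
  by (auto simp: rung_perm_def fun_eq_iff transpose_def)

lemma rung_sum_perm:
  assumes "p permutes legs J"
  shows "rung_sum \<beta> (\<sigma> \<circ> rung_perm \<alpha> p) = rung_sum \<beta> \<sigma>"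
proof (cases "\<beta> = \<alpha>")
  case True
  have "rung_sum \<beta> (\<sigma> \<circ> rung_perm \<alpha> p) = (\<Sum>j\<in>legs J. \<sigma> (\<alpha>, p j))"
    unfolding rung_sum_def True by (simp add: rung_perm_def)
  also have "\<dots> = rung_sum \<beta> \<sigma>"
    unfolding rung_sum_def True using sum.reindex_bij_betw[OF permutes_imp_bij[OF assms], of "\<lambda>j. \<sigma> (\<alpha>, j)"] .
  finally show ?thesis .
next
  case False
  then show ?thesis by (simp add: rung_sum_def rung_perm_def)
qed

text \<open>Replaces the slicewise projection by an average over permutations of the whole ladder,
  which makes the interplay of different rungs a matter of commuting permutations.\<close>

lemma rung_proj_eq:
  assumes "\<psi> \<in> TT" "\<alpha> \<in> {1..L}"
  shows "rung_proj J \<alpha> \<psi> = (\<lambda>\<sigma>. inverse (of_nat (card {p. p permutes legs J})) *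
    (\<Sum>p | p permutes legs J. \<psi> (\<sigma> \<circ> rung_perm \<alpha> p)))"
proof
  fix \<sigma>
  have "rung_slice \<alpha> \<sigma> \<psi> \<in> tensor_space (legs J) (1/2)"
  proof -
    have "\<eta> \<in> configs (legs J) (1/2)" if m: "(\<lambda>(\<beta>, j). if \<beta> = \<alpha> then \<eta> j else \<sigma> (\<beta>, j)) \<in> CC" for \<eta>
    proof -
      have "\<eta> j \<in> dint (- (1/2)) (1/2)" if "j \<in> legs J" for j
        using configs_val[OF m, of "(\<alpha>, j)"] that assms(2) by (simp add: V_iff)
      moreover have "\<eta> j = undefined" if "j \<notin> legs J" for j
        using PiE_arb[OF m[unfolded configs_def], of "(\<alpha>, j)"] that by (simp add: V_iff)
      ultimately show ?thesis by (auto simp: configs_def)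
    qed
    then show ?thesis
      unfolding tensor_space_def rung_slice_def using tensor_space_vanish[OF assms(1)] by blast
  qed
  from orth_proj_sym_tensors[OF this]
  have "rung_proj J \<alpha> \<psi> \<sigma> = sym_average (legs J) (rung_slice \<alpha> \<sigma> \<psi>) (\<lambda>j. \<sigma> (\<alpha>, j))"
    by (simp add: rung_proj_def)
  moreover have "rung_slice \<alpha> \<sigma> \<psi> ((\<lambda>j. \<sigma> (\<alpha>, j)) \<circ> p) = \<psi> (\<sigma> \<circ> rung_perm \<alpha> p)" for p
    unfolding rung_slice_def by (intro arg_cong[of _ _ \<psi>]) (auto simp: rung_perm_def fun_eq_iff)
  ultimately show "rung_proj J \<alpha> \<psi> \<sigma> = inverse (of_nat (card {p. p permutes legs J})) *
      (\<Sum>p | p permutes legs J. \<psi> (\<sigma> \<circ> rung_perm \<alpha> p))"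
    by (simp add: sym_average_def)
qed

lemma comp_rung_perm_TT:
  assumes "\<psi> \<in> TT" "\<alpha> \<in> {1..L}" "p permutes legs J"
  shows "(\<lambda>\<sigma>. \<psi> (\<sigma> \<circ> rung_perm \<alpha> p)) \<in> TT"
proof -
  have "\<psi> (\<sigma> \<circ> rung_perm \<alpha> p) = 0" if "\<sigma> \<notin> CC" for \<sigma>
    using tensor_space_vanish[OF assms(1)] configs_comp_iff[OF rung_perm_permutes[OF assms(3,2)]] that by blast
  then show ?thesis by (simp add: tensor_space_def)
qed

lemma finite_perms: "finite {p. p permutes legs J}"
  by (rule finite_permutations[OF finite_legs])

lemma rung_proj_TT:
  assumes "\<psi> \<in> TT" "\<alpha> \<in> {1..L}"
  shows "rung_proj J \<alpha> \<psi> \<in> TT"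
  unfolding rung_proj_eq[OF assms]
  by (intro lin_sub_scale lin_sub_sum finite_perms lin_sub_tensor_space comp_rung_perm_TT assms) simp

lemma rung_proj_ladder_space:
  assumes "\<psi> \<in> ladder_space J L M" "\<alpha> \<in> {1..L}"
  shows "rung_proj J \<alpha> \<psi> \<in> ladder_space J L M"
  unfolding rung_proj_eq[OF ladder_space_TT[OF assms(1)] assms(2)]
proof (intro lin_sub_scale lin_sub_sum finite_perms lin_sub_ladder_space)
  fix p assume "p \<in> {p. p permutes legs J}"
  then have p: "p permutes legs J" by simp
  note P = rung_perm_permutes[OF p assms(2)]
  have \<psi>: "\<psi> \<in> TT" "\<forall>\<sigma>\<in>CC. \<psi> \<sigma> \<noteq> 0 \<longrightarrow> (\<Sum>u\<in>V. \<sigma> u) = M"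
    using assms(1) unfolding ladder_space_def magnetization_space_iff[OF finite_V] by blast+
  have "(\<Sum>u\<in>V. (\<sigma> \<circ> rung_perm \<alpha> p) u) = (\<Sum>u\<in>V. \<sigma> u)" for \<sigma>
    using sum.reindex_bij_betw[OF permutes_imp_bij[OF P], of \<sigma>] by simp
  then have "\<forall>\<sigma>\<in>CC. \<psi> (\<sigma> \<circ> rung_perm \<alpha> p) \<noteq> 0 \<longrightarrow> (\<Sum>u\<in>V. \<sigma> u) = M"
    using \<psi>(2) configs_comp[OF P] by metis
  then show "(\<lambda>\<sigma>. \<psi> (\<sigma> \<circ> rung_perm \<alpha> p)) \<in> ladder_space J L M"
    unfolding ladder_space_def magnetization_space_iff[OF finite_V]
    using comp_rung_perm_TT[OF \<psi>(1) assms(2) p] by blast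
qed

lemma Sym_comp_rung_perm:
  assumes "\<chi> \<in> Sym" "\<alpha> \<in> {1..L}" "p permutes legs J" "\<sigma> \<in> CC"
  shows "\<chi> (\<sigma> \<circ> rung_perm \<alpha> p) = \<chi> \<sigma>"
  using assms(1) configs_comp[OF rung_perm_permutes[OF assms(3,2)] assms(4)] assms(4) rung_sum_perm[OF assms(3)]
  unfolding Sym_def by blast

text \<open>A symmetric vector has the same inner product with \<open>\<psi>\<close> as with each of
  its translates under permutations of one rung, hence also with their average.\<close>

lemma rung_proj_orth:
  assumes "\<psi> \<in> TT" "\<alpha> \<in> {1..L}" "\<chi> \<in> Sym"
  shows "ip CC \<chi> (\<lambda>\<sigma>. \<psi> \<sigma> - rung_proj J \<alpha> \<psi> \<sigma>) = 0"
proof (rule ip_sym_average[OF finite_legs rung_proj_eq[OF assms(1,2)]])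
  fix p assume p: "p permutes legs J"
  have "ip CC (\<lambda>\<sigma>. \<chi> (\<sigma> \<circ> rung_perm \<alpha> p)) (\<lambda>\<sigma>. \<psi> (\<sigma> \<circ> rung_perm \<alpha> p)) = ip CC \<chi> \<psi>"
    by (rule ip_reindex[OF bij_comp_configs[OF rung_perm_permutes[OF p assms(2)]]])
  moreover have "ip CC (\<lambda>\<sigma>. \<chi> (\<sigma> \<circ> rung_perm \<alpha> p)) (\<lambda>\<sigma>. \<psi> (\<sigma> \<circ> rung_perm \<alpha> p)) =
      ip CC \<chi> (\<lambda>\<sigma>. \<psi> (\<sigma> \<circ> rung_perm \<alpha> p))"
    by (intro ip_cong refl Sym_comp_rung_perm[OF assms(3,2) p])
  ultimately show "ip CC \<chi> (\<lambda>\<sigma>. \<psi> (\<sigma> \<circ> rung_perm \<alpha> p)) = ip CC \<chi> \<psi>" by simp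
qed

text \<open>Symmetry on a single rung is what one factor of \<open>P_lattice\<close> contributes;
  \<open>Sym\<close> is reached only when all rungs have been treated.\<close>

definition rung_invariant :: "nat \<Rightarrow> (nat \<times> nat) vect \<Rightarrow> bool" where
  "rung_invariant \<alpha> \<psi> \<longleftrightarrow> (\<forall>q \<sigma>. q permutes legs J \<longrightarrow> \<psi> (\<sigma> \<circ> rung_perm \<alpha> q) = \<psi> \<sigma>)"

lemma rung_proj_invariant:
  assumes "\<psi> \<in> TT" "\<alpha> \<in> {1..L}"
  shows "rung_invariant \<alpha> (rung_proj J \<alpha> \<psi>)"
  unfolding rung_invariant_def
proof (intro allI impI)
  fix q \<sigma> assume q: "q permutes legs J"
  show "rung_proj J \<alpha> \<psi> (\<sigma> \<circ> rung_perm \<alpha> q) = rung_proj J \<alpha> \<psi> \<sigma>"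
    using setum_permutations_compose_left[OF q, of "\<lambda>p. \<psi> (\<sigma> \<circ> rung_perm \<alpha> p)"]
    unfolding rung_proj_eq[OF assms] comp_assoc rung_perm_comp by simp
qed

lemma rung_proj_preserves_invariant:
  assumes "\<psi> \<in> TT" "\<alpha> \<in> {1..L}" "\<beta> \<noteq> \<alpha>" "rung_invariant \<beta> \<psi>"
  shows "rung_invariant \<beta> (rung_proj J \<alpha> \<psi>)"
  unfolding rung_invariant_def
proof (intro allI impI)
  fix q \<sigma> assume q: "q permutes legs J"
  have "\<psi> (\<sigma> \<circ> rung_perm \<beta> q \<circ> rung_perm \<alpha> p) = \<psi> (\<sigma> \<circ> rung_perm \<alpha> p)" for p
    using assms(4) q rung_perm_commute[OF assms(3), of q p] unfolding rung_invariant_def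
    by (metis comp_assoc)
  then show "rung_proj J \<alpha> \<psi> (\<sigma> \<circ> rung_perm \<beta> q) = rung_proj J \<alpha> \<psi> \<sigma>"
    unfolding rung_proj_eq[OF assms(1,2)] by simp
qed

text \<open>The outermost factor symmetrizes its own rung, keeps the rungs already symmetrized
  because permutations of different rungs commute, and changes the vector only orthogonally to
  \<open>Sym\<close>. For the full list this identifies the product as the orthogonal projection on
  \<open>Sym\<close>.\<close>

lemma foldr_rung_proj:
  defines "Q \<equiv> \<lambda>xs. foldr (\<lambda>\<alpha> A. rung_proj J \<alpha> \<circ> A) xs id"
  assumes "\<psi> \<in> TT" "set xs \<subseteq> {1..L}"
  shows "Q xs \<psi> \<in> TT \<and> (\<forall>\<alpha>\<in>set xs. rung_invariant \<alpha> (Q xs \<psi>)) \<and>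
    (\<forall>\<chi>\<in>Sym. ip CC \<chi> (\<lambda>\<sigma>. \<psi> \<sigma> - Q xs \<psi> \<sigma>) = 0) \<and>
    (\<forall>M. \<psi> \<in> ladder_space J L M \<longrightarrow> Q xs \<psi> \<in> ladder_space J L M)"
  using assms(3)
proof (induction xs)
  case Nil
  then show ?case using assms(2) by (simp add: Q_def)
next
  case (Cons \<alpha> xs)
  have Q: "Q (\<alpha> # xs) \<psi> = rung_proj J \<alpha> (Q xs \<psi>)" by (simp add: Q_def)
  have \<alpha>: "\<alpha> \<in> {1..L}" using Cons.prems by simp
  have IH: "Q xs \<psi> \<in> TT" "\<forall>\<alpha>\<in>set xs. rung_invariant \<alpha> (Q xs \<psi>)"
    "\<forall>\<chi>\<in>Sym. ip CC \<chi> (\<lambda>\<sigma>. \<psi> \<sigma> - Q xs \<psi> \<sigma>) = 0"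
    "\<forall>M. \<psi> \<in> ladder_space J L M \<longrightarrow> Q xs \<psi> \<in> ladder_space J L M"
    using Cons by auto
  have "rung_invariant \<beta> (Q (\<alpha> # xs) \<psi>)" if "\<beta> \<in> set (\<alpha> # xs)" for \<beta>
    unfolding Q using that rung_proj_invariant[OF IH(1) \<alpha>] rung_proj_preserves_invariant[OF IH(1) \<alpha>] IH(2)
    by (cases "\<beta> = \<alpha>") auto
  moreover have "ip CC \<chi> (\<lambda>\<sigma>. \<psi> \<sigma> - Q (\<alpha> # xs) \<psi> \<sigma>) = 0" if "\<chi> \<in> Sym" for \<chi>
    using bspec[OF IH(3) that] rung_proj_orth[OF IH(1) \<alpha> that] unfolding Q ip_diff_right by simp
  moreover have "Q (\<alpha> # xs) \<psi> \<in> TT" unfolding Q by (rule rung_proj_TT[OF IH(1) \<alpha>])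
  moreover have "Q (\<alpha> # xs) \<psi> \<in> ladder_space J L M" if "\<psi> \<in> ladder_space J L M" for M
    unfolding Q using rung_proj_ladder_space[OF _ \<alpha>] IH(4) that by blast
  ultimately show ?case by blast
qed

abbreviation PP where "PP \<equiv> P_lattice J L"

lemma P_lattice:
  assumes "\<psi> \<in> TT"
  shows P_lattice_Sym: "PP \<psi> \<in> Sym"
    and P_lattice_orth: "\<chi> \<in> Sym \<Longrightarrow> ip CC \<chi> (PP \<psi>) = ip CC \<chi> \<psi>"
    and P_lattice_ladder_space: "\<psi> \<in> ladder_space J L M \<Longrightarrow> PP \<psi> \<in> ladder_space J L M"
proof -
  have "set [1..<L + 1] = {1..L}" by auto
  with foldr_rung_proj[OF assms, of "[1..<L + 1]"]
  have P: "PP \<psi> \<in> TT" "\<forall>\<alpha>\<in>{1..L}. rung_invariant \<alpha> (PP \<psi>)"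
    "\<forall>\<chi>\<in>Sym. ip CC \<chi> (\<lambda>\<sigma>. \<psi> \<sigma> - PP \<psi> \<sigma>) = 0" "\<forall>M. \<psi> \<in> ladder_space J L M \<longrightarrow> PP \<psi> \<in> ladder_space J L M"
    unfolding P_lattice_def by auto
  show "PP \<psi> \<in> Sym"
  proof (rule Sym_if_swap_invariant[OF P(1)])
    fix \<alpha> j k \<sigma> assume "\<alpha> \<in> {1..L}" "j \<in> legs J" "k \<in> legs J"
    then show "PP \<psi> (swap (\<alpha>, j) (\<alpha>, k) \<sigma>) = PP \<psi> \<sigma>"
      using P(2) permutes_swap_id[of j "legs J" k] unfolding rung_invariant_def swap_eq_rung_perm by blast
  qed
  show "\<chi> \<in> Sym \<Longrightarrow> ip CC \<chi> (PP \<psi>) = ip CC \<chi> \<psi>"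
    using P(3) unfolding ip_diff_right by simp
  show "\<psi> \<in> ladder_space J L M \<Longrightarrow> PP \<psi> \<in> ladder_space J L M" using P(4) by blast
qed

end

section \<open>The lower bound on the ladder energy\<close>

context spin_ladder
begin

lemma Sym_TT: "\<Phi> \<in> Sym \<Longrightarrow> \<Phi> \<in> TT"
  by (simp add: Sym_def)

lemma H0_ladder_space: "\<psi> \<in> H0 \<Delta> J L M \<Longrightarrow> \<psi> \<in> ladder_space J L M"
  by (simp add: H0_def)

lemma H0_perp_H0: "\<psi> \<in> H0_perp \<Delta> J L M \<Longrightarrow> \<psi> \<in> H0 \<Delta> J L M"
  by (simp add: H0_perp_def)

lemma norm_pos:
  assumes "\<psi> \<in> TT" "\<psi> \<noteq> zero_vect"
  shows "0 < Re (ip CC \<psi> \<psi>)"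
proof (rule ccontr)
  assume "\<not> 0 < Re (ip CC \<psi> \<psi>)"
  then have z: "Re (ip CC \<psi> \<psi>) \<le> 0" by simp
  have "\<psi> \<sigma> = 0" for \<sigma>
    using ip_self_eq_0[OF finite_configs[OF finite_V] z] tensor_space_vanish[OF assms(1)] by blast
  then show False using assms(2) by blast
qed

lemma ip_P_lattice_self:
  assumes "\<psi> \<in> TT"
  shows "ip CC (PP \<psi>) (PP \<psi>) = ip CC \<psi> (PP \<psi>)"
  using P_lattice_orth[OF assms P_lattice_Sym[OF assms]] ip_commute[of CC \<psi> "PP \<psi>"]
    ip_commute[of CC "PP \<psi>" "PP \<psi>"] by simp

lemma P_lattice_le:
  assumes "\<psi> \<in> TT"
  shows "Re (ip CC \<psi> (PP \<psi>)) \<le> Re (ip CC \<psi> \<psi>)"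
proof -
  have "0 \<le> Re (ip CC (\<lambda>\<sigma>. \<psi> \<sigma> - PP \<psi> \<sigma>) (\<lambda>\<sigma>. \<psi> \<sigma> - PP \<psi> \<sigma>))" by (rule ip_self_nonneg)
  also have "\<dots> = Re (ip CC \<psi> \<psi>) - Re (ip CC \<psi> (PP \<psi>))"
    unfolding ip_diff_left ip_diff_right ip_P_lattice_self[OF assms]
      P_lattice_orth[OF assms P_lattice_Sym[OF assms], symmetric] by simp
  finally show ?thesis by simp
qed

lemma rayleigh_P_lattice:
  assumes "\<psi> \<in> TT"
  shows "0 \<le> ladder_rayleigh J L PP \<psi>" "ladder_rayleigh J L PP \<psi> \<le> 1"
proof -
  have "0 \<le> Re (ip CC \<psi> (PP \<psi>))" using ip_self_nonneg[of CC "PP \<psi>"] unfolding ip_P_lattice_self[OF assms] .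
  then show "0 \<le> ladder_rayleigh J L PP \<psi>"
    unfolding rayleigh_def braket_ip using ip_self_nonneg by (rule divide_nonneg_nonneg)
  show "ladder_rayleigh J L PP \<psi> \<le> 1"
    unfolding rayleigh_def braket_ip using P_lattice_le[OF assms] ip_self_nonneg[of CC \<psi>]
    by (simp add: divide_le_eq)
qed

definition overlap :: "(nat \<times> nat) vect \<Rightarrow> real" where
  "overlap \<psi> = (if \<psi> = zero_vect then 0 else ladder_rayleigh J L PP \<psi>)"

text \<open>Cauchy-Schwarz for \<open>\<phi>\<close> and \<open>P \<psi>'\<close>, using \<open>\<langle>\<psi>'|\<psi>'\<rangle> = \<langle>\<phi>|\<psi>'\<rangle> = \<langle>\<phi>|P \<psi>'\<rangle>\<close>.\<close>

lemma norm_sq_le_overlap: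
  assumes \<phi>: "\<phi> \<in> Sym" and \<psi>': "\<psi>' \<in> TT" and orth: "ip CC \<psi>' (\<lambda>\<sigma>. \<phi> \<sigma> - \<psi>' \<sigma>) = 0"
  shows "Re (ip CC \<psi>' \<psi>') \<le> Re (ip CC \<phi> \<phi>) * overlap \<psi>'"
proof (cases "\<psi>' = zero_vect")
  case True
  then show ?thesis by (simp add: overlap_def)
next
  case False
  define N a p where "N = Re (ip CC \<phi> \<phi>)" and "a = Re (ip CC \<psi>' \<psi>')" and "p = Re (ip CC \<psi>' (PP \<psi>'))"
  have a: "a > 0" unfolding a_def by (rule norm_pos[OF \<psi>' False])
  have eq: "ip CC \<psi>' \<phi> = ip CC \<psi>' \<psi>'" using orth by (simp add: ip_diff_right)
  have ap: "Re (ip CC \<phi> (PP \<psi>')) = a" "Re (ip CC (PP \<psi>') \<phi>) = a"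
    unfolding Re_ip_commute[of CC "PP \<psi>'" \<phi>] P_lattice_orth[OF \<psi>' \<phi>] Re_ip_commute[of CC \<phi> \<psi>'] eq a_def by simp_all
  have quad: "0 \<le> N - 2 * t * a + t\<^sup>2 * p" for t :: real
  proof -
    have "0 \<le> Re (ip CC (\<lambda>\<sigma>. \<phi> \<sigma> - complex_of_real t * PP \<psi>' \<sigma>) (\<lambda>\<sigma>. \<phi> \<sigma> - complex_of_real t * PP \<psi>' \<sigma>))"
      by (rule ip_self_nonneg)
    also have "\<dots> = N - 2 * t * a + t\<^sup>2 * p"
      unfolding ip_diff_left ip_diff_right ip_scale_left ip_scale_right ip_P_lattice_self[OF \<psi>']
      by (simp add: ap N_def p_def algebra_simps power2_eq_square)
    finally show ?thesis .
  qed
  \<comment> \<open>Pythagoras gives \<open>a \<le> N\<close>, and with \<open>a > 0\<close> this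
    makes \<open>N\<close> positive.\<close>
  have "0 \<le> Re (ip CC (\<lambda>\<sigma>. \<phi> \<sigma> - \<psi>' \<sigma>) (\<lambda>\<sigma>. \<phi> \<sigma> - \<psi>' \<sigma>))" by (rule ip_self_nonneg)
  also have "\<dots> = N - a"
    unfolding ip_diff_left[of CC \<phi> \<psi>'] orth using Re_ip_commute[of CC \<phi> \<psi>'] eq
    by (simp add: ip_diff_right N_def a_def)
  finally have N: "N > 0" using a by simp
  \<comment> \<open>The choice \<open>t = N / a\<close> yields the discriminant inequality
    \<open>a\<^sup>2 \<le> N * p\<close> without dividing by \<open>p\<close>, whose positivity is
    not yet known.\<close>
  have "0 \<le> N - 2 * (N / a) * a + (N / a)\<^sup>2 * p" by (rule quad)
  then have "N * 1 \<le> N * (N * p / (a * a))" using a by (simp add: power2_eq_square)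
  then have "1 \<le> N * p / (a * a)" using N by (metis mult_le_cancel_left_pos)
  then have "a \<le> N * (p / a)" using a by (simp add: le_divide_eq)
  then show ?thesis
    using False by (simp add: overlap_def rayleigh_def braket_ip N_def a_def p_def)
qed

text \<open>The energy of \<open>\<phi>\<close> is that of \<open>\<psi>''\<close>, because the
  Hamiltonian kills \<open>\<psi>'\<close>; the gap bounds it below by the squared norm of
  \<open>\<psi>''\<close>, and the overlap bounds how much of the norm of \<open>\<phi>\<close> can
  sit in \<open>\<psi>'\<close>. The estimate is kept free of division so that \<open>\<phi>\<close>
  may be zero.\<close>

lemma Sym_decomposition:
  assumes "\<phi> \<in> Sym" "\<phi> \<in> ladder_space J L M" "ladder_orth J L \<phi> (ladder_ground \<Delta> J L M)"
  obtains \<psi>' \<psi>'' where "\<psi>' \<in> H0_perp \<Delta> J L M" "\<psi>'' \<in> Hexc \<Delta> J L M" "\<phi> = (\<lambda>\<sigma>. \<psi>' \<sigma> + \<psi>'' \<sigma>)"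
    "(1 - 1 / \<Delta>) * (Re (ip CC \<phi> \<phi>) * (1 - overlap \<psi>')) \<le> Re (ip CC \<phi> (ladder_ham \<Delta> J L \<phi>))"
proof -
  obtain \<psi>' where \<psi>': "\<psi>' \<in> H0 \<Delta> J L M" "\<forall>\<chi>\<in>H0 \<Delta> J L M. ip CC \<chi> (\<lambda>\<sigma>. \<phi> \<sigma> - \<psi>' \<sigma>) = 0"
    using orthogonal_projection_exists[OF finite_configs[OF finite_V] lin_sub_H0, of M "1/2" \<phi>]
      ladder_space_outside[OF H0_ladder_space] by blast
  define \<psi>'' where "\<psi>'' = (\<lambda>\<sigma>. \<phi> \<sigma> - \<psi>' \<sigma>)"
  have sum: "\<phi> = (\<lambda>\<sigma>. \<psi>' \<sigma> + \<psi>'' \<sigma>)" by (simp add: \<psi>''_def)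
  have L: "\<psi>' \<in> ladder_space J L M" "ladder_ham \<Delta> J L \<psi>' = zero_vect" using \<psi>'(1) by (simp_all add: H0_def)
  have exc: "\<psi>'' \<in> Hexc \<Delta> J L M"
    using lin_sub_diff[OF lin_sub_ladder_space assms(2) L(1)] \<psi>'(2)
    unfolding Hexc_def orth_to_def braket_ip \<psi>''_def by simp
  \<comment> \<open>The ground space lies in \<open>H0\<close> and is thus orthogonal to
    \<open>\<psi>''\<close>, so the orthogonality of \<open>\<phi>\<close> to it passes to
    \<open>\<psi>'\<close>.\<close>
  have "ip CC \<chi> \<psi>' = 0" if "\<chi> \<in> ladder_ground \<Delta> J L M" for \<chi>
    using \<psi>'(2) assms(3) that ladder_ground_subset_H0 unfolding orth_to_def braket_ip ip_diff_right by fastforce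
  then have perp: "\<psi>' \<in> H0_perp \<Delta> J L M"
    using \<psi>'(1) by (simp add: H0_perp_def orth_to_def braket_ip)
  have o: "ip CC \<psi>' \<psi>'' = 0" "ip CC \<psi>'' \<psi>' = 0"
    using bspec[OF \<psi>'(2) \<psi>'(1)] ip_commute[of CC \<psi>'' \<psi>'] unfolding \<psi>''_def by simp_all
  have Hsum: "ladder_ham \<Delta> J L \<phi> = ladder_ham \<Delta> J L \<psi>''"
    using ladder_ham_add[of \<psi>' \<psi>''] L(2) unfolding sum[symmetric] by simp
  have "ip CC \<phi> (ladder_ham \<Delta> J L \<phi>) = ip CC (ladder_ham \<Delta> J L \<phi>) \<psi>''"
    unfolding Hsum ladder_ham_selfadjoint[symmetric, of \<phi>] ..
  also have "\<dots> = ip CC \<psi>'' (ladder_ham \<Delta> J L \<psi>'')"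
    unfolding Hsum ladder_ham_selfadjoint ..
  finally have energy: "ip CC \<phi> (ladder_ham \<Delta> J L \<phi>) = ip CC \<psi>'' (ladder_ham \<Delta> J L \<psi>'')" .
  have norm: "Re (ip CC \<phi> \<phi>) = Re (ip CC \<psi>' \<psi>') + Re (ip CC \<psi>'' \<psi>'')"
    unfolding sum ip_add_left ip_add_right o by simp
  have "Re (ip CC \<phi> \<phi>) * (1 - overlap \<psi>') \<le> Re (ip CC \<psi>'' \<psi>'')"
    using norm_sq_le_overlap[OF assms(1) ladder_space_TT[OF L(1)] bspec[OF \<psi>'(2) \<psi>'(1)]] norm
    by (simp add: algebra_simps)
  then have "(1 - 1 / \<Delta>) * (Re (ip CC \<phi> \<phi>) * (1 - overlap \<psi>')) \<le> (1 - 1 / \<Delta>) * Re (ip CC \<psi>'' \<psi>'')"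
    using \<Delta> by (intro mult_left_mono) simp_all
  also have "\<dots> \<le> Re (ip CC \<phi> (ladder_ham \<Delta> J L \<phi>))" unfolding energy by (rule Hexc_gap[OF exc])
  finally show ?thesis by (rule that[OF perp exc sum])
qed

lemma projected_decomposition:
  assumes \<psi>: "\<psi> \<in> ladder_space J L M" "ladder_orth J L \<psi> (ladder_ground \<Delta> J L M)"
  shows "\<exists>\<psi>' \<psi>''. \<psi>' \<in> H0_perp \<Delta> J L M \<and> \<psi>'' \<in> Hexc \<Delta> J L M \<and> PP \<psi> = (\<lambda>\<sigma>. \<psi>' \<sigma> + \<psi>'' \<sigma>) \<and>
    (PP \<psi> \<noteq> zero_vect \<longrightarrow>
      (1 - 1 / \<Delta>) * (1 - overlap \<psi>') \<le> ladder_rayleigh J L (ladder_ham \<Delta> J L) (PP \<psi>))"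
proof -
  note T = ladder_space_TT[OF \<psi>(1)]
  have "ladder_orth J L (PP \<psi>) (ladder_ground \<Delta> J L M)"
    using \<psi>(2) P_lattice_orth[OF T] ladder_ground_subset_Sym unfolding orth_to_def braket_ip by fastforce
  from Sym_decomposition[OF P_lattice_Sym[OF T] P_lattice_ladder_space[OF T \<psi>(1)] this]
  obtain \<psi>' \<psi>'' where d: "\<psi>' \<in> H0_perp \<Delta> J L M" "\<psi>'' \<in> Hexc \<Delta> J L M" "PP \<psi> = (\<lambda>\<sigma>. \<psi>' \<sigma> + \<psi>'' \<sigma>)"
    "(1 - 1 / \<Delta>) * (Re (ip CC (PP \<psi>) (PP \<psi>)) * (1 - overlap \<psi>')) \<le> Re (ip CC (PP \<psi>) (ladder_ham \<Delta> J L (PP \<psi>)))" .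
  have "(1 - 1 / \<Delta>) * (1 - overlap \<psi>') \<le> ladder_rayleigh J L (ladder_ham \<Delta> J L) (PP \<psi>)"
    if "PP \<psi> \<noteq> zero_vect"
    using d(4) norm_pos[OF Sym_TT[OF P_lattice_Sym[OF T]] that]
    unfolding rayleigh_def braket_ip by (simp add: le_divide_eq mult_ac)
  then show ?thesis using d(1-3) by blast
qed

lemma overlap_le_sup:
  assumes "\<psi>' \<in> H0_perp \<Delta> J L M"
  shows "overlap \<psi>' \<le> sup_overlap \<Delta> J L M"
proof (cases "H0_perp \<Delta> J L M = {zero_vect}")
  case True
  then show ?thesis using assms by (simp add: overlap_def sup_overlap_def)
next
  case False
  have T: "\<psi> \<in> TT" if "\<psi> \<in> H0_perp \<Delta> J L M" for \<psi>
    using that by (intro ladder_space_TT H0_ladder_space H0_perp_H0)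
  have le: "ladder_rayleigh J L PP \<psi> \<le> sup_overlap \<Delta> J L M" if "\<psi> \<in> H0_perp \<Delta> J L M - {zero_vect}" for \<psi>
  proof -
    \<comment> \<open>A supremum of reals dominates its members only if they are bounded above; a
      projection gives the bound 1.\<close>
    have "bdd_above (ladder_rayleigh J L PP ` (H0_perp \<Delta> J L M - {zero_vect}))"
      using rayleigh_P_lattice(2)[OF T] by (intro bdd_aboveI2[where M = 1]) blast
    from cSUP_upper[OF that this] show ?thesis using False by (simp add: sup_overlap_def)
  qed
  show ?thesis
  proof (cases "\<psi>' = zero_vect")
    case True
    \<comment> \<open>For \<open>\<psi>' = 0\<close> the claim is that the supremum is nonnegative,
      which any nonzero member of \<open>H0_perp\<close> shows.\<close>
    then obtain \<psi> where "\<psi> \<in> H0_perp \<Delta> J L M - {zero_vect}" using False assms by blast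
    then show ?thesis using le[of \<psi>] rayleigh_P_lattice(1)[OF T, of \<psi>] True by (simp add: overlap_def)
  next
    case False
    then show ?thesis using le[of \<psi>'] assms by (simp add: overlap_def)
  qed
qed

lemma Sym_energy_ge:
  assumes "\<phi> \<in> Sym" "\<phi> \<in> ladder_space J L M" "ladder_orth J L \<phi> (ladder_ground \<Delta> J L M)"
  shows "(1 - 1 / \<Delta>) * (1 - sup_overlap \<Delta> J L M) * Re (ip CC \<phi> \<phi>) \<le> Re (ip CC \<phi> (ladder_ham \<Delta> J L \<phi>))"
proof -
  obtain \<psi>' \<psi>'' where d: "\<psi>' \<in> H0_perp \<Delta> J L M"
    "(1 - 1 / \<Delta>) * (Re (ip CC \<phi> \<phi>) * (1 - overlap \<psi>')) \<le> Re (ip CC \<phi> (ladder_ham \<Delta> J L \<phi>))"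
    using Sym_decomposition[OF assms] by metis
  have "(1 - 1 / \<Delta>) * (Re (ip CC \<phi> \<phi>) * (1 - sup_overlap \<Delta> J L M)) \<le> (1 - 1 / \<Delta>) * (Re (ip CC \<phi> \<phi>) * (1 - overlap \<psi>'))"
    using overlap_le_sup[OF d(1)] \<Delta> ip_self_nonneg by (intro mult_left_mono) simp_all
  with d(2) show ?thesis by (simp add: mult_ac)
qed

section \<open>Energy of symmetric vectors\<close>

lemma Sym_swap:
  assumes "\<phi> \<in> Sym" "\<alpha> \<in> {1..L}" "j \<in> legs J" "k \<in> legs J" "\<sigma> \<in> CC"
  shows "\<phi> (swap (\<alpha>, j) (\<alpha>, k) \<sigma>) = \<phi> \<sigma>"
  unfolding swap_eq_rung_perm by (rule Sym_comp_rung_perm[OF assms(1,2) permutes_swap_id[OF assms(3,4)] assms(5)])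

text \<open>Exchanging the legs \<open>j\<close> and \<open>k\<close> on the upper rung leaves
  \<open>\<phi>\<close> fixed and carries one bond to the other; reindexing the inner product by
  this exchange equates the energies.\<close>

lemma Sym_bond_energy:
  assumes "\<phi> \<in> Sym" "\<alpha> \<in> {1..L - 1}" "j \<in> legs J" "k \<in> legs J"
  shows "ip CC \<phi> (h (\<alpha>, j) (\<alpha> + 1, k) \<phi>) = ip CC \<phi> (h (\<alpha>, j) (\<alpha> + 1, j) \<phi>)"
proof (cases "j = k")
  case False
  define s where "s \<sigma> = swap (\<alpha> + 1, j) (\<alpha> + 1, k) \<sigma>" for \<sigma> :: "nat \<times> nat \<Rightarrow> real"
  have \<alpha>: "\<alpha> \<in> {1..L}" "\<alpha> + 1 \<in> {1..L}" using assms(2) L by auto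
  have inV: "(\<alpha>, j) \<in> V" "(\<alpha> + 1, j) \<in> V" "(\<alpha> + 1, k) \<in> V" using \<alpha> assms by (auto simp: V_iff)
  have ne: "(\<alpha>, j) \<noteq> (\<alpha> + 1, j)" "(\<alpha>, j) \<noteq> (\<alpha> + 1, k)" "(\<alpha> + 1, j) \<noteq> (\<alpha> + 1, k)" using False by auto
  have sC: "s \<sigma> \<in> CC" if "\<sigma> \<in> CC" for \<sigma> unfolding s_def by (rule swap_configs[OF that inV(2,3)])
  have \<phi>s: "\<phi> (s \<sigma>) = \<phi> \<sigma>" if "\<sigma> \<in> CC" for \<sigma>
    unfolding s_def by (rule Sym_swap[OF assms(1) \<alpha>(2) assms(3,4) that])
  have hs: "h (\<alpha>, j) (\<alpha> + 1, k) \<phi> (s \<sigma>) = h (\<alpha>, j) (\<alpha> + 1, j) \<phi> \<sigma>" if \<sigma>: "\<sigma> \<in> CC" for \<sigma>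
  proof -
    have v: "s \<sigma> (\<alpha>, j) = \<sigma> (\<alpha>, j)" "s \<sigma> (\<alpha> + 1, k) = \<sigma> (\<alpha> + 1, j)" using ne by (auto simp: s_def)
    have "(s \<sigma>)((\<alpha>, j) := \<sigma> (\<alpha> + 1, j), (\<alpha> + 1, k) := \<sigma> (\<alpha>, j)) = s (swap (\<alpha>, j) (\<alpha> + 1, j) \<sigma>)"
      using ne by (auto simp: s_def fun_eq_iff)
    then have "\<phi> ((s \<sigma>)((\<alpha>, j) := \<sigma> (\<alpha> + 1, j), (\<alpha> + 1, k) := \<sigma> (\<alpha>, j))) = \<phi> (swap (\<alpha>, j) (\<alpha> + 1, j) \<sigma>)"
      using \<phi>s[OF swap_configs[OF \<sigma> inV(1,2)]] by simp
    then show ?thesis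
      unfolding h_op_half[OF ne(2) inV(1,3) sC[OF \<sigma>]] h_op_half[OF ne(1) inV(1,2) \<sigma>] v \<phi>s[OF \<sigma>] by simp
  qed
  have "ip CC \<phi> (h (\<alpha>, j) (\<alpha> + 1, k) \<phi>) = ip CC (\<lambda>\<sigma>. \<phi> (s \<sigma>)) (\<lambda>\<sigma>. h (\<alpha>, j) (\<alpha> + 1, k) \<phi> (s \<sigma>))"
    unfolding s_def by (rule ip_reindex[OF bij_swap_configs[OF ne(3) inV(2,3)], symmetric])
  also have "\<dots> = ip CC \<phi> (h (\<alpha>, j) (\<alpha> + 1, j) \<phi>)"
    by (intro ip_cong \<phi>s hs)
  finally show ?thesis .
qed simp

lemma Sym_full_energy:
  assumes "\<phi> \<in> Sym"
  shows "ip CC \<phi> (ladder_ham_full \<Delta> J L \<phi>) = of_nat n * ip CC \<phi> (ladder_ham \<Delta> J L \<phi>)"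
proof -
  have "ip CC \<phi> (ladder_ham_full \<Delta> J L \<phi>) =
      (\<Sum>\<alpha>\<in>{1..L - 1}. \<Sum>j\<in>legs J. \<Sum>k\<in>legs J. ip CC \<phi> (h (\<alpha>, j) (\<alpha> + 1, k) \<phi>))"
    unfolding ladder_ham_full_def ip_sum_right ..
  also have "\<dots> = (\<Sum>\<alpha>\<in>{1..L - 1}. \<Sum>j\<in>legs J. \<Sum>k\<in>legs J. ip CC \<phi> (h (\<alpha>, j) (\<alpha> + 1, j) \<phi>))"
    by (intro sum.cong refl Sym_bond_energy[OF assms])
  also have "\<dots> = of_nat n * ip CC \<phi> (ladder_ham \<Delta> J L \<phi>)"
    unfolding ladder_ham_def ip_sum_right sum_constant sum_distrib_left by (simp add: legs)
  finally show ?thesis .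
qed

end

section \<open>The chain as the symmetric part of the ladder\<close>

lemma site_op_sum: "site_op s A u (\<lambda>\<sigma>. \<Sum>i\<in>I. f i \<sigma>) = (\<lambda>\<sigma>. \<Sum>i\<in>I. site_op s A u (f i) \<sigma>)"
proof
  fix \<sigma>
  have "site_op s A u (\<lambda>\<sigma>. \<Sum>i\<in>I. f i \<sigma>) \<sigma> = (\<Sum>m\<in>dint (- s) s. \<Sum>i\<in>I. A (\<sigma> u) m * f i (\<sigma>(u := m)))"
    unfolding site_op_def sum_distrib_left ..
  also have "\<dots> = (\<Sum>i\<in>I. site_op s A u (f i) \<sigma>)"
    unfolding site_op_def by (rule sum.swap)
  finally show "site_op s A u (\<lambda>\<sigma>. \<Sum>i\<in>I. f i \<sigma>) \<sigma> = (\<Sum>i\<in>I. site_op s A u (f i) \<sigma>)" .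
qed

text \<open>The sign \<open>\<epsilon>\<close> treats raising and lowering together, so that the
  counting argument is carried out once.\<close>

definition ladder_op :: "real \<Rightarrow> real \<Rightarrow> real \<Rightarrow> real \<Rightarrow> complex" where
  "ladder_op \<epsilon> s = (if \<epsilon> = 1 then spin_plus s else spin_minus s)"

lemma ladder_op_apply:
  assumes "\<epsilon> = 1 \<or> \<epsilon> = - 1" "u \<in> V" "\<psi> \<in> tensor_space V s"
  shows "site_op s (ladder_op \<epsilon> s) u \<psi> \<sigma> =
    complex_of_real (sqrt (s * (s + 1) - (\<sigma> u - \<epsilon>) * \<sigma> u)) * \<psi> (\<sigma>(u := \<sigma> u - \<epsilon>))"
  using assms(1)
proof
  assume e: "\<epsilon> = 1"
  show ?thesis unfolding e ladder_op_def using S_plus_apply[OF assms(2,3), of \<sigma>] by simp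
next
  assume e: "\<epsilon> = - 1"
  show ?thesis unfolding e ladder_op_def using S_minus_apply[OF assms(2,3), of \<sigma>] by simp
qed

context spin_ladder
begin

section \<open>Rung sums and the sizes of their fibres\<close>

abbreviation chain_configs where "chain_configs \<equiv> configs {1..L} J"

abbreviation chain_tensors where "chain_tensors \<equiv> tensor_space {1..L} J"

lemma twice_J: "2 * J = real n"
  by (simp add: J)

text \<open>The number of legs contributing to \<open>ladder_op \<epsilon>\<close> at
  \<open>\<sigma>\<close>: such a leg carries \<open>\<epsilon> / 2\<close>, and the operator reads
  the vector with this spin flipped to \<open>- \<epsilon> / 2\<close>.\<close>

definition rung_count :: "real \<Rightarrow> nat \<Rightarrow> (nat \<times> nat \<Rightarrow> real) \<Rightarrow> nat" where
  "rung_count \<epsilon> \<alpha> \<sigma> = card {j \<in> legs J. \<sigma> (\<alpha>, j) = \<epsilon> / 2}"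

lemma rung_count:
  assumes "\<sigma> \<in> CC" "\<alpha> \<in> {1..L}" "\<epsilon> = 1 \<or> \<epsilon> = - 1"
  shows "real (rung_count \<epsilon> \<alpha> \<sigma>) = J + \<epsilon> * rung_sum \<alpha> \<sigma>"
proof -
  have \<epsilon>: "\<epsilon> * \<epsilon> = 1" "\<epsilon> \<noteq> 0" using assms(3) by auto
  have "\<sigma> (\<alpha>, j) = - (1/2) \<or> \<sigma> (\<alpha>, j) = 1/2" if "j \<in> legs J" for j
    using configs_half_cases[OF assms(1), of "(\<alpha>, j)"] that assms(2) V_iff by metis
  then have "\<epsilon> * \<sigma> (\<alpha>, j) = (if \<sigma> (\<alpha>, j) = \<epsilon> / 2 then 1 else 0) - 1/2" if "j \<in> legs J" for j
    using assms(3) that by force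
  then have "\<epsilon> * rung_sum \<alpha> \<sigma> = (\<Sum>j\<in>legs J. (if \<sigma> (\<alpha>, j) = \<epsilon> / 2 then 1 else 0) - 1/2)"
    unfolding rung_sum_def sum_distrib_left by (intro sum.cong refl)
  also have "\<dots> = real (rung_count \<epsilon> \<alpha> \<sigma>) - (\<Sum>j\<in>legs J. 1/2)"
    unfolding sum_subtractf rung_count_def by (simp add: sum.If_cases Int_def)
  also have "(\<Sum>j\<in>legs J. 1/2) = J" using twice_J by (simp add: legs)
  finally show ?thesis by simp
qed

definition rung_sums :: "(nat \<times> nat \<Rightarrow> real) \<Rightarrow> (nat \<Rightarrow> real)" where
  "rung_sums \<sigma> = restrict (\<lambda>\<alpha>. rung_sum \<alpha> \<sigma>) {1..L}"

lemma rung_sums_apply: "\<alpha> \<in> {1..L} \<Longrightarrow> rung_sums \<sigma> \<alpha> = rung_sum \<alpha> \<sigma>"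
  by (simp add: rung_sums_def)

lemma rung_sums_configs:
  assumes "\<sigma> \<in> CC"
  shows "rung_sums \<sigma> \<in> chain_configs"
proof -
  have "rung_sum \<alpha> \<sigma> \<in> dint (- J) J" if "\<alpha> \<in> {1..L}" for \<alpha>
  proof -
    have "rung_count 1 \<alpha> \<sigma> \<le> card (legs J)" unfolding rung_count_def by (intro card_mono) auto
    then have "rung_count 1 \<alpha> \<sigma> \<in> {..n}" by (simp add: legs)
    moreover have "rung_sum \<alpha> \<sigma> = real (rung_count 1 \<alpha> \<sigma>) - J"
      using rung_count[OF assms that, of 1] by simp
    ultimately show ?thesis unfolding dint_spin[OF twice_J] by blast
  qed
  then show ?thesis unfolding configs_def rung_sums_def by auto
qed

lemma Sym_rung_sums:
  "\<Phi> \<in> Sym \<longleftrightarrow> \<Phi> \<in> TT \<and> (\<forall>\<sigma>\<in>CC. \<forall>\<sigma>'\<in>CC. rung_sums \<sigma> = rung_sums \<sigma>' \<longrightarrow> \<Phi> \<sigma> = \<Phi> \<sigma>')"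
proof -
  have "rung_sums \<sigma> = rung_sums \<sigma>' \<longleftrightarrow> (\<forall>\<alpha>\<in>{1..L}. rung_sum \<alpha> \<sigma> = rung_sum \<alpha> \<sigma>')" for \<sigma> \<sigma>'
    unfolding rung_sums_def fun_eq_iff restrict_def by auto
  then show ?thesis unfolding Sym_def by simp
qed

definition fibre :: "(nat \<Rightarrow> real) \<Rightarrow> (nat \<times> nat \<Rightarrow> real) set" where
  "fibre \<tau> = {\<sigma>\<in>CC. rung_sums \<sigma> = \<tau>}"

lemma finite_fibre: "finite (fibre \<tau>)"
  by (simp add: fibre_def)

lemma fibre_nonempty:
  assumes "\<tau> \<in> chain_configs"
  shows "fibre \<tau> \<noteq> {}"
proof -
  have "\<exists>k. k \<le> n \<and> \<tau> \<alpha> = real k - J" if "\<alpha> \<in> {1..L}" for \<alpha>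
    using configs_val[OF assms that] unfolding dint_spin[OF twice_J] by auto
  then obtain k where k: "\<And>\<alpha>. \<alpha> \<in> {1..L} \<Longrightarrow> k \<alpha> \<le> n \<and> \<tau> \<alpha> = real (k \<alpha>) - J" by metis
  \<comment> \<open>A rung with \<open>k \<alpha>\<close> of its \<open>n\<close> spins up has sum
    \<open>k \<alpha> - n / 2\<close>, which is \<open>k \<alpha> - J\<close>.\<close>
  define \<sigma> where "\<sigma> = restrict (\<lambda>(\<alpha>, j). if j \<le> k \<alpha> then 1/2 else - (1/2::real)) V"
  have \<sigma>: "\<sigma> \<in> CC" unfolding configs_def \<sigma>_def by (auto simp: dint_half split: if_splits)
  have "rung_sum \<alpha> \<sigma> = \<tau> \<alpha>" if a: "\<alpha> \<in> {1..L}" for \<alpha>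
  proof -
    have "{j \<in> legs J. \<sigma> (\<alpha>, j) = 1/2} = {1..k \<alpha>}"
      using k[OF a] a by (auto simp: \<sigma>_def V_iff legs)
    then have "rung_count 1 \<alpha> \<sigma> = k \<alpha>" by (simp add: rung_count_def)
    then show ?thesis using rung_count[OF \<sigma> a, of 1] k[OF a] by simp
  qed
  then have "rung_sums \<sigma> = \<tau>"
    using assms unfolding rung_sums_def configs_def by (auto simp: fun_eq_iff PiE_def extensional_def)
  then show ?thesis using \<sigma> by (auto simp: fibre_def)
qed

text \<open>On chain configurations this is the product over the rungs of the binomial coefficients
  \<open>n\<close> over \<open>J + \<tau> \<alpha>\<close>. Only its positivity and the ratio of
  neighbouring values are used.\<close>

definition multiplicity :: "(nat \<Rightarrow> real) \<Rightarrow> real" where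
  "multiplicity \<tau> = real (card (fibre \<tau>))"

lemma multiplicity_pos: "\<tau> \<in> chain_configs \<Longrightarrow> 0 < multiplicity \<tau>"
  using fibre_nonempty finite_fibre by (simp add: multiplicity_def card_gt_0_iff)

lemma rung_sum_upd:
  assumes "j \<in> legs J"
  shows "rung_sum \<beta> (\<sigma>((\<alpha>, j) := x)) = rung_sum \<beta> \<sigma> + (if \<beta> = \<alpha> then x - \<sigma> (\<alpha>, j) else 0)"
proof (cases "\<beta> = \<alpha>")
  case True
  have "rung_sum \<alpha> (\<sigma>((\<alpha>, j) := x)) = (\<Sum>i\<in>legs J. \<sigma> (\<alpha>, i) + (if i = j then x - \<sigma> (\<alpha>, j) else 0))"
    unfolding rung_sum_def by (intro sum.cong refl) simp
  also have "\<dots> = rung_sum \<alpha> \<sigma> + (x - \<sigma> (\<alpha>, j))"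
    using assms by (simp add: sum.distrib rung_sum_def)
  finally show ?thesis using True by simp
qed (simp add: rung_sum_def)

lemma rung_sums_flip:
  assumes "\<alpha> \<in> {1..L}" "j \<in> legs J" "\<sigma> (\<alpha>, j) = \<epsilon> / 2"
  shows "rung_sums (\<sigma>((\<alpha>, j) := - \<epsilon> / 2)) = (rung_sums \<sigma>)(\<alpha> := rung_sums \<sigma> \<alpha> - \<epsilon>)"
  using assms(1,3) rung_sum_upd[OF assms(2)] by (auto simp: rung_sums_def fun_eq_iff)

lemma flip_CC:
  assumes "\<sigma> \<in> CC" "\<alpha> \<in> {1..L}" "j \<in> legs J" "\<epsilon> = 1 \<or> \<epsilon> = - 1"
  shows "\<sigma>((\<alpha>, j) := - \<epsilon> / 2) \<in> CC"
  using assms(2-4) by (intro configs_upd_half[OF assms(1)]) (auto simp: V_iff)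

text \<open>Double counting of the pairs of configurations that differ by flipping one spin of rung \<open>\<alpha>\<close>.\<close>

lemma multiplicity_step:
  assumes "\<tau> \<in> chain_configs" "\<alpha> \<in> {1..L}" "\<epsilon> = 1 \<or> \<epsilon> = - 1"
  shows "multiplicity \<tau> * (J + \<epsilon> * \<tau> \<alpha>) = multiplicity (\<tau>(\<alpha> := \<tau> \<alpha> - \<epsilon>)) * (J - \<epsilon> * \<tau> \<alpha> + 1)"
proof -
  let ?\<tau>' = "\<tau>(\<alpha> := \<tau> \<alpha> - \<epsilon>)"
  define A where "A = (SIGMA \<sigma>:fibre \<tau>. {j \<in> legs J. \<sigma> (\<alpha>, j) = \<epsilon> / 2})"
  define B where "B = (SIGMA \<sigma>:fibre ?\<tau>'. {j \<in> legs J. \<sigma> (\<alpha>, j) = - \<epsilon> / 2})"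
  have card: "real (card (SIGMA \<sigma>:fibre \<tau>. {j \<in> legs J. \<sigma> (\<alpha>, j) = \<epsilon> / 2})) = multiplicity \<tau> * (J + \<epsilon> * \<tau> \<alpha>)"
    if "\<epsilon> = 1 \<or> \<epsilon> = - 1" for \<epsilon> \<tau>
  proof -
    have "real (rung_count \<epsilon> \<alpha> \<sigma>) = J + \<epsilon> * \<tau> \<alpha>" if "\<sigma> \<in> fibre \<tau>" for \<sigma>
      using that rung_count[OF _ assms(2) \<open>\<epsilon> = 1 \<or> \<epsilon> = - 1\<close>, of \<sigma>] rung_sums_apply[OF assms(2), of \<sigma>]
      by (auto simp: fibre_def)
    then have "(\<Sum>\<sigma>\<in>fibre \<tau>. real (rung_count \<epsilon> \<alpha> \<sigma>)) = multiplicity \<tau> * (J + \<epsilon> * \<tau> \<alpha>)"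
      by (simp add: multiplicity_def)
    then show ?thesis by (simp add: card_SigmaI finite_fibre rung_count_def)
  qed
  have \<epsilon>: "\<epsilon> * \<epsilon> = 1" using assms(3) by auto
  have "bij_betw (\<lambda>(\<sigma>, j). (\<sigma>((\<alpha>, j) := - \<epsilon> / 2), j)) A B"
  proof (rule bij_betwI[where g = "\<lambda>(\<sigma>, j). (\<sigma>((\<alpha>, j) := \<epsilon> / 2), j)"])
    show "(\<lambda>(\<sigma>, j). (\<sigma>((\<alpha>, j) := - \<epsilon> / 2), j)) \<in> A \<rightarrow> B"
    proof
      fix x assume "x \<in> A"
      then obtain \<sigma> j where x: "x = (\<sigma>, j)" "\<sigma> \<in> CC" "rung_sums \<sigma> = \<tau>" "j \<in> legs J" "\<sigma> (\<alpha>, j) = \<epsilon> / 2"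
        by (auto simp: A_def fibre_def)
      then show "(case x of (\<sigma>, j) \<Rightarrow> (\<sigma>((\<alpha>, j) := - \<epsilon> / 2), j)) \<in> B"
        using flip_CC[OF x(2) assms(2) x(4) assms(3)] rung_sums_flip[of \<alpha> j \<sigma> \<epsilon>, OF assms(2) x(4,5)]
        by (simp add: B_def fibre_def)
    qed
    show "(\<lambda>(\<sigma>, j). (\<sigma>((\<alpha>, j) := \<epsilon> / 2), j)) \<in> B \<rightarrow> A"
    proof
      fix x assume "x \<in> B"
      then obtain \<sigma> j where x: "x = (\<sigma>, j)" "\<sigma> \<in> CC" "rung_sums \<sigma> = ?\<tau>'" "j \<in> legs J" "\<sigma> (\<alpha>, j) = - \<epsilon> / 2"
        by (auto simp: B_def fibre_def)
      have "- \<epsilon> = 1 \<or> - \<epsilon> = - 1" using assms(3) by auto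
      from flip_CC[OF x(2) assms(2) x(4) this] rung_sums_flip[of \<alpha> j \<sigma> "- \<epsilon>", OF assms(2) x(4,5)]
      show "(case x of (\<sigma>, j) \<Rightarrow> (\<sigma>((\<alpha>, j) := \<epsilon> / 2), j)) \<in> A"
        using x by (simp add: A_def fibre_def)
    qed
  qed (auto simp: A_def B_def)
  then have "real (card A) = real (card B)" by (simp add: bij_betw_same_card)
  moreover have "- \<epsilon> = 1 \<or> - \<epsilon> = - 1" using assms(3) by auto
  \<comment> \<open>The count for \<open>- \<epsilon>\<close> on the shifted configuration is
    \<open>J - \<epsilon> * (\<tau> \<alpha> - \<epsilon>)\<close>, which is
    \<open>J - \<epsilon> * \<tau> \<alpha> + 1\<close> because
    \<open>\<epsilon> * \<epsilon> = 1\<close>.\<close>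
  ultimately show ?thesis
    using card[OF assms(3), of \<tau>] card[of "- \<epsilon>" ?\<tau>'] \<epsilon> unfolding A_def B_def by (simp add: algebra_simps)
qed

text \<open>A basis vector of the chain is sent to the normalized sum of the ladder basis vectors in its fibre.\<close>

definition embed :: "nat vect \<Rightarrow> (nat \<times> nat) vect" where
  "embed \<psi> = (\<lambda>\<sigma>. if \<sigma> \<in> CC then complex_of_real (1 / sqrt (multiplicity (rung_sums \<sigma>))) * \<psi> (rung_sums \<sigma>) else 0)"

lemma embed_TT: "embed \<psi> \<in> TT"
  by (simp add: embed_def tensor_space_def)

lemma embed_Sym: "embed \<psi> \<in> Sym"
  unfolding Sym_rung_sums using embed_TT by (auto simp: embed_def)

text \<open>Each fibre of \<open>rung_sums\<close> contributes its size times the square of the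
  normalization, that is 1.\<close>

lemma embed_isometry: "ip CC (embed \<phi>) (embed \<psi>) = ip chain_configs \<phi> \<psi>"
proof -
  define f where "f \<sigma> = cnj (embed \<phi> \<sigma>) * embed \<psi> \<sigma>" for \<sigma>
  have "ip CC (embed \<phi>) (embed \<psi>) = sum f CC" by (simp add: ip_def f_def)
  also have "\<dots> = (\<Sum>\<tau>\<in>chain_configs. sum f {\<sigma>\<in>CC. rung_sums \<sigma> = \<tau>})"
  proof (rule sum.group[symmetric])
    show "rung_sums ` CC \<subseteq> chain_configs" using rung_sums_configs by blast
  qed simp_all
  also have "\<dots> = (\<Sum>\<tau>\<in>chain_configs. cnj (\<phi> \<tau>) * \<psi> \<tau>)"
  proof (intro sum.cong refl)
    fix \<tau> assume \<tau>: "\<tau> \<in> chain_configs"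
    have m: "multiplicity \<tau> > 0" by (rule multiplicity_pos[OF \<tau>])
    have "f \<sigma> = complex_of_real (1 / multiplicity \<tau>) * (cnj (\<phi> \<tau>) * \<psi> \<tau>)" if "\<sigma> \<in> {\<sigma>\<in>CC. rung_sums \<sigma> = \<tau>}" for \<sigma>
    proof -
      have "1 / sqrt (multiplicity \<tau>) * (1 / sqrt (multiplicity \<tau>)) = 1 / multiplicity \<tau>" using m by simp
      then have "complex_of_real (1 / sqrt (multiplicity \<tau>)) * complex_of_real (1 / sqrt (multiplicity \<tau>)) = complex_of_real (1 / multiplicity \<tau>)"
        by (metis of_real_mult)
      then show ?thesis using that by (simp add: f_def embed_def mult_ac)
    qed
    then have "sum f {\<sigma>\<in>CC. rung_sums \<sigma> = \<tau>} = of_nat (card (fibre \<tau>)) * (complex_of_real (1 / multiplicity \<tau>) * (cnj (\<phi> \<tau>) * \<psi> \<tau>))"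
      by (simp add: fibre_def)
    also have "\<dots> = cnj (\<phi> \<tau>) * \<psi> \<tau>"
      using m by (simp add: multiplicity_def)
    finally show "sum f {\<sigma>\<in>CC. rung_sums \<sigma> = \<tau>} = cnj (\<phi> \<tau>) * \<psi> \<tau>" .
  qed
  finally show ?thesis by (simp add: ip_def)
qed

text \<open>The \<open>N\<close> legs that can be flipped all give the same value, so the sum
  carries the factor \<open>N / sqrt (multiplicity \<tau>')\<close>. The ratio of multiplicities
  turns it into \<open>sqrt (N * D) / sqrt (multiplicity \<tau>)\<close>, and \<open>N * D\<close>
  is the radicand in the spin \<open>J\<close> matrix element.\<close>

lemma embed_ladder_op:
  assumes "\<psi> \<in> chain_tensors" "\<alpha> \<in> {1..L}" "\<epsilon> = 1 \<or> \<epsilon> = - 1" "\<sigma> \<in> CC"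
  shows "(\<Sum>j\<in>legs J. site_op (1/2) (ladder_op \<epsilon> (1/2)) (\<alpha>, j) (embed \<psi>) \<sigma>) =
    embed (site_op J (ladder_op \<epsilon> J) \<alpha> \<psi>) \<sigma>"
proof -
  define \<tau> where "\<tau> = rung_sums \<sigma>"
  define \<tau>' where "\<tau>' = \<tau>(\<alpha> := \<tau> \<alpha> - \<epsilon>)"
  define N where "N = real (rung_count \<epsilon> \<alpha> \<sigma>)"
  define D where "D = J - \<epsilon> * \<tau> \<alpha> + 1"
  have \<epsilon>: "\<epsilon> * \<epsilon> = 1" using assms(3) by auto
  have \<tau>: "\<tau> \<in> chain_configs" unfolding \<tau>_def by (rule rung_sums_configs[OF assms(4)])
  have N: "N = J + \<epsilon> * \<tau> \<alpha>" unfolding N_def \<tau>_def rung_sums_apply[OF assms(2)] by (rule rung_count[OF assms(4,2,3)])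
  have ND: "J * (J + 1) - (\<tau> \<alpha> - \<epsilon>) * \<tau> \<alpha> = N * D"
    unfolding N D_def using \<epsilon> by algebra
  have flip_term: "site_op (1/2) (ladder_op \<epsilon> (1/2)) (\<alpha>, j) (embed \<psi>) \<sigma> =
      (if \<sigma> (\<alpha>, j) = \<epsilon> / 2 then complex_of_real (1 / sqrt (multiplicity \<tau>')) * \<psi> \<tau>' else 0)" if j: "j \<in> legs J" for j
  proof -
    have V: "(\<alpha>, j) \<in> V" using assms(2) j by (simp add: V_iff)
    note ap = ladder_op_apply[OF assms(3) V embed_TT, of \<psi> \<sigma>]
    consider (flip) "\<sigma> (\<alpha>, j) = \<epsilon> / 2" | (zero) "\<sigma> (\<alpha>, j) = - \<epsilon> / 2" "\<sigma> (\<alpha>, j) \<noteq> \<epsilon> / 2"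
      using configs_half_cases[OF assms(4) V] assms(3) by force
    then show ?thesis
    proof cases
      case flip
      have "1/2 * (1/2 + 1) - (\<sigma> (\<alpha>, j) - \<epsilon>) * \<sigma> (\<alpha>, j) = 1" unfolding flip using \<epsilon> by (simp add: algebra_simps)
      moreover have "\<sigma> (\<alpha>, j) - \<epsilon> = - \<epsilon> / 2" unfolding flip by simp
      ultimately have "site_op (1/2) (ladder_op \<epsilon> (1/2)) (\<alpha>, j) (embed \<psi>) \<sigma> = embed \<psi> (\<sigma>((\<alpha>, j) := - \<epsilon> / 2))"
        using ap by simp
      also have "\<dots> = complex_of_real (1 / sqrt (multiplicity \<tau>')) * \<psi> \<tau>'"
        using flip_CC[OF assms(4,2) j assms(3)] rung_sums_flip[of \<alpha> j \<sigma> \<epsilon>, OF assms(2) j flip]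
        unfolding embed_def \<tau>'_def \<tau>_def by simp
      finally show ?thesis using flip by simp
    next
      case zero
      have "1/2 * (1/2 + 1) - (\<sigma> (\<alpha>, j) - \<epsilon>) * \<sigma> (\<alpha>, j) = 0" unfolding zero(1) using \<epsilon> by (simp add: algebra_simps)
      then show ?thesis using ap zero(2) by simp
    qed
  qed
  have "(\<Sum>j\<in>legs J. site_op (1/2) (ladder_op \<epsilon> (1/2)) (\<alpha>, j) (embed \<psi>) \<sigma>) =
      complex_of_real N * (complex_of_real (1 / sqrt (multiplicity \<tau>')) * \<psi> \<tau>')"
    unfolding N_def rung_count_def using flip_term by (simp add: sum.If_cases Int_def)
  \<comment> \<open>For \<open>N = 0\<close> the label \<open>\<tau>'\<close> leaves the admissible
    range and its multiplicity is no longer positive, but both sides carry a factor 0.\<close>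
  also have "\<dots> = complex_of_real (1 / sqrt (multiplicity \<tau>)) * (complex_of_real (sqrt (N * D)) * \<psi> \<tau>')"
  proof (cases "N = 0")
    case False
    then have "rung_count \<epsilon> \<alpha> \<sigma> \<noteq> 0" by (simp add: N_def)
    then obtain j where j: "j \<in> legs J" "\<sigma> (\<alpha>, j) = \<epsilon> / 2" unfolding rung_count_def by (auto simp: card_eq_0_iff)
    have \<tau>': "\<tau>' \<in> chain_configs"
      using rung_sums_configs[OF flip_CC[OF assms(4,2) j(1) assms(3)]] rung_sums_flip[of \<alpha> j \<sigma> \<epsilon>, OF assms(2) j]
      unfolding \<tau>'_def \<tau>_def by simp
    have m: "multiplicity \<tau> > 0" "multiplicity \<tau>' > 0" by (intro multiplicity_pos \<tau> \<tau>')+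
    have Npos: "N > 0" using False by (simp add: N_def)
    have step: "multiplicity \<tau> * N = multiplicity \<tau>' * D"
      using multiplicity_step[OF \<tau> assms(2,3)] unfolding N D_def \<tau>'_def .
    have "N / sqrt (multiplicity \<tau>') = sqrt (N * N / multiplicity \<tau>')"
      using Npos by (simp add: real_sqrt_divide)
    also have "N * N / multiplicity \<tau>' = N * D / multiplicity \<tau>"
      using step m by (simp add: field_simps)
    also have "sqrt \<dots> = 1 / sqrt (multiplicity \<tau>) * sqrt (N * D)"
      by (simp add: real_sqrt_divide)
    finally have "N * (1 / sqrt (multiplicity \<tau>')) = 1 / sqrt (multiplicity \<tau>) * sqrt (N * D)" by simp
    then show ?thesis unfolding mult.assoc[symmetric] of_real_mult[symmetric] by simp
  qed simp
  also have "\<dots> = embed (site_op J (ladder_op \<epsilon> J) \<alpha> \<psi>) \<sigma>"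
    using assms(4) ladder_op_apply[OF assms(3,2,1), of \<tau>] unfolding ND embed_def \<tau>_def[symmetric] \<tau>'_def[symmetric] by simp
  finally show ?thesis .
qed

section \<open>The embedding intertwines chain and ladder operators\<close>

lemma embed_add: "embed (\<lambda>\<tau>. f \<tau> + g \<tau>) \<sigma> = embed f \<sigma> + embed g \<sigma>"
  by (simp add: embed_def add_divide_distrib)

lemma embed_diff: "embed (\<lambda>\<tau>. f \<tau> - g \<tau>) \<sigma> = embed f \<sigma> - embed g \<sigma>"
  by (simp add: embed_def diff_divide_distrib)

lemma embed_scale: "embed (\<lambda>\<tau>. c * f \<tau>) \<sigma> = c * embed f \<sigma>"
  by (simp add: embed_def)

lemma embed_sum: "embed (\<lambda>\<tau>. \<Sum>i\<in>I. f i \<tau>) \<sigma> = (\<Sum>i\<in>I. embed (f i) \<sigma>)"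
  by (simp add: embed_def sum_distrib_left)

lemma spin12_ladder_op:
  "site_op s (spin1 s) u \<psi> = (\<lambda>\<sigma>. (1/2) * (site_op s (ladder_op 1 s) u \<psi> \<sigma> + site_op s (ladder_op (- 1) s) u \<psi> \<sigma>))"
  "site_op s (spin2 s) u \<psi> = (\<lambda>\<sigma>. (1 / (2 * \<i>)) * (site_op s (ladder_op 1 s) u \<psi> \<sigma> - site_op s (ladder_op (- 1) s) u \<psi> \<sigma>))"
  by (simp_all add: fun_eq_iff site_op_spin1 site_op_spin2 ladder_op_def)

lemma embed_spins:
  assumes "\<psi> \<in> chain_tensors" "\<alpha> \<in> {1..L}"
  shows "(\<lambda>\<sigma>. \<Sum>j\<in>legs J. S1 (1/2) (\<alpha>, j) (embed \<psi>) \<sigma>) = embed (S1 J \<alpha> \<psi>)" (is ?one)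
    and "(\<lambda>\<sigma>. \<Sum>j\<in>legs J. S2 (1/2) (\<alpha>, j) (embed \<psi>) \<sigma>) = embed (S2 J \<alpha> \<psi>)" (is ?two)
    and "(\<lambda>\<sigma>. \<Sum>j\<in>legs J. S3 (1/2) (\<alpha>, j) (embed \<psi>) \<sigma>) = embed (S3 J \<alpha> \<psi>)" (is ?three)
proof -
  have V: "(\<alpha>, j) \<in> V" if "j \<in> legs J" for j using assms(2) that by (simp add: V_iff)
  have out: "embed f \<sigma> = 0" if "\<sigma> \<notin> CC" for f \<sigma> using that by (simp add: embed_def)
  have sout: "S1 (1/2) (\<alpha>, j) (embed \<psi>) \<sigma> = 0" "S2 (1/2) (\<alpha>, j) (embed \<psi>) \<sigma> = 0" "S3 (1/2) (\<alpha>, j) (embed \<psi>) \<sigma> = 0"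
    if "j \<in> legs J" "\<sigma> \<notin> CC" for j \<sigma>
    using tensor_space_vanish[OF _ that(2)] site_op_tensor_space[OF half_half V[OF that(1)] embed_TT, of \<psi>] by blast+
  have "(\<Sum>j\<in>legs J. S1 (1/2) (\<alpha>, j) (embed \<psi>) \<sigma>) = embed (S1 J \<alpha> \<psi>) \<sigma>" for \<sigma>
  proof (cases "\<sigma> \<in> CC")
    case True
    show ?thesis
      unfolding spin12_ladder_op sum_distrib_left[symmetric] sum.distrib embed_scale embed_add
      using embed_ladder_op[OF assms _ True, of 1] embed_ladder_op[OF assms _ True, of "- 1"] by simp
  qed (simp add: out sout)
  then show ?one by blast
  have "(\<Sum>j\<in>legs J. S2 (1/2) (\<alpha>, j) (embed \<psi>) \<sigma>) = embed (S2 J \<alpha> \<psi>) \<sigma>" for \<sigma>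
  proof (cases "\<sigma> \<in> CC")
    case True
    show ?thesis
      unfolding spin12_ladder_op sum_distrib_left[symmetric] sum_subtractf embed_scale embed_diff
      using embed_ladder_op[OF assms _ True, of 1] embed_ladder_op[OF assms _ True, of "- 1"] by simp
  qed (simp add: out sout)
  then show ?two by blast
  have "(\<Sum>j\<in>legs J. S3 (1/2) (\<alpha>, j) (embed \<psi>) \<sigma>) = embed (S3 J \<alpha> \<psi>) \<sigma>" for \<sigma>
  proof (cases "\<sigma> \<in> CC")
    case True
    have "(\<Sum>j\<in>legs J. S3 (1/2) (\<alpha>, j) (embed \<psi>) \<sigma>) = (\<Sum>j\<in>legs J. complex_of_real (\<sigma> (\<alpha>, j)) * embed \<psi> \<sigma>)"
      by (intro sum.cong refl) (rule S3_apply[OF V embed_TT])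
    also have "\<dots> = complex_of_real (rung_sums \<sigma> \<alpha>) * embed \<psi> \<sigma>"
      unfolding rung_sums_apply[OF assms(2)] rung_sum_def of_real_sum sum_distrib_right ..
    also have "\<dots> = embed (S3 J \<alpha> \<psi>) \<sigma>"
      using True by (simp add: embed_def S3_apply[OF assms(2,1)])
    finally show ?thesis .
  qed (simp add: out sout)
  then show ?three by blast
qed

text \<open>By linearity the inner sum is itself an embedded chain vector, so the one-spin identity
  applies a second time.\<close>

lemma embed_two_spins:
  assumes "\<psi> \<in> chain_tensors" "\<alpha> \<in> {1..L}" "\<beta> \<in> {1..L}"
  shows "(\<Sum>j\<in>legs J. \<Sum>k\<in>legs J. S1 (1/2) (\<alpha>, j) (S1 (1/2) (\<beta>, k) (embed \<psi>)) \<sigma>) = embed (S1 J \<alpha> (S1 J \<beta> \<psi>)) \<sigma>"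
    and "(\<Sum>j\<in>legs J. \<Sum>k\<in>legs J. S2 (1/2) (\<alpha>, j) (S2 (1/2) (\<beta>, k) (embed \<psi>)) \<sigma>) = embed (S2 J \<alpha> (S2 J \<beta> \<psi>)) \<sigma>"
    and "(\<Sum>j\<in>legs J. \<Sum>k\<in>legs J. S3 (1/2) (\<alpha>, j) (S3 (1/2) (\<beta>, k) (embed \<psi>)) \<sigma>) = embed (S3 J \<alpha> (S3 J \<beta> \<psi>)) \<sigma>"
proof -
  have inner: "(\<Sum>k\<in>legs J. site_op (1/2) A u (f k) \<sigma>) = site_op (1/2) A u (\<lambda>\<sigma>. \<Sum>k\<in>legs J. f k \<sigma>) \<sigma>" for A u f
    unfolding site_op_sum ..
  note T = site_op_tensor_space[OF twice_J assms(3,1)]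
  show "(\<Sum>j\<in>legs J. \<Sum>k\<in>legs J. S1 (1/2) (\<alpha>, j) (S1 (1/2) (\<beta>, k) (embed \<psi>)) \<sigma>) = embed (S1 J \<alpha> (S1 J \<beta> \<psi>)) \<sigma>"
    unfolding inner embed_spins(1)[OF assms(1,3)] using fun_cong[OF embed_spins(1)[OF T(1) assms(2)], of \<sigma>] .
  show "(\<Sum>j\<in>legs J. \<Sum>k\<in>legs J. S2 (1/2) (\<alpha>, j) (S2 (1/2) (\<beta>, k) (embed \<psi>)) \<sigma>) = embed (S2 J \<alpha> (S2 J \<beta> \<psi>)) \<sigma>"
    unfolding inner embed_spins(2)[OF assms(1,3)] using fun_cong[OF embed_spins(2)[OF T(2) assms(2)], of \<sigma>] .
  show "(\<Sum>j\<in>legs J. \<Sum>k\<in>legs J. S3 (1/2) (\<alpha>, j) (S3 (1/2) (\<beta>, k) (embed \<psi>)) \<sigma>) = embed (S3 J \<alpha> (S3 J \<beta> \<psi>)) \<sigma>"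
    unfolding inner embed_spins(3)[OF assms(1,3)] using fun_cong[OF embed_spins(3)[OF T(3) assms(2)], of \<sigma>] .
qed

text \<open>Summing over both rungs turns the products of spins 1/2 into products of total spins.
  The constants match as well: \<open>n * n\<close> copies of 1/4 add up to
  \<open>J\<^sup>2\<close>, and in the boundary term the free leg index turns the prefactor 1/2 into
  \<open>n / 2 = J\<close>.\<close>

lemma embed_h_op:
  assumes "\<psi> \<in> chain_tensors" "\<alpha> \<in> {1..L}" "\<beta> \<in> {1..L}"
  shows "(\<Sum>j\<in>legs J. \<Sum>k\<in>legs J. h (\<alpha>, j) (\<beta>, k) (embed \<psi>) \<sigma>) = embed (h_op \<Delta> J \<alpha> \<beta> \<psi>) \<sigma>"
proof -
  have split_sums: "(\<Sum>j\<in>legs J. \<Sum>k\<in>legs J. a j k - b j k - c * (d j k + e j k) + f * g j k) =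
      (\<Sum>j\<in>legs J. \<Sum>k\<in>legs J. a j k) - (\<Sum>j\<in>legs J. \<Sum>k\<in>legs J. b j k)
      - c * ((\<Sum>j\<in>legs J. \<Sum>k\<in>legs J. d j k) + (\<Sum>j\<in>legs J. \<Sum>k\<in>legs J. e j k))
      + f * (\<Sum>j\<in>legs J. \<Sum>k\<in>legs J. g j k)" for a b d e g and c f :: complex
    by (simp only: sum.distrib sum_subtractf sum_distrib_left[symmetric])
  have card: "card (legs J) = n" by (simp add: legs)
  have s3: "(\<Sum>j\<in>legs J. \<Sum>k\<in>legs J. S3 (1/2) (\<alpha>, j) (embed \<psi>) \<sigma> - S3 (1/2) (\<beta>, k) (embed \<psi>) \<sigma>) =
      of_nat n * (embed (S3 J \<alpha> \<psi>) \<sigma> - embed (S3 J \<beta> \<psi>) \<sigma>)"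
    unfolding fun_cong[OF embed_spins(3)[OF assms(1,2)], of \<sigma>, symmetric]
      fun_cong[OF embed_spins(3)[OF assms(1,3)], of \<sigma>, symmetric]
    by (simp add: sum_subtractf card sum_distrib_left[symmetric] right_diff_distrib)
  have sq: "(\<Sum>j\<in>legs J. \<Sum>k\<in>legs J. complex_of_real ((1/2)\<^sup>2) * embed \<psi> \<sigma>) = complex_of_real (J\<^sup>2) * embed \<psi> \<sigma>"
    by (simp add: card) (simp add: J power2_eq_square)
  have co: "complex_of_real (1/2 * sqrt (1 - 1 / \<Delta>\<^sup>2)) * (of_nat n * x) = complex_of_real (J * sqrt (1 - 1 / \<Delta>\<^sup>2)) * x" for x
    by (simp add: J)
  have "(\<Sum>j\<in>legs J. \<Sum>k\<in>legs J. h (\<alpha>, j) (\<beta>, k) (embed \<psi>) \<sigma>) =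
      complex_of_real (J\<^sup>2) * embed \<psi> \<sigma> - embed (S3 J \<alpha> (S3 J \<beta> \<psi>)) \<sigma>
      - complex_of_real (1 / \<Delta>) * (embed (S1 J \<alpha> (S1 J \<beta> \<psi>)) \<sigma> + embed (S2 J \<alpha> (S2 J \<beta> \<psi>)) \<sigma>)
      + complex_of_real (J * sqrt (1 - 1 / \<Delta>\<^sup>2)) * (embed (S3 J \<alpha> \<psi>) \<sigma> - embed (S3 J \<beta> \<psi>) \<sigma>)"
    unfolding h_op_def split_sums embed_two_spins[OF assms] s3 sq co ..
  also have "\<dots> = embed (h_op \<Delta> J \<alpha> \<beta> \<psi>) \<sigma>"
    unfolding h_op_def embed_add embed_diff embed_scale ..
  finally show ?thesis .
qed

lemma embed_chain_ham:
  assumes "\<psi> \<in> chain_tensors"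
  shows "ladder_ham_full \<Delta> J L (embed \<psi>) = embed (chain_ham \<Delta> J L \<psi>)"
proof
  fix \<sigma>
  have "ladder_ham_full \<Delta> J L (embed \<psi>) \<sigma> = (\<Sum>\<alpha>\<in>{1..L - 1}. embed (h_op \<Delta> J \<alpha> (\<alpha> + 1) \<psi>) \<sigma>)"
    unfolding ladder_ham_full_def using L by (intro sum.cong refl embed_h_op[OF assms]) auto
  then show "ladder_ham_full \<Delta> J L (embed \<psi>) \<sigma> = embed (chain_ham \<Delta> J L \<psi>) \<sigma>"
    unfolding chain_ham_def embed_sum .
qed

section \<open>Ground spaces and the gap of the chain\<close>

lemma sum_rung_sums: "(\<Sum>\<alpha>\<in>{1..L}. rung_sums \<sigma> \<alpha>) = (\<Sum>u\<in>V. \<sigma> u)"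
  unfolding ladder_def rung_sums_def by (simp add: rung_sum_def sum.cartesian_product case_prod_eta)

lemma embed_ladder_space:
  assumes "\<psi> \<in> chain_space J L M"
  shows "embed \<psi> \<in> ladder_space J L M"
proof -
  have "\<forall>\<tau>\<in>chain_configs. \<psi> \<tau> \<noteq> 0 \<longrightarrow> (\<Sum>\<alpha>\<in>{1..L}. \<tau> \<alpha>) = M"
    using assms unfolding chain_space_def magnetization_space_iff[OF finite_atLeastAtMost] by blast
  then have "(\<Sum>u\<in>V. \<sigma> u) = M" if "\<sigma> \<in> CC" "embed \<psi> \<sigma> \<noteq> 0" for \<sigma>
    using that rung_sums_configs[OF that(1)] sum_rung_sums[of \<sigma>] by (auto simp: embed_def)
  then show ?thesis
    unfolding ladder_space_def magnetization_space_iff[OF finite_V] using embed_TT by blast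
qed

lemma embed_eq_0:
  assumes "\<psi> \<in> chain_tensors" "embed \<psi> = zero_vect"
  shows "\<psi> = zero_vect"
proof
  fix \<tau>
  show "\<psi> \<tau> = 0"
  proof (cases "\<tau> \<in> chain_configs")
    case True
    then obtain \<sigma> where "\<sigma> \<in> CC" "rung_sums \<sigma> = \<tau>" using fibre_nonempty by (auto simp: fibre_def)
    then show ?thesis using fun_cong[OF assms(2), of \<sigma>] multiplicity_pos[OF True] by (simp add: embed_def)
  qed (rule tensor_space_vanish[OF assms(1)])
qed

text \<open>A symmetric vector is constant on fibres, so reading it at one chosen point of each
  fibre and undoing the normalization gives a preimage. Its energy vanishes because the embedding is
  injective and intertwines the Hamiltonians.\<close>

lemma ladder_ground_embed:
  assumes "g \<in> ladder_ground \<Delta> J L M"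
  obtains g' where "g' \<in> chain_ground \<Delta> J L M" "embed g' = g"
proof -
  have g: "g \<in> ladder_space J L M" "ladder_ham_full \<Delta> J L g = zero_vect" "g \<in> Sym"
    using assms ladder_ground_subset_Sym by (auto simp: ladder_ground_def)
  define pick where "pick \<tau> = (SOME \<sigma>. \<sigma> \<in> fibre \<tau>)" for \<tau>
  have pick: "pick \<tau> \<in> CC" "rung_sums (pick \<tau>) = \<tau>" if "\<tau> \<in> chain_configs" for \<tau>
    using fibre_nonempty[OF that] some_in_eq[of "fibre \<tau>"] unfolding pick_def by (auto simp: fibre_def)
  define g' where "g' \<tau> = (if \<tau> \<in> chain_configs then complex_of_real (sqrt (multiplicity \<tau>)) * g (pick \<tau>) else 0)" for \<tau>
  have T: "g' \<in> chain_tensors" by (simp add: g'_def tensor_space_def)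
  have "embed g' \<sigma> = g \<sigma>" for \<sigma>
  proof (cases "\<sigma> \<in> CC")
    case True
    define \<tau> where "\<tau> = rung_sums \<sigma>"
    have \<tau>: "\<tau> \<in> chain_configs" unfolding \<tau>_def by (rule rung_sums_configs[OF True])
    have "g (pick \<tau>) = g \<sigma>" using g(3) pick[OF \<tau>] True unfolding Sym_rung_sums \<tau>_def by blast
    then show ?thesis
      using True \<tau> multiplicity_pos[OF \<tau>] unfolding embed_def g'_def \<tau>_def[symmetric] by simp
  next
    case False
    then show ?thesis using ladder_space_outside[OF g(1) False] by (simp add: embed_def)
  qed
  then have eq: "embed g' = g" by blast
  have "(\<Sum>\<alpha>\<in>{1..L}. \<tau> \<alpha>) = M" if "\<tau> \<in> chain_configs" "g' \<tau> \<noteq> 0" for \<tau>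
  proof -
    have "g (pick \<tau>) \<noteq> 0" using that by (auto simp: g'_def)
    then have "(\<Sum>u\<in>V. pick \<tau> u) = M"
      using g(1) pick(1)[OF that(1)] unfolding ladder_space_def magnetization_space_iff[OF finite_V] by blast
    then show ?thesis using sum_rung_sums[of "pick \<tau>"] pick(2)[OF that(1)] by simp
  qed
  then have space: "g' \<in> chain_space J L M"
    unfolding chain_space_def magnetization_space_iff[OF finite_atLeastAtMost] using T by blast
  have hT: "chain_ham \<Delta> J L g' \<in> chain_tensors"
    unfolding chain_ham_def using L
    by (intro lin_sub_sum lin_sub_tensor_space h_op_tensor_space[OF twice_J _ _ T]) auto
  have "chain_ham \<Delta> J L g' = zero_vect"
    by (rule embed_eq_0[OF hT]) (use embed_chain_ham[OF T] eq g(2) in simp)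
  then show ?thesis using that eq space by (simp add: chain_ground_def)
qed

text \<open>Each competitor in the infimum embeds isometrically as a symmetric ladder vector to
  which the ladder bound applies; the factor \<open>2 * J\<close> is the ratio of coupled to
  uncoupled energy. If there is no competitor, the infimum is infinite and the bound is
  trivial.\<close>

lemma gap_ge: "ereal (2 * J * (1 - 1 / \<Delta>) * (1 - sup_overlap \<Delta> J L M)) \<le> gap \<Delta> J L M"
  unfolding gap_def
proof (rule INF_greatest)
  fix \<psi> assume "\<psi> \<in> {\<psi> \<in> chain_space J L M. \<psi> \<noteq> zero_vect \<and> orth_to {1..L} J \<psi> (chain_ground \<Delta> J L M)}"
  then have \<psi>: "\<psi> \<in> chain_space J L M" "\<psi> \<noteq> zero_vect" "orth_to {1..L} J \<psi> (chain_ground \<Delta> J L M)" by auto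
  have T: "\<psi> \<in> chain_tensors" using \<psi>(1) by (simp add: chain_space_def magnetization_space_def)
  have "ip CC g (embed \<psi>) = 0" if g: "g \<in> ladder_ground \<Delta> J L M" for g
  proof -
    obtain g' where "g' \<in> chain_ground \<Delta> J L M" "embed g' = g" using ladder_ground_embed[OF g] .
    then show ?thesis using \<psi>(3) embed_isometry[of g' \<psi>] unfolding orth_to_def braket_ip by simp
  qed
  then have orth: "ladder_orth J L (embed \<psi>) (ladder_ground \<Delta> J L M)" by (simp add: orth_to_def braket_ip)
  have "embed \<psi> \<noteq> zero_vect" using embed_eq_0[OF T] \<psi>(2) by blast
  then have pos: "0 < Re (ip CC (embed \<psi>) (embed \<psi>))" by (rule norm_pos[OF embed_TT])
  have "ip chain_configs \<psi> (chain_ham \<Delta> J L \<psi>) = ip CC (embed \<psi>) (ladder_ham_full \<Delta> J L (embed \<psi>))"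
    unfolding embed_chain_ham[OF T] embed_isometry ..
  also have "\<dots> = of_nat n * ip CC (embed \<psi>) (ladder_ham \<Delta> J L (embed \<psi>))"
    by (rule Sym_full_energy[OF embed_Sym])
  finally have "Re (ip chain_configs \<psi> (chain_ham \<Delta> J L \<psi>)) = real n * Re (ip CC (embed \<psi>) (ladder_ham \<Delta> J L (embed \<psi>)))"
    by simp
  moreover have "real n * ((1 - 1 / \<Delta>) * (1 - sup_overlap \<Delta> J L M) * Re (ip CC (embed \<psi>) (embed \<psi>)))
      \<le> real n * Re (ip CC (embed \<psi>) (ladder_ham \<Delta> J L (embed \<psi>)))"
    by (intro mult_left_mono Sym_energy_ge[OF embed_Sym embed_ladder_space[OF \<psi>(1)] orth]) simp
  ultimately have "2 * J * (1 - 1 / \<Delta>) * (1 - sup_overlap \<Delta> J L M) \<le> rayleigh {1..L} J (chain_ham \<Delta> J L) \<psi>"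
    using pos unfolding rayleigh_def braket_ip embed_isometry twice_J by (simp add: le_divide_eq mult_ac)
  then show "ereal (2 * J * (1 - 1 / \<Delta>) * (1 - sup_overlap \<Delta> J L M)) \<le> ereal (rayleigh {1..L} J (chain_ham \<Delta> J L) \<psi>)"
    by simp
qed

end

theorem lemma4p1:
  fixes J \<Delta> M :: real and L :: nat
  assumes "J \<in> half_nats"
    and "\<Delta> > 1"
    and "L \<ge> 2"
    and "M \<in> dint (- (J * real L)) (J * real L)"
  shows "(\<forall>\<psi>. \<psi> \<in> ladder_space J L M \<and> ladder_orth J L \<psi> (ladder_ground \<Delta> J L M) \<longrightarrow>
           (\<exists>\<psi>' \<psi>''. \<psi>' \<in> H0_perp \<Delta> J L M \<and> \<psi>'' \<in> Hexc \<Delta> J L M \<and>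
              P_lattice J L \<psi> = (\<lambda>\<sigma>. \<psi>' \<sigma> + \<psi>'' \<sigma>) \<and>
              (P_lattice J L \<psi> \<noteq> zero_vect \<longrightarrow>
                 ladder_rayleigh J L (ladder_ham \<Delta> J L) (P_lattice J L \<psi>)
                 \<ge> (1 - 1 / \<Delta>) *
                    (1 - (if \<psi>' = zero_vect then 0
                          else ladder_rayleigh J L (P_lattice J L) \<psi>')))))
       \<and> gap \<Delta> J L M \<ge> ereal (2 * J * (1 - 1 / \<Delta>) * (1 - sup_overlap \<Delta> J L M))"
proof -
  obtain n where "J = real n / 2" "n \<ge> 1" using assms(1) by (auto simp: half_nats_def)
  then interpret spin_ladder J \<Delta> L n using assms(2,3) by unfold_locales
  show ?thesis
    using projected_decomposition[of _ M] gap_ge[of M] unfolding overlap_def by blast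
qed

end
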